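(* Let $\alpha,\gamma,\theta>0$ satisfy $\alpha>2$ and $\theta<\min(\gamma,2)$, let $T>0$ and $H\in\mathcal{S}$. Then: (1) if $\theta<3/2$, $$\lim_{n\to\infty}\mathbb{E}\Big[\sup_{0\le t\le T}\Big(\int_0^tA^{n,4}_s(H)\,ds\Big)^2\Big]=0;$$ (2) if $\theta=3/2$, then for any $\varepsilon>0$, $$\limsup_{n\to\infty}\mathbb{E}\Big[\sup_{0\le t\le T}\Big(\int_0^t\Big\{A^{n,4}_s(H)-m\sum_{x\in\Lambda_n}\Big[\big(\bar\eta^{\varepsilon n}_x(s)\big)^2-\frac1{4\varepsilon n}\Big]H'(\tfrac xn)\Big\}ds\Big)^2\Big]\le CT\varepsilon\|\nabla H\|^2_{L^2([0,1])},$$ where $m=\sum_{y\in\mathbb{Z}}y\,p_\gamma(y)$ and $C$ is a finite constant independent of $\varepsilon$, $T$ and $H$.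
   Context: Model. Let $\Lambda_n=\{1,\dots,n-1\}$ and $\mathcal{X}_n=\{0,1\}^{\Lambda_n}$. For $x\in\mathbb{Z}$ let $s_\alpha(x)=|x|^{-1-\alpha}\mathbf{1}_{\{x\ne0\}}$ and $p_\gamma(x)=|x|^{-1-\gamma}\mathbf{1}_{\{x>0\}}$. For $\eta\in\mathcal{X}_n$, $\eta^{x,y}$ is $\eta$ with the values $\eta_x,\eta_y$ exchanged, and $\eta^x$ is $\eta$ with $\eta_x$ replaced by $1-\eta_x$. For $f:\mathcal{X}_n\to\mathbb{R}$, $$L_sf(\eta)=\sum_{x,y\in\Lambda_n}s_\alpha(x-y)[f(\eta^{x,y})-f(\eta)]+\tfrac12\sum_{x\in\Lambda_n,\,y\in\mathbb{Z}\setminus\Lambda_n}s_\alpha(x-y)[f(\eta^x)-f(\eta)],$$ $$L_af(\eta)=\sum_{x,y\in\Lambda_n}p_\gamma(y-x)\eta_x(1-\eta_y)[f(\eta^{x,y})-f(\eta)]+\tfrac12\sum_{x\in\Lambda_n,\,y\le0}p_\gamma(x-y)(1-\eta_x)[f(\eta^x)-f(\eta)]+\tfrac12\sum_{x\in\Lambda_n,\,y\ge n}p_\gamma(y-x)\eta_x[f(\eta^x)-f(\eta)].$$ $\nu_{1/2}$ is the product measure on $\mathcal{X}_n$ with $\nu_{1/2}(\eta_x=1)=1/2$, and $\eta(t)=\eta^n(t)$ is the Markov process with generator $L_n=n^2L_s+n^\theta L_a$ started from $\nu_{1/2}$; $\mathbb{E}$ is the corresponding expectation. $\bar\eta_x=\eta_x-1/2$.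 $\mathcal{S}=\{H\in\mathcal{C}^\infty([0,1]):H^{(i)}(0)=H^{(i)}(1)=0\ \forall i\ge0\}$; $\nabla H=H'$. Let $a_\gamma(x)=\frac{p_\gamma(x)-p_\gamma(-x)}2$ and $$A^{n,4}_s(H)=-\frac{n^\theta}{\sqrt n}\sum_{x,y\in\Lambda_n}a_\gamma(y-x)\big[H(\tfrac yn)-H(\tfrac xn)\big]\bar\eta_x(s)\bar\eta_y(s).$$ Block averages (with $\varepsilon n$ treated as an integer): $\eta^{\varepsilon n}_x=\frac1{\varepsilon n}\sum_{y=0}^{\varepsilon n-1}\eta_{x+y}$ for $x=1,\dots,n-\varepsilon n-1$, and $\eta^{\varepsilon n}_x=\frac1{\varepsilon n}\sum_{y=0}^{\varepsilon n-1}\eta_{x-y}$ for $x=n-\varepsilon n,\dots,n-1$; $\bar\eta^{\varepsilon n}_x=\eta^{\varepsilon n}_x-1/2$.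
   Formalization: In (2) the sign before m is corrected from minus to plus (with these definitions A^{n,4} is asymptotically −m times the block sum, so the printed bound fails), and ε is restricted to 0<ε≤1/2, since for ε>1/2 the block averages use sites outside Λ_n. *)

theory Defs
  imports "HOL-Probability.Probability"
begin

section \<open>Configurations\<close>

text \<open>Sites are integers.  A configuration is a function on \<open>Sites n\<close> with values in \<open>{0, 1}\<close>,
  represented as an extensional function (value \<open>undefined\<close> off \<open>Sites n\<close>).\<close>

type_synonym config = "int \<Rightarrow> real"

definition Sites :: "nat \<Rightarrow> int set" where
  "Sites n = {1..int n - 1}"

definition configs :: "nat \<Rightarrow> config set" where
  "configs n = (Sites n \<rightarrow>\<^sub>E {0, 1})"

definition swap :: "int \<Rightarrow> int \<Rightarrow> config \<Rightarrow> config" where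
  "swap x y \<eta> = \<eta>(x := \<eta> y, y := \<eta> x)"

definition flip :: "int \<Rightarrow> config \<Rightarrow> config" where
  "flip x \<eta> = \<eta>(x := 1 - \<eta> x)"

definition nu_half :: "nat \<Rightarrow> config pmf" where
  "nu_half n = Pi_pmf (Sites n) undefined (\<lambda>_. map_pmf of_bool (bernoulli_pmf (1/2)))"

definition centred :: "config \<Rightarrow> int \<Rightarrow> real" where
  "centred \<eta> x = \<eta> x - 1/2"


section \<open>The generator\<close>

definition s_rate :: "real \<Rightarrow> int \<Rightarrow> real" where
  "s_rate \<alpha> x = (if x \<noteq> 0 then real_of_int \<bar>x\<bar> powr (-1 - \<alpha>) else 0)"

definition p_rate :: "real \<Rightarrow> int \<Rightarrow> real" where
  "p_rate \<gamma> x = (if x > 0 then real_of_int \<bar>x\<bar> powr (-1 - \<gamma>) else 0)"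

definition a_rate :: "real \<Rightarrow> int \<Rightarrow> real" where
  "a_rate \<gamma> x = (p_rate \<gamma> x - p_rate \<gamma> (- x)) / 2"

definition mean_jump :: "real \<Rightarrow> real" where
  "mean_jump \<gamma> = (\<Sum>\<^sub>\<infinity>y\<in>(UNIV :: int set). of_int y * p_rate \<gamma> y)"

definition gen_sym :: "real \<Rightarrow> nat \<Rightarrow> (config \<Rightarrow> real) \<Rightarrow> config \<Rightarrow> real" where
  "gen_sym \<alpha> n f \<eta> =
     (\<Sum>x\<in>Sites n. \<Sum>y\<in>Sites n. s_rate \<alpha> (x - y) * (f (swap x y \<eta>) - f \<eta>))
   + 1/2 * (\<Sum>x\<in>Sites n. \<Sum>\<^sub>\<infinity>y\<in>- Sites n. s_rate \<alpha> (x - y) * (f (flip x \<eta>) - f \<eta>))"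

definition gen_asym :: "real \<Rightarrow> nat \<Rightarrow> (config \<Rightarrow> real) \<Rightarrow> config \<Rightarrow> real" where
  "gen_asym \<gamma> n f \<eta> =
     (\<Sum>x\<in>Sites n. \<Sum>y\<in>Sites n.
        p_rate \<gamma> (y - x) * \<eta> x * (1 - \<eta> y) * (f (swap x y \<eta>) - f \<eta>))
   + 1/2 * (\<Sum>x\<in>Sites n. \<Sum>\<^sub>\<infinity>y\<in>{..0}.
        p_rate \<gamma> (x - y) * (1 - \<eta> x) * (f (flip x \<eta>) - f \<eta>))
   + 1/2 * (\<Sum>x\<in>Sites n. \<Sum>\<^sub>\<infinity>y\<in>{int n..}.
        p_rate \<gamma> (y - x) * \<eta> x * (f (flip x \<eta>) - f \<eta>))"

definition generator ::
  "real \<Rightarrow> real \<Rightarrow> real \<Rightarrow> nat \<Rightarrow> (config \<Rightarrow> real) \<Rightarrow> config \<Rightarrow> real" where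
  "generator \<alpha> \<gamma> \<theta> n f \<eta> = real n ^ 2 * gen_sym \<alpha> n f \<eta> + real n powr \<theta> * gen_asym \<gamma> n f \<eta>"


section \<open>Markov processes with a given generator\<close>

text \<open>The semigroup \<open>exp (t L)\<close>; the series converges on \<open>E\<close> whenever \<open>E\<close> is finite and
  \<open>L f\<close> on \<open>E\<close> is linear in, and only depends on, the restriction of \<open>f\<close> to \<open>E\<close>.\<close>

definition semigroup_of ::
  "(('s \<Rightarrow> real) \<Rightarrow> 's \<Rightarrow> real) \<Rightarrow> real \<Rightarrow> ('s \<Rightarrow> real) \<Rightarrow> 's \<Rightarrow> real" where
  "semigroup_of L t f e = (\<Sum>k. t ^ k / fact k * (L ^^ k) f e)"

text \<open>\<open>X\<close> is a Markov process on the finite set \<open>E\<close> with initial law \<open>\<mu>\<close> and generator \<open>L\<close>, given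
  through its finite-dimensional distributions, with right-continuous paths having left limits
  for the discrete topology on \<open>E\<close>.  Only times \<open>t \<ge> 0\<close> matter.\<close>

definition markov_process ::
  "'a measure \<Rightarrow> (real \<Rightarrow> 'a \<Rightarrow> 's) \<Rightarrow> 's set \<Rightarrow> 's pmf \<Rightarrow> (('s \<Rightarrow> real) \<Rightarrow> 's \<Rightarrow> real) \<Rightarrow> bool" where
  "markov_process M X E \<mu> L \<longleftrightarrow>
     prob_space M \<and>
     (\<forall>t\<ge>0. X t \<in> M \<rightarrow>\<^sub>M count_space E) \<and>
     (\<forall>k (t :: nat \<Rightarrow> real) e.
        t 0 = 0 \<longrightarrow> (\<forall>i<k. t i \<le> t (Suc i)) \<longrightarrow> (\<forall>i\<le>k. e i \<in> E) \<longrightarrow>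
        measure M {\<omega> \<in> space M. \<forall>i\<le>k. X (t i) \<omega> = e i} =
          pmf \<mu> (e 0) * (\<Prod>i<k. semigroup_of L (t (Suc i) - t i) (indicat_real {e (Suc i)}) (e i))) \<and>
     (\<forall>\<omega>\<in>space M.
        (\<forall>t\<ge>0. \<forall>\<^sub>F s in at_right t. X s \<omega> = X t \<omega>) \<and>
        (\<forall>t>0. \<exists>e. \<forall>\<^sub>F s in at_left t. X s \<omega> = e))"

text \<open>\<open>E[sup\<^bsub>0 \<le> t \<le> T\<^esub> (\<integral>\<^sub>0\<^sup>t F s ds)\<^sup>2]\<close>, as an extended nonnegative number.\<close>

definition sup_sq_integral :: "'a measure \<Rightarrow> real \<Rightarrow> (real \<Rightarrow> 'a \<Rightarrow> real) \<Rightarrow> ennreal" where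
  "sup_sq_integral M T F =
     (\<integral>\<^sup>+ \<omega>. (SUP t\<in>{0..T}. ennreal ((integral {0..t} (\<lambda>s. F s \<omega>))\<^sup>2)) \<partial>M)"


section \<open>Test functions\<close>

text \<open>A function on \<open>[0, 1]\<close> is represented by any function on the reals extending it; derivatives
  at the end points are one-sided.\<close>

definition D01 :: "(real \<Rightarrow> real) \<Rightarrow> real \<Rightarrow> real" where
  "D01 H x = vector_derivative H (at x within {0..1})"

definition test_functions :: "(real \<Rightarrow> real) set" where
  "test_functions = {H. \<forall>i. (D01 ^^ i) H differentiable_on {0..1} \<and>
                            (D01 ^^ i) H 0 = 0 \<and> (D01 ^^ i) H 1 = 0}"

definition L2_norm_sq :: "(real \<Rightarrow> real) \<Rightarrow> real" where
  "L2_norm_sq f = integral {0..1} (\<lambda>x. (f x)\<^sup>2)"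


section \<open>The quadratic field and block averages\<close>

definition A4 :: "real \<Rightarrow> real \<Rightarrow> nat \<Rightarrow> (real \<Rightarrow> real) \<Rightarrow> config \<Rightarrow> real" where
  "A4 \<gamma> \<theta> n H \<eta> = - (real n powr \<theta> / sqrt (real n)) *
     (\<Sum>x\<in>Sites n. \<Sum>y\<in>Sites n. a_rate \<gamma> (y - x) * (H (of_int y / real n) - H (of_int x / real n))
        * centred \<eta> x * centred \<eta> y)"

text \<open>Integer block length standing for \<open>\<epsilon> n\<close>.\<close>

definition block_len :: "real \<Rightarrow> nat \<Rightarrow> nat" where
  "block_len \<epsilon> n = nat \<lfloor>\<epsilon> * real n\<rfloor>"

text \<open>Blocks of length \<open>l\<close> look to the right of \<open>x\<close>, except within distance \<open>l\<close> of the right end.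
  They stay inside \<open>Sites n\<close> for all sites \<open>x\<close> when \<open>2 * l \<le> n\<close>.\<close>

definition block_avg :: "nat \<Rightarrow> nat \<Rightarrow> config \<Rightarrow> int \<Rightarrow> real" where
  "block_avg n l \<eta> x =
     (if x \<le> int n - int l - 1 then (\<Sum>y<l. \<eta> (x + int y)) / real l
      else (\<Sum>y<l. \<eta> (x - int y)) / real l)"

definition block_field :: "nat \<Rightarrow> nat \<Rightarrow> (real \<Rightarrow> real) \<Rightarrow> config \<Rightarrow> real" where
  "block_field n l H \<eta> =
     (\<Sum>x\<in>Sites n. ((block_avg n l \<eta> x - 1/2)\<^sup>2 - 1 / (4 * real l)) * D01 H (of_int x / real n))"

text \<open>Sign convention: the sum of \<open>z * a_rate \<gamma> z\<close> over all integers \<open>z\<close> is \<open>mean_jump \<gamma>\<close>, so for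
  \<open>\<theta> = 3/2\<close>, because of the leading minus sign, \<open>A4\<close> is asymptotically \<open>- mean_jump \<gamma>\<close> times the
  block field.  The difference between \<open>A4\<close> and its approximation accordingly carries a plus sign.\<close>

definition A4_remainder ::
  "real \<Rightarrow> real \<Rightarrow> real \<Rightarrow> nat \<Rightarrow> (real \<Rightarrow> real) \<Rightarrow> config \<Rightarrow> real" where
  "A4_remainder \<gamma> \<theta> \<epsilon> n H \<eta> =
     A4 \<gamma> \<theta> n H \<eta> + mean_jump \<gamma> * block_field n (block_len \<epsilon> n) H \<eta>"

end

theory Submission
  imports Defs
begin

text \<open>The uniform measure is invariant, and the Dirichlet form of the generator dominates
  \<open>n\<^sup>2\<close> times that of nearest-neighbour stirring.  For a function \<open>F2\<close>
  with finite \<open>H\<^sub>-\<^sub>1\<close> norm, solve a resolvent equation for the symmetric part of the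
  generator; the time integral of \<open>F2\<close> is then, up to a small error, a forward plus a
  backward martingale (Kipnis--Varadhan, Lyons--Zheng), and Doob's inequality bounds its running
  maximum.  On a time grid all of this is a statement about finite sums over paths; the limit of
  fine grids is taken with Fatou's lemma.

  Statically, a quadratic polynomial \<open>\<Sum> c(x,y) \<eta>\<^sub>x \<eta>\<^sub>y\<close> of centred
  occupations is a mass distribution on pairs, and its squared \<open>H\<^sub>-\<^sub>1\<close> norm is at
  most \<open>n\<^sup>-\<^sup>2\<close> times the energy of any flow transporting the mass away.
  Moving, for each fixed \<open>x\<close>, the mass \<open>c(x, \<cdot>)\<close> to the uniform distribution on
  a row of length \<open>l\<close> costs \<open>l/n\<^sup>2\<close> times the sum of the squared masses.
  For \<open>\<theta> < 3/2\<close>, rows of length \<open>n/2\<close> suffice.  For \<open>\<theta> = 3/2\<close>,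
  rows of length \<open>\<epsilon> n\<close> are compared with the block field, since
  \<open>\<eta>\<^sub>x \<eta>\<^sup>l\<^sub>x\<close> is a uniform row up to its diagonal term, and
  \<open>(\<eta>\<^sub>x - \<eta>\<^sup>l\<^sub>x) \<eta>\<^sup>l\<^sub>x\<close> is again a flow, the block average being
  invariant under exchanges inside the block.\<close>

section \<open>Doob's inequality on path space\<close>

text \<open>The process is not reversible, and its asymmetric part carries the large prefactor
  \<open>n powr \<theta>\<close>. Solving an equation for the symmetric part alone is what removes
  it: the drifts of the forward and the backward martingale add up to twice the symmetric part, the
  antisymmetric parts cancel, and the asymmetric dynamics is never estimated. The resolvent
  parameter makes the equation solvable without a spectral gap; its cost vanishes with it at the
  end.

  The two regimes come from one balance. Spreading a mass D uniformly over a row of length l leaves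
  a field of variance \<open>D^2 / (16 * l)\<close>, in total of order n/l for n rows with D of
  order one, whereas the transport costs order \<open>l * n / n^2\<close>. No l \<le> n makes the
  first small. For \<theta> < 3/2 the coefficients carry a factor
  \<open>n powr (\<theta> - 3/2)\<close> which, as \<theta> < \<gamma>, beats both. For \<theta> =
  3/2 the row masses stay of order one: they approach \<open>- m * H'\<close>. Adding m times the
  block field leaves rows of almost zero mass, and only the transport cost, proportional to
  \<epsilon>, survives.\<close>

fun run_max :: "(nat \<Rightarrow> real) \<Rightarrow> nat \<Rightarrow> real" where
  "run_max M 0 = max 0 (M 0)"
| "run_max M (Suc n) = max (run_max M n) (M (Suc n))"

lemma run_max_ge: "j \<le> n \<Longrightarrow> M j \<le> run_max M n"
  by (induction n) (auto simp: le_Suc_eq max.coboundedI1)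

lemma run_max_cong: "(\<And>i. i \<le> n \<Longrightarrow> M i = M' i) \<Longrightarrow> run_max M n = run_max M' n"
  by (induction n) auto

text \<open>Pathwise form of Doob's inequality: for a martingale \<open>M\<close> the last sum has mean zero.\<close>

lemma run_max_doob:
  assumes "M 0 = 0"
  shows "(run_max M N)\<^sup>2 \<le> 4 * (M N)\<^sup>2 - 4 * (\<Sum>i<N. run_max M i * (M (Suc i) - M i))"
proof -
  \<comment> \<open>While the maximum m stays put, the increment enters linearly and both sides stay
    in step; when it rises to x, the gap gains the square of \<open>x - m\<close>.\<close>
  have *: "(run_max M N)\<^sup>2 \<le> 2 * M N * run_max M N - 2 * (\<Sum>i<N. run_max M i * (M (Suc i) - M i))"
  proof (induction N)
    case 0
    then show ?case using assms by simp
  next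
    case (Suc N)
    define m where "m = run_max M N"
    define x where "x = M (Suc N)"
    define A where "A = (\<Sum>i<N. run_max M i * (M (Suc i) - M i))"
    have IH: "m\<^sup>2 \<le> 2 * M N * m - 2 * A"
      using Suc by (simp add: m_def A_def)
    have "(max m x)\<^sup>2 \<le> 2 * x * max m x - 2 * (A + m * (x - M N))"
    proof (cases "x \<le> m")
      case True
      then show ?thesis using IH by (simp add: max_def algebra_simps power2_eq_square)
    next
      case False
      have "0 \<le> (x - m)\<^sup>2" by simp
      then show ?thesis using IH False by (simp add: max_def algebra_simps power2_eq_square)
    qed
    then show ?case by (simp add: m_def x_def A_def)
  qed
  \<comment> \<open>Young's inequality: half of the squared maximum is absorbed on the left, which
    is where Doob's constant 4 comes from.\<close>
  have "0 \<le> (2 * M N - run_max M N)\<^sup>2" by simp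
  then show ?thesis using * by (simp add: algebra_simps power2_eq_square)
qed

text \<open>Bounding a square needs the maxima of both \<open>M\<close> and \<open>- M\<close>; this
  doubles the constant in Doob's inequality.\<close>

lemma sq_le_run_max:
  assumes "j \<le> N"
  shows "(M j)\<^sup>2 \<le> (run_max M N)\<^sup>2 + (run_max (\<lambda>i. - M i) N)\<^sup>2"
proof (cases "M j \<ge> 0")
  case True
  then have "(M j)\<^sup>2 \<le> (run_max M N)\<^sup>2" using run_max_ge[OF assms, of M] by (simp add: power_mono)
  then show ?thesis by (simp add: add_increasing2)
next
  case False
  then have "(- M j)\<^sup>2 \<le> (run_max (\<lambda>i. - M i) N)\<^sup>2"
    using run_max_ge[OF assms, of "\<lambda>i. - M i"] by (intro power_mono) auto
  then show ?thesis by (simp add: add_increasing)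
qed

section \<open>Stationary averages over the paths of a finite chain\<close>

definition avg :: "'s set \<Rightarrow> ('s \<Rightarrow> real) \<Rightarrow> real" where
  "avg E f = (\<Sum>e\<in>E. f e) / real (card E)"

text \<open>The expectation over \<open>N\<close> steps of the chain with matrix \<open>P\<close>
  started from the uniform law. As a finite weighted sum over paths it keeps the martingale
  arguments free of measure theory.\<close>

definition path_mean :: "'s set \<Rightarrow> ('s \<Rightarrow> 's \<Rightarrow> real) \<Rightarrow> nat \<Rightarrow> ((nat \<Rightarrow> 's) \<Rightarrow> real) \<Rightarrow> real" where
  "path_mean E P N \<Phi> = (\<Sum>w\<in>PiE {..N} (\<lambda>_. E). (\<Prod>i<N. P (w i) (w (Suc i))) * \<Phi> w) / real (card E)"

text \<open>The column sums say that the uniform law is stationary; they also make the transposed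
  matrix a transition matrix, that of the chain run backwards.\<close>

locale doubly_stochastic =
  fixes E :: "'s set" and P :: "'s \<Rightarrow> 's \<Rightarrow> real"
  assumes finite_E: "finite E" and nonempty_E: "E \<noteq> {}"
    and nonneg: "\<And>e e'. e \<in> E \<Longrightarrow> e' \<in> E \<Longrightarrow> 0 \<le> P e e'"
    and row_sum: "\<And>e. e \<in> E \<Longrightarrow> (\<Sum>e'\<in>E. P e e') = 1"
    and col_sum: "\<And>e'. e' \<in> E \<Longrightarrow> (\<Sum>e\<in>E. P e e') = 1"
begin

lemma transpose_doubly_stochastic: "doubly_stochastic E (\<lambda>e e'. P e' e)"
  by unfold_locales (auto simp: finite_E nonempty_E nonneg row_sum col_sum)

lemma card_pos: "0 < card E"
  using finite_E nonempty_E by (simp add: card_gt_0_iff)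

lemma path_mean_cong:
  assumes "\<And>w. w \<in> PiE {..N} (\<lambda>_. E) \<Longrightarrow> \<Phi> w = \<Psi> w"
  shows "path_mean E P N \<Phi> = path_mean E P N \<Psi>"
  unfolding path_mean_def by (intro arg_cong2[where f="(/)"] sum.cong) (auto simp: assms)

lemma path_mean_mono:
  assumes "\<And>w. w \<in> PiE {..N} (\<lambda>_. E) \<Longrightarrow> \<Phi> w \<le> \<Psi> w"
  shows "path_mean E P N \<Phi> \<le> path_mean E P N \<Psi>"
  unfolding path_mean_def
proof (rule divide_right_mono, rule sum_mono, rule mult_left_mono)
  fix w assume w: "w \<in> PiE {..N} (\<lambda>_. E)"
  show "\<Phi> w \<le> \<Psi> w" by (rule assms[OF w])
  show "0 \<le> (\<Prod>i<N. P (w i) (w (Suc i)))"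
    by (rule prod_nonneg) (use PiE_mem[OF w] nonneg in simp)
qed simp

lemma path_mean_add: "path_mean E P N (\<lambda>w. \<Phi> w + \<Psi> w) = path_mean E P N \<Phi> + path_mean E P N \<Psi>"
  by (simp add: path_mean_def sum.distrib distrib_left add_divide_distrib)

lemma path_mean_diff: "path_mean E P N (\<lambda>w. \<Phi> w - \<Psi> w) = path_mean E P N \<Phi> - path_mean E P N \<Psi>"
  by (simp add: path_mean_def sum_subtractf right_diff_distrib diff_divide_distrib)

lemma path_mean_cmult: "path_mean E P N (\<lambda>w. c * \<Phi> w) = c * path_mean E P N \<Phi>"
  by (simp add: path_mean_def sum_distrib_left mult_ac)

lemma path_mean_sum: "path_mean E P N (\<lambda>w. \<Sum>i\<in>I. \<Phi> i w) = (\<Sum>i\<in>I. path_mean E P N (\<Phi> i))"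
  by (induction I rule: infinite_finite_induct)
    (simp_all add: path_mean_add path_mean_def sum.distrib distrib_left add_divide_distrib)

lemma path_mean_0: "path_mean E P 0 (\<lambda>w. h (w 0)) = avg E h"
proof -
  have "(\<Sum>w\<in>PiE {..0::nat} (\<lambda>_. E). h (w 0)) = (\<Sum>e\<in>E. h e)"
    by (rule sum.reindex_bij_witness[where i="\<lambda>e. restrict (\<lambda>_. e) {..0}" and j="\<lambda>w. w 0"])
      (auto simp: PiE_def extensional_def fun_eq_iff Pi_def)
  then show ?thesis by (simp add: path_mean_def avg_def)
qed

text \<open>Conditioning on the first \<open>N\<close> steps: a path with one more step is a shorter
  path together with a last state.\<close>

lemma path_mean_Suc:
  "path_mean E P (Suc N) \<Phi> = path_mean E P N (\<lambda>w. \<Sum>e\<in>E. P (w N) e * \<Phi> (w(Suc N := e)))"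
proof -
  have eq: "{..Suc N} = insert (Suc N) {..N}" by auto
  have *: "PiE {..Suc N} (\<lambda>_. E) = (\<lambda>(y, g). g(Suc N := y)) ` (E \<times> PiE {..N} (\<lambda>_. E))"
    unfolding eq by (rule PiE_insert_eq)
  have inj: "inj_on (\<lambda>(y, g). g(Suc N := y)) (E \<times> PiE {..N} (\<lambda>_. E))"
    using inj_combinator[of "Suc N" "{..N}" "\<lambda>_. E"] by simp
  have "(\<Sum>w\<in>PiE {..Suc N} (\<lambda>_. E). (\<Prod>i<Suc N. P (w i) (w (Suc i))) * \<Phi> w)
      = (\<Sum>(y, g)\<in>E \<times> PiE {..N} (\<lambda>_. E). (\<Prod>i<N. P (g i) (g (Suc i))) * (P (g N) y * \<Phi> (g(Suc N := y))))"
    unfolding * by (subst sum.reindex[OF inj]) (auto intro!: sum.cong simp: mult_ac)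
  also have "\<dots> = (\<Sum>g\<in>PiE {..N} (\<lambda>_. E). \<Sum>y\<in>E. (\<Prod>i<N. P (g i) (g (Suc i))) * (P (g N) y * \<Phi> (g(Suc N := y))))"
    by (subst sum.swap) (simp add: sum.cartesian_product)
  finally show ?thesis by (simp add: path_mean_def sum_distrib_left)
qed

lemma path_mean_Suc_const:
  assumes "\<And>w e. w \<in> PiE {..N} (\<lambda>_. E) \<Longrightarrow> e \<in> E \<Longrightarrow> \<Phi> (w(Suc N := e)) = \<Phi> w"
  shows "path_mean E P (Suc N) \<Phi> = path_mean E P N \<Phi>"
proof -
  have "(\<Sum>e\<in>E. P (w N) e * \<Phi> (w(Suc N := e))) = \<Phi> w" if w: "w \<in> PiE {..N} (\<lambda>_. E)" for w
  proof -
    have "(\<Sum>e\<in>E. P (w N) e * \<Phi> (w(Suc N := e))) = (\<Sum>e\<in>E. P (w N) e) * \<Phi> w"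
      by (simp add: sum_distrib_right assms[OF w])
    also have "(\<Sum>e\<in>E. P (w N) e) = 1" using w by (intro row_sum) (auto dest: PiE_mem)
    finally show ?thesis by (simp only: mult_1)
  qed
  then show ?thesis unfolding path_mean_Suc by (intro path_mean_cong) auto
qed

lemma avg_step: "avg E (\<lambda>e. \<Sum>e'\<in>E. P e e' * h e') = avg E h"
proof -
  have "(\<Sum>e\<in>E. \<Sum>e'\<in>E. P e e' * h e') = (\<Sum>e'\<in>E. (\<Sum>e\<in>E. P e e') * h e')"
    by (subst sum.swap) (simp add: sum_distrib_right)
  then show ?thesis by (simp add: avg_def col_sum)
qed

lemma path_mean_last: "path_mean E P N (\<lambda>w. h (w N)) = avg E h"
proof (induction N arbitrary: h)
  case 0
  then show ?case by (rule path_mean_0)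
next
  case (Suc N)
  have "path_mean E P (Suc N) (\<lambda>w. h (w (Suc N))) = path_mean E P N (\<lambda>w. \<Sum>e\<in>E. P (w N) e * h e)"
    by (simp add: path_mean_Suc)
  also have "\<dots> = avg E (\<lambda>e. \<Sum>e'\<in>E. P e e' * h e')"
    by (rule Suc)
  finally show ?case by (simp add: avg_step)
qed

lemma path_mean_at:
  assumes "k \<le> N" shows "path_mean E P N (\<lambda>w. h (w k)) = avg E h"
  using assms
proof (induction N)
  case 0
  then show ?case by (simp add: path_mean_0)
next
  case (Suc N)
  show ?case
  proof (cases "k = Suc N")
    case True
    then show ?thesis by (simp only: path_mean_last)
  next
    case False
    then have "k \<le> N" using Suc.prems by simp
    have "path_mean E P (Suc N) (\<lambda>w. h (w k)) = path_mean E P N (\<lambda>w. h (w k))"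
      using False by (intro path_mean_Suc_const) auto
    then show ?thesis using Suc.IH[OF \<open>k \<le> N\<close>] by simp
  qed
qed

lemma path_mean_const: "path_mean E P N (\<lambda>w. c) = c"
  using path_mean_last[of N "\<lambda>_. c"] card_pos by (simp add: avg_def)

definition step :: "('s \<Rightarrow> real) \<Rightarrow> 's \<Rightarrow> real" where
  "step g e = (\<Sum>e'\<in>E. P e e' * g e')"

text \<open>The Dynkin martingale of \<open>g\<close> along the path \<open>w\<close>: each
  increment is \<open>g\<close> minus its conditional expectation given the previous state.\<close>

definition mart :: "('s \<Rightarrow> real) \<Rightarrow> (nat \<Rightarrow> 's) \<Rightarrow> nat \<Rightarrow> real" where
  "mart g w j = (\<Sum>k<j. g (w (Suc k)) - step g (w k))"

text \<open>The mean conditional variance of one increment of \<open>mart g\<close>: by stationarity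
  the mean of the one-step average of \<open>g^2\<close> equals the mean of
  \<open>g^2\<close>.\<close>

definition step_var :: "('s \<Rightarrow> real) \<Rightarrow> real" where
  "step_var g = avg E (\<lambda>e. (g e)\<^sup>2 - (step g e)\<^sup>2)"

lemma mart_0 [simp]: "mart g w 0 = 0"
  by (simp add: mart_def)

lemma mart_upd [simp]: "j \<le> N \<Longrightarrow> mart g (w(Suc N := e)) j = mart g w j"
  unfolding mart_def by (intro sum.cong) auto

lemma mart_neg: "mart (\<lambda>e. - g e) w j = - mart g w j"
  by (simp add: mart_def step_def sum_negf sum_subtractf)

text \<open>Increments are centred given the past, so cross terms drop out, and by stationarity
  every step contributes the same amount.\<close>

lemma mart_sq: "path_mean E P N (\<lambda>w. (mart g w N)\<^sup>2) = N * step_var g"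
proof (induction N)
  case 0
  then show ?case by (simp add: path_mean_const)
next
  case (Suc N)
  have inner: "(\<Sum>e\<in>E. P (w N) e * (mart g (w(Suc N := e)) (Suc N))\<^sup>2)
      = (mart g w N)\<^sup>2 + ((\<Sum>e\<in>E. P (w N) e * (g e)\<^sup>2) - (step g (w N))\<^sup>2)"
    if w: "w \<in> PiE {..N} (\<lambda>_. E)" for w
  proof -
    let ?s = "step g (w N)"
    have wN: "w N \<in> E" using w by (auto dest: PiE_mem)
    have "mart g (w(Suc N := e)) (Suc N) = mart g w N + (g e - ?s)" for e
    proof -
      have "mart g (w(Suc N := e)) (Suc N) = mart g (w(Suc N := e)) N + (g e - ?s)"
        unfolding mart_def by (simp del: fun_upd_apply add: fun_upd_same fun_upd_other)
      then show ?thesis by simp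
    qed
    then have "(\<Sum>e\<in>E. P (w N) e * (mart g (w(Suc N := e)) (Suc N))\<^sup>2)
      = (\<Sum>e\<in>E. P (w N) e * ((mart g w N)\<^sup>2 - 2 * mart g w N * ?s + ?s\<^sup>2)
          + (2 * mart g w N - 2 * ?s) * (P (w N) e * g e) + P (w N) e * (g e)\<^sup>2)"
      by (simp only: ) (simp add: algebra_simps power2_eq_square)
    also have "\<dots> = (\<Sum>e\<in>E. P (w N) e) * ((mart g w N)\<^sup>2 - 2 * mart g w N * ?s + ?s\<^sup>2)
          + (2 * mart g w N - 2 * ?s) * ?s + (\<Sum>e\<in>E. P (w N) e * (g e)\<^sup>2)"
      by (simp add: sum.distrib sum_distrib_left sum_distrib_right step_def)
    finally show ?thesis by (simp add: row_sum[OF wN] algebra_simps power2_eq_square)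
  qed
  have "path_mean E P (Suc N) (\<lambda>w. (mart g w (Suc N))\<^sup>2)
      = path_mean E P N (\<lambda>w. (mart g w N)\<^sup>2 + ((\<Sum>e\<in>E. P (w N) e * (g e)\<^sup>2) - (step g (w N))\<^sup>2))"
    unfolding path_mean_Suc by (intro path_mean_cong inner)
  also have "\<dots> = N * step_var g + (avg E (\<lambda>e. \<Sum>e'\<in>E. P e e' * (g e')\<^sup>2) - avg E (\<lambda>e. (step g e)\<^sup>2))"
    unfolding path_mean_add path_mean_diff Suc
    using path_mean_last[of N "\<lambda>e. \<Sum>e'\<in>E. P e e' * (g e')\<^sup>2"] path_mean_last[of N "\<lambda>e. (step g e)\<^sup>2"]
    by simp
  also have "avg E (\<lambda>e. \<Sum>e'\<in>E. P e e' * (g e')\<^sup>2) = avg E (\<lambda>e. (g e)\<^sup>2)"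
    by (rule avg_step)
  finally have "path_mean E P (Suc N) (\<lambda>w. (mart g w (Suc N))\<^sup>2)
      = N * step_var g + (avg E (\<lambda>e. (g e)\<^sup>2) - avg E (\<lambda>e. (step g e)\<^sup>2))" .
  moreover have "avg E (\<lambda>e. (g e)\<^sup>2) - avg E (\<lambda>e. (step g e)\<^sup>2) = step_var g"
    by (simp add: step_var_def avg_def sum_subtractf diff_divide_distrib)
  ultimately show ?case by (simp only: of_nat_Suc) (simp add: distrib_right)
qed

text \<open>The running maximum at time \<open>i\<close> depends on the path up to time
  \<open>i\<close> only, while the next increment has conditional mean zero.\<close>

lemma mart_transform_zero:
  "path_mean E P N (\<lambda>w. \<Sum>i<N. run_max (mart g w) i * (mart g w (Suc i) - mart g w i)) = 0"
proof (induction N)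
  case 0
  then show ?case by (simp add: path_mean_const)
next
  case (Suc N)
  have "(\<Sum>e\<in>E. P (w N) e * (\<Sum>i<Suc N. run_max (mart g (w(Suc N := e))) i *
        (mart g (w(Suc N := e)) (Suc i) - mart g (w(Suc N := e)) i)))
      = (\<Sum>i<N. run_max (mart g w) i * (mart g w (Suc i) - mart g w i))"
    if w: "w \<in> PiE {..N} (\<lambda>_. E)" for w
  proof -
    let ?A = "\<Sum>i<N. run_max (mart g w) i * (mart g w (Suc i) - mart g w i)"
    let ?m = "run_max (mart g w) N"
    have wN: "w N \<in> E" using w by (auto dest: PiE_mem)
    have rm: "run_max (mart g (w(Suc N := e))) i = run_max (mart g w) i" if "i \<le> N" for i e
      using that by (intro run_max_cong) auto
    have "(\<Sum>i<Suc N. run_max (mart g (w(Suc N := e))) i *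
        (mart g (w(Suc N := e)) (Suc i) - mart g (w(Suc N := e)) i)) = ?A + ?m * (g e - step g (w N))" for e
    proof -
      have "mart g (w(Suc N := e)) (Suc N) - mart g (w(Suc N := e)) N = g e - step g (w N)"
        unfolding mart_def by simp
      then show ?thesis by (simp add: rm)
    qed
    then have "(\<Sum>e\<in>E. P (w N) e * (\<Sum>i<Suc N. run_max (mart g (w(Suc N := e))) i *
        (mart g (w(Suc N := e)) (Suc i) - mart g (w(Suc N := e)) i)))
      = (\<Sum>e\<in>E. P (w N) e * (?A - ?m * step g (w N)) + ?m * (P (w N) e * g e))"
      by (simp only: ) (simp add: algebra_simps)
    also have "\<dots> = (\<Sum>e\<in>E. P (w N) e) * (?A - ?m * step g (w N)) + ?m * step g (w N)"
      by (simp add: sum.distrib sum_distrib_left sum_distrib_right step_def)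
    finally show ?thesis by (simp add: row_sum[OF wN])
  qed
  then have "path_mean E P (Suc N) (\<lambda>w. \<Sum>i<Suc N. run_max (mart g w) i * (mart g w (Suc i) - mart g w i))
    = path_mean E P N (\<lambda>w. \<Sum>i<N. run_max (mart g w) i * (mart g w (Suc i) - mart g w i))"
    unfolding path_mean_Suc[of N] by (intro path_mean_cong) blast
  then show ?case using Suc by simp
qed

definition mart_max :: "('s \<Rightarrow> real) \<Rightarrow> nat \<Rightarrow> (nat \<Rightarrow> 's) \<Rightarrow> real" where
  "mart_max g N w = (run_max (mart g w) N)\<^sup>2 + (run_max (\<lambda>i. - mart g w i) N)\<^sup>2"

lemma mart_max_ge: "j \<le> N \<Longrightarrow> (mart g w j)\<^sup>2 \<le> mart_max g N w"
  unfolding mart_max_def by (rule sq_le_run_max)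

text \<open>The pathwise inequality is averaged once for \<open>g\<close> and once for
  \<open>- g\<close>; hence 8 = 2 * 4.\<close>

lemma doob: "path_mean E P N (mart_max g N) \<le> 8 * N * step_var g"
proof -
  have one: "path_mean E P N (\<lambda>w. (run_max (mart h w) N)\<^sup>2) \<le> 4 * N * step_var h" for h
  proof -
    have "path_mean E P N (\<lambda>w. (run_max (mart h w) N)\<^sup>2) \<le> path_mean E P N
        (\<lambda>w. 4 * (mart h w N)\<^sup>2 - 4 * (\<Sum>i<N. run_max (mart h w) i * (mart h w (Suc i) - mart h w i)))"
      by (intro path_mean_mono run_max_doob) simp
    also have "\<dots> = 4 * (N * step_var h) - 4 * 0"
      by (simp only: path_mean_diff path_mean_cmult mart_sq mart_transform_zero)
    also have "\<dots> = 4 * N * step_var h" by simp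
    finally show ?thesis .
  qed

  have "step_var (\<lambda>e. - g e) = step_var g"
    by (simp add: step_var_def step_def sum_negf)
  moreover have "mart (\<lambda>e. - g e) w = (\<lambda>i. - mart g w i)" for w
    by (rule ext) (rule mart_neg)
  ultimately have two: "path_mean E P N (\<lambda>w. (run_max (\<lambda>i. - mart g w i) N)\<^sup>2) \<le> 4 * N * step_var g"
    using one[of "\<lambda>e. - g e"] by (simp only:)
  have "path_mean E P N (mart_max g N) = path_mean E P N (\<lambda>w. (run_max (mart g w) N)\<^sup>2)
      + path_mean E P N (\<lambda>w. (run_max (\<lambda>i. - mart g w i) N)\<^sup>2)"
    by (subst path_mean_add[symmetric]) (rule path_mean_cong, simp add: mart_max_def)
  then show ?thesis using one[of g] two by linarith
qed

text \<open>Under a uniform initial law the weight of a path is, up to a constant, the bare product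
  of its transition entries, so reading the path backwards merely transposes the matrix.\<close>

lemma path_mean_reverse:
  "path_mean E P N \<Phi> = path_mean E (\<lambda>e e'. P e' e) N (\<lambda>w. \<Phi> (restrict (\<lambda>i. w (N - i)) {..N}))"
proof -
  let ?r = "\<lambda>w. restrict (\<lambda>i. w (N - i)) {..N} :: nat \<Rightarrow> 's"
  have rr: "?r (?r w) = w" if "w \<in> PiE {..N} (\<lambda>_. E)" for w
  proof
    fix i show "?r (?r w) i = w i"
    proof (cases "i \<le> N")
      case False
      then show ?thesis using PiE_arb[OF that, of i] by simp
    qed simp
  qed
  have mem: "?r w \<in> PiE {..N} (\<lambda>_. E)" if "w \<in> PiE {..N} (\<lambda>_. E)" for w
    by (rule restrict_PiE_iff[THEN iffD2]) (use PiE_mem[OF that] in simp)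
  have "(\<Sum>w\<in>PiE {..N} (\<lambda>_. E). (\<Prod>i<N. P (w i) (w (Suc i))) * \<Phi> w)
      = (\<Sum>w\<in>PiE {..N} (\<lambda>_. E). (\<Prod>i<N. P (w (Suc i)) (w i)) * \<Phi> (?r w))"
  proof (rule sum.reindex_bij_witness[where i="?r" and j="?r"])
    fix w assume w: "w \<in> PiE {..N} (\<lambda>_. E)"
    have "(\<Prod>i<N. P (?r w (Suc i)) (?r w i)) = (\<Prod>i<N. P (w (N - Suc i)) (w (Suc (N - Suc i))))"
      by (intro prod.cong) (auto simp: Suc_diff_Suc)
    also have "\<dots> = (\<Prod>i<N. P (w i) (w (Suc i)))"
      by (rule prod.nat_diff_reindex)
    finally show "(\<Prod>i<N. P (?r w (Suc i)) (?r w i)) * \<Phi> (?r (?r w)) = (\<Prod>i<N. P (w i) (w (Suc i))) * \<Phi> w"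
      by (simp only: rr[OF w])
  qed (use rr mem in auto)
  then show ?thesis by (simp add: path_mean_def)
qed

end

section \<open>Forward-backward martingale bound for additive functionals\<close>

lemma sq_sum5: "(a + b + (x + y + z) / 2)\<^sup>2 \<le> 5 * (a\<^sup>2 + b\<^sup>2 + x\<^sup>2 / 4 + y\<^sup>2 / 4 + z\<^sup>2 / 4)" for a b x y z :: real
proof -
  have "(a + b + (x + y + z) / 2)\<^sup>2 = (\<Sum>i\<in>{..<5::nat}. [a, b, x/2, y/2, z/2] ! i)\<^sup>2"
    by (simp add: numeral_eq_Suc algebra_simps add_divide_distrib)
  also have "\<dots> \<le> (\<Sum>i\<in>{..<5::nat}. ([a, b, x/2, y/2, z/2] ! i)\<^sup>2) * 5"
    using sum_squared_le_sum_of_squares[of "\<lambda>i. [a, b, x/2, y/2, z/2] ! i" "{..<5::nat}"] by simp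
  also have "\<dots> = 5 * (a\<^sup>2 + b\<^sup>2 + x\<^sup>2 / 4 + y\<^sup>2 / 4 + z\<^sup>2 / 4)"
    by (simp add: numeral_eq_Suc power_divide)
  finally show ?thesis .
qed

text \<open>Cauchy-Schwarz in time, without any cancellation. The right-hand side does not depend on
  \<open>j\<close>, so it also bounds the running maximum.\<close>

lemma additive_sq_bound:
  fixes f :: "'s \<Rightarrow> real" and N :: nat
  assumes w: "j \<le> N" and d: "0 \<le> d"
  shows "(\<Sum>k=1..j. d * f (w k))\<^sup>2 \<le> d\<^sup>2 * N * (\<Sum>k=1..N. (f (w k))\<^sup>2)"
proof -
  have "(\<Sum>k=1..j. d * f (w k))\<^sup>2 \<le> (\<Sum>k=1..j. (d * f (w k))\<^sup>2) * real (card {1..j})"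
    by (rule sum_squared_le_sum_of_squares)
  also have "\<dots> \<le> (\<Sum>k=1..N. (d * f (w k))\<^sup>2) * real N"
    using w by (intro mult_mono sum_mono2 sum_nonneg) auto
  finally show ?thesis by (simp add: power_mult_distrib sum_distrib_left mult_ac)
qed

context doubly_stochastic
begin

abbreviation "back_step g e \<equiv> (\<Sum>e'\<in>E. P e' e * g e')"

text \<open>The backward sums are not a martingale in \<open>j\<close>. On the reversed path such a
  sum is the increment, between the times \<open>N - j\<close> and \<open>N\<close>, of a forward
  martingale of the transposed chain. Both end values are controlled by \<open>mart_max\<close>,
  which costs a factor 4 on top of Doob's 8.\<close>

lemma backward_doob:
  "\<exists>R. (\<forall>w\<in>PiE {..N} (\<lambda>_. E). \<forall>j\<le>N. (\<Sum>k<j. g (w k) - back_step g (w (Suc k)))\<^sup>2 \<le> R w) \<and>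
    path_mean E P N R \<le> 32 * real N * avg E (\<lambda>e. (g e)\<^sup>2 - (back_step g e)\<^sup>2)"
proof -
  interpret T: doubly_stochastic E "\<lambda>e e'. P e' e" by (rule transpose_doubly_stochastic)
  let ?r = "\<lambda>w. restrict (\<lambda>i. w (N - i)) {..N}"
  define R where "R w = 4 * T.mart_max g N (?r w)" for w
  have rr: "?r (?r w) = w" if "w \<in> PiE {..N} (\<lambda>_. E)" for w
  proof
    fix i show "?r (?r w) i = w i"
    proof (cases "i \<le> N")
      case False
      then show ?thesis using PiE_arb[OF that, of i] by simp
    qed simp
  qed
  have bound: "(\<Sum>k<j. g (w k) - back_step g (w (Suc k)))\<^sup>2 \<le> R w"
    if w: "w \<in> PiE {..N} (\<lambda>_. E)" and j: "j \<le> N" for w j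
  proof -
    have eq: "(\<Sum>k<j. g (w k) - back_step g (w (Suc k))) = T.mart g (?r w) N - T.mart g (?r w) (N - j)"
      using j
    proof (induction j)
      case (Suc j)
      have "T.mart g (?r w) (Suc (N - Suc j)) - T.mart g (?r w) (N - Suc j) = g (w j) - back_step g (w (Suc j))"
      proof -
        have "Suc (N - Suc j) \<le> N" "N - (N - Suc j) = Suc j" "N - Suc (N - Suc j) = j"
          using Suc.prems by linarith+
        then show ?thesis by (simp add: T.mart_def T.step_def)
      qed
      moreover have "Suc (N - Suc j) = N - j" using Suc.prems by simp
      ultimately show ?case
        using Suc.IH[OF Suc_leD[OF Suc.prems]] by (simp only: sum.lessThan_Suc)
    qed simp
    let ?a = "T.mart g (?r w) N" and ?b = "T.mart g (?r w) (N - j)"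
    have "(?a - ?b)\<^sup>2 \<le> 2 * ?a\<^sup>2 + 2 * ?b\<^sup>2"
      using zero_le_power2[of "?a + ?b"] by (simp add: power2_eq_square algebra_simps)
    also have "\<dots> \<le> 4 * T.mart_max g N (?r w)"
      using T.mart_max_ge[of N N g "?r w"] T.mart_max_ge[of "N - j" N g "?r w"] by simp
    finally show ?thesis by (simp only: eq R_def)
  qed
  have "path_mean E P N R = path_mean E (\<lambda>e e'. P e' e) N (\<lambda>w. R (?r w))"
    by (rule path_mean_reverse)
  also have "\<dots> = path_mean E (\<lambda>e e'. P e' e) N (\<lambda>w. 4 * T.mart_max g N w)"
    by (rule T.path_mean_cong) (simp only: R_def rr)
  also have "\<dots> = 4 * path_mean E (\<lambda>e e'. P e' e) N (T.mart_max g N)"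
    by (rule T.path_mean_cmult)
  also have "\<dots> \<le> 4 * (8 * N * T.step_var g)"
    using T.doob[of N g] by simp
  also have "\<dots> = 32 * real N * avg E (\<lambda>e. (g e)\<^sup>2 - (back_step g e)\<^sup>2)"
    by (simp add: T.step_var_def T.step_def)
  finally show ?thesis using bound by blast
qed

text \<open>The Lyons-Zheng decomposition in discrete time. Adding forward and backward increments
  cancels the values of \<open>g\<close> up to one-step drifts, and the two drifts together are
  close to \<open>2 * d * S\<close>. So the sum of \<open>d * S\<close> is minus half the sum of two
  martingales, up to an error; \<open>c\<close> is the error per step and \<open>c'\<close> bounds
  the drift at the two ends. The factor 5 counts the parts being squared: \<open>F1\<close>,
  \<open>lam * g\<close>, the two martingales and the error.\<close>

lemma additive_functional_bound:
  fixes d lam c c' :: real and N :: nat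
  assumes d: "0 \<le> d" and lam: "0 \<le> lam"
    and F: "\<And>e. e \<in> E \<Longrightarrow> F e = F1 e + (lam * g e - S e)"
    and err: "\<And>e. e \<in> E \<Longrightarrow> \<bar>(step g e - g e) + (back_step g e - g e) - 2 * d * S e\<bar> \<le> c"
    and err': "\<And>e. e \<in> E \<Longrightarrow> \<bar>step g e - g e\<bar> \<le> c'"
  shows "\<exists>R. (\<forall>w\<in>PiE {..N} (\<lambda>_. E). \<forall>j\<le>N. (\<Sum>k=1..j. d * F (w k))\<^sup>2 \<le> R w) \<and>
    path_mean E P N R \<le> 5 * ((d * N)\<^sup>2 * avg E (\<lambda>e. (F1 e)\<^sup>2) + lam\<^sup>2 * (d * N)\<^sup>2 * avg E (\<lambda>e. (g e)\<^sup>2)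
        + 2 * (N * step_var g) + 8 * (N * avg E (\<lambda>e. (g e)\<^sup>2 - (back_step g e)\<^sup>2)) + (N * c + 2 * c')\<^sup>2 / 4)"
proof -
  obtain R' where R': "\<forall>w\<in>PiE {..N} (\<lambda>_. E). \<forall>j\<le>N.
      (\<Sum>k<j. g (w k) - back_step g (w (Suc k)))\<^sup>2 \<le> R' w"
    "path_mean E P N R' \<le> 32 * real N * avg E (\<lambda>e. (g e)\<^sup>2 - (back_step g e)\<^sup>2)"
    using backward_doob[of N g] by blast
  obtain e0 where e0: "e0 \<in> E" using nonempty_E by auto
  have c: "0 \<le> c" "0 \<le> c'" using err[OF e0] err'[OF e0] by linarith+
  define R where "R w = 5 * ((d\<^sup>2 * N * (\<Sum>k=1..N. (F1 (w k))\<^sup>2) + lam\<^sup>2 * (d\<^sup>2 * N * (\<Sum>k=1..N. (g (w k))\<^sup>2)))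
     + (mart_max g N w / 4 + R' w / 4) + (N * c + 2 * c')\<^sup>2 / 4)" for w
  have 1: "(\<Sum>k=1..j. d * F (w k))\<^sup>2 \<le> R w" if w: "w \<in> PiE {..N} (\<lambda>_. E)" and j: "j \<le> N" for w j
  proof -
    have wE: "w k \<in> E" if "k \<le> N" for k using PiE_mem[OF w] that by simp
    let ?A = "\<Sum>k=1..j. d * F1 (w k)" and ?B = "\<Sum>k=1..j. d * g (w k)" and ?M = "mart g w j"
      and ?M' = "\<Sum>k<j. g (w k) - back_step g (w (Suc k))"
    \<comment> \<open>\<open>z\<close> is what keeps the two martingales from representing the sum
      of \<open>d * S\<close> exactly.\<close>
    define z where "z = - 2 * (\<Sum>k=1..j. d * S (w k)) - (?M + ?M')"
    have shift: "(\<Sum>k=1..j. h (w k)) = (\<Sum>k<j. h (w (Suc k)))" for h :: "_ \<Rightarrow> real"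
      by (simp add: sum.atLeast1_atMost_eq)
    \<comment> \<open>The forward drift is evaluated at the start of each step and the backward
      drift at its end; shifting the former by one step leaves two end terms.\<close>
    have tel: "(\<Sum>k<j. step g (w k) - g (w k)) = (\<Sum>k<j. step g (w (Suc k)) - g (w (Suc k)))
       + (step g (w 0) - g (w 0)) - (step g (w j) - g (w j))"
      by (induction j) auto
    have "?M + ?M' = - (\<Sum>k<j. step g (w k) - g (w k)) - (\<Sum>k<j. back_step g (w (Suc k)) - g (w (Suc k)))"
      unfolding mart_def by (simp add: sum_subtractf)
    also have "\<dots> = - (\<Sum>k<j. (step g (w (Suc k)) - g (w (Suc k))) + (back_step g (w (Suc k)) - g (w (Suc k))))
       - (step g (w 0) - g (w 0)) + (step g (w j) - g (w j))"
      unfolding tel by (simp only: sum.distrib)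
    finally have MM: "?M + ?M' = - (\<Sum>k<j. (step g (w (Suc k)) - g (w (Suc k))) + (back_step g (w (Suc k)) - g (w (Suc k))))
       - (step g (w 0) - g (w 0)) + (step g (w j) - g (w j))" .
    have "(\<Sum>k<j. (step g (w (Suc k)) - g (w (Suc k))) + (back_step g (w (Suc k)) - g (w (Suc k))) - 2 * d * S (w (Suc k)))
       = (\<Sum>k<j. (step g (w (Suc k)) - g (w (Suc k))) + (back_step g (w (Suc k)) - g (w (Suc k))))
         - 2 * (\<Sum>k<j. d * S (w (Suc k)))"
      by (simp only: sum_subtractf[of "\<lambda>k. (step g (w (Suc k)) - g (w (Suc k))) + (back_step g (w (Suc k)) - g (w (Suc k)))"]
          sum_distrib_left mult.assoc)
    then have "z = (\<Sum>k<j. (step g (w (Suc k)) - g (w (Suc k))) + (back_step g (w (Suc k)) - g (w (Suc k)))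
         - 2 * d * S (w (Suc k))) + (step g (w 0) - g (w 0)) - (step g (w j) - g (w j))"
      unfolding z_def shift[of "\<lambda>e. d * S e"] MM by linarith
    moreover have "\<bar>\<Sum>k<j. (step g (w (Suc k)) - g (w (Suc k))) + (back_step g (w (Suc k)) - g (w (Suc k)))
         - 2 * d * S (w (Suc k))\<bar> \<le> (\<Sum>k<j. c)"
      using j by (intro order.trans[OF sum_abs] sum_mono err wE) auto
    moreover have "(\<Sum>k<j. c) \<le> N * c" using j c by (simp add: mult_right_mono)
    moreover have "\<bar>step g (w 0) - g (w 0)\<bar> \<le> c'" "\<bar>step g (w j) - g (w j)\<bar> \<le> c'"
      using j by (auto intro!: err' wE)
    ultimately have "\<bar>z\<bar> \<le> N * c + 2 * c'" by linarith
    then have z: "z\<^sup>2 \<le> (N * c + 2 * c')\<^sup>2" using c by (intro abs_le_square_iff[THEN iffD1]) simp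
    have "(\<Sum>k=1..j. d * F (w k)) = (\<Sum>k=1..j. d * (F1 (w k) + (lam * g (w k) - S (w k))))"
      using j by (intro sum.cong) (auto simp: F wE)
    also have "\<dots> = ?A + lam * ?B + (?M + ?M' + z) / 2"
    proof -
      have "(\<Sum>k=1..j. d * (F1 (w k) + (lam * g (w k) - S (w k))))
        = (\<Sum>k=1..j. d * F1 (w k) + lam * (d * g (w k)) - d * S (w k))"
        by (simp add: algebra_simps)
      also have "\<dots> = ?A + lam * ?B - (\<Sum>k=1..j. d * S (w k))"
        by (simp only: sum.distrib sum_subtractf sum_distrib_left)
      finally show ?thesis unfolding z_def by (simp add: field_simps)
    qed
    finally have i1: "(\<Sum>k=1..j. d * F (w k))\<^sup>2 \<le> 5 * (?A\<^sup>2 + (lam * ?B)\<^sup>2 + ?M\<^sup>2/4 + ?M'\<^sup>2/4 + z\<^sup>2/4)"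
      by (simp only: sq_sum5)
    have i2: "(lam * ?B)\<^sup>2 \<le> lam\<^sup>2 * (d\<^sup>2 * N * (\<Sum>k=1..N. (g (w k))\<^sup>2))"
      using additive_sq_bound[OF j d, of g w] by (simp only: power_mult_distrib mult_left_mono zero_le_power2)
    have comb: "s \<le> 5 * (A + B + (M / 4 + M' / 4) + Z / 4)"
      if "s \<le> 5 * (a + b + m / 4 + m' / 4 + y / 4)" "b \<le> B" "a \<le> A" "y \<le> Z" "m \<le> M" "m' \<le> M'"
      for a b m m' y s A B M M' Z :: real using that by argo
    have i3: "?M'\<^sup>2 \<le> R' w" using R' w j by blast
    show ?thesis unfolding R_def
      by (rule comb[OF i1 i2 additive_sq_bound[OF j d, of F1 w] z mart_max_ge[OF j, of g w] i3])
  qed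
  have at: "path_mean E P N (\<lambda>w. \<Sum>k=1..N. (h (w k))\<^sup>2) = N * avg E (\<lambda>e. (h e)\<^sup>2)" for h
    unfolding path_mean_sum using path_mean_at[of _ N "\<lambda>e. (h e)\<^sup>2"] by simp
  have quarter: "path_mean E P N (\<lambda>w. \<Phi> w / 4) = path_mean E P N \<Phi> / 4" for \<Phi>
    using path_mean_cmult[of N "1/4" \<Phi>] by simp
  have "path_mean E P N R = 5 * ((d\<^sup>2 * N * (N * avg E (\<lambda>e. (F1 e)\<^sup>2)) + lam\<^sup>2 * (d\<^sup>2 * N * (N * avg E (\<lambda>e. (g e)\<^sup>2))))
     + (path_mean E P N (mart_max g N) / 4 + path_mean E P N R' / 4) + (N * c + 2 * c')\<^sup>2 / 4)"
    unfolding R_def path_mean_cmult path_mean_add path_mean_const at quarter ..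
  also have "\<dots> \<le> 5 * ((d * N)\<^sup>2 * avg E (\<lambda>e. (F1 e)\<^sup>2) + lam\<^sup>2 * (d * N)\<^sup>2 * avg E (\<lambda>e. (g e)\<^sup>2)
        + 2 * (N * step_var g) + 8 * (N * avg E (\<lambda>e. (g e)\<^sup>2 - (back_step g e)\<^sup>2)) + (N * c + 2 * c')\<^sup>2 / 4)"
    using doob[of N g] R'(2) by (simp add: power2_eq_square mult_ac)
  finally show ?thesis using 1 by blast
qed

end

text \<open>Uniformisation: \<open>c\<close> dominates the diagonal, so \<open>k\<close>, the
  identity plus \<open>s / c\<close>, is a stochastic matrix, and lam - s = (lam + c) (1 - q k) with
  q = c / (lam + c) < 1 is inverted by a Neumann series. The summand 1 in \<open>c\<close> keeps it
  positive even for s = 0.\<close>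

lemma resolvent_exists:
  fixes s :: "'s \<Rightarrow> 's \<Rightarrow> real"
  assumes fin: "finite E"
    and off: "\<And>e e'. e \<in> E \<Longrightarrow> e' \<in> E \<Longrightarrow> e \<noteq> e' \<Longrightarrow> 0 \<le> s e e'"
    and row: "\<And>e. e \<in> E \<Longrightarrow> (\<Sum>e'\<in>E. s e e') = 0"
    and lam: "0 < lam"
  obtains g where "\<And>e. e \<in> E \<Longrightarrow> F e = lam * g e - (\<Sum>e'\<in>E. s e e' * g e')"
proof -
  define c where "c = 1 + (\<Sum>e\<in>E. \<bar>s e e\<bar>)"
  have c1: "1 \<le> c" unfolding c_def by (simp add: sum_nonneg)
  define k where "k e e' = (if e = e' then 1 else 0) + s e e' / c" for e e'
  have k_nonneg: "0 \<le> k e e'" if "e \<in> E" "e' \<in> E" for e e'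
  proof (cases "e = e'")
    case True
    have "\<bar>s e e\<bar> \<le> (\<Sum>e\<in>E. \<bar>s e e\<bar>)" using that by (intro member_le_sum fin) auto
    then have "- c \<le> s e e" unfolding c_def by linarith
    then show ?thesis using True c1 by (simp add: k_def field_simps)
  next
    case False
    then show ?thesis using off[OF that] c1 by (simp add: k_def)
  qed
  have k_row: "(\<Sum>e'\<in>E. k e e') = 1" if "e \<in> E" for e
    unfolding k_def sum.distrib sum_divide_distrib[symmetric] row[OF that] using that fin by simp
  define K where "K h e = (\<Sum>e'\<in>E. k e e' * h e')" for h e
  define a where "a = (\<Sum>e\<in>E. \<bar>F e\<bar>)"
  have a: "\<bar>(K ^^ n) F e\<bar> \<le> a" if "e \<in> E" for n e
    using that
  proof (induction n arbitrary: e)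
    case 0
    then show ?case unfolding a_def using member_le_sum[of e E "\<lambda>e. \<bar>F e\<bar>"] fin by simp
  next
    case (Suc n)
    have "\<bar>(K ^^ Suc n) F e\<bar> \<le> (\<Sum>e'\<in>E. \<bar>k e e' * (K ^^ n) F e'\<bar>)"
      by (simp add: K_def sum_abs)
    also have "\<dots> \<le> (\<Sum>e'\<in>E. k e e' * a)"
      using Suc k_nonneg by (intro sum_mono) (auto simp: abs_mult intro!: mult_left_mono)
    also have "\<dots> = a" using k_row[OF Suc.prems] by (simp add: sum_distrib_right[symmetric])
    finally show ?case .
  qed
  define q where "q = c / (lam + c)"
  have q: "0 \<le> q" "q < 1" using c1 lam by (auto simp: q_def)
  have sm: "summable (\<lambda>n. q ^ n * (K ^^ n) F e)" if "e \<in> E" for e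
  proof (rule summable_comparison_test')
    show "summable (\<lambda>n. a * q ^ n)" using q by (intro summable_mult summable_geometric) simp
    show "norm (q ^ n * (K ^^ n) F e) \<le> a * q ^ n" for n
      using mult_left_mono[OF a[OF that, of n], of "q ^ n"] q by (simp add: abs_mult mult_ac)
  qed
  define g where "g e = (\<Sum>n. q ^ n * (K ^^ n) F e) / (lam + c)" for e
  have main: "F e = lam * g e - (\<Sum>e'\<in>E. s e e' * g e')" if e: "e \<in> E" for e
  proof -
    have Kg: "(lam + c) * K g e = (\<Sum>n. q ^ n * (K ^^ Suc n) F e)"
    proof -
      have "(\<Sum>n. q ^ n * (K ^^ Suc n) F e) = (\<Sum>n. \<Sum>e'\<in>E. k e e' * (q ^ n * (K ^^ n) F e'))"
        by (simp add: K_def sum_distrib_left mult_ac)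
      also have "\<dots> = (\<Sum>e'\<in>E. \<Sum>n. k e e' * (q ^ n * (K ^^ n) F e'))"
        using sm by (intro suminf_sum summable_mult) auto
      also have "\<dots> = (\<Sum>e'\<in>E. k e e' * (\<Sum>n. q ^ n * (K ^^ n) F e'))"
        using sm by (intro sum.cong suminf_mult) auto
      also have "\<dots> = (lam + c) * K g e"
        using c1 lam by (simp add: K_def g_def sum_distrib_left)
      finally show ?thesis by simp
    qed
    have "summable (\<lambda>n. q ^ Suc n * (K ^^ Suc n) F e)"
      using sm[OF e] by (subst summable_Suc_iff)
    have "(lam + c) * g e = F e + (\<Sum>n. q ^ Suc n * (K ^^ Suc n) F e)"
      using suminf_split_head[OF sm[OF e]] c1 lam by (simp add: g_def)
    also have "(\<Sum>n. q ^ Suc n * (K ^^ Suc n) F e) = (\<Sum>n. q * (q ^ n * (K ^^ Suc n) F e))"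
      by (simp add: mult_ac)
    also have "\<dots> = q * (\<Sum>n. q ^ n * (K ^^ Suc n) F e)"
    proof (cases "q = 0")
      case False
      have "summable (\<lambda>n. (1 / q) * (q ^ Suc n * (K ^^ Suc n) F e))"
        using \<open>summable (\<lambda>n. q ^ Suc n * (K ^^ Suc n) F e)\<close> by (rule summable_mult)
      then have "summable (\<lambda>n. q ^ n * (K ^^ Suc n) F e)" using False by simp
      then show ?thesis by (rule suminf_mult)
    qed simp
    also have "\<dots> = c * K g e" unfolding Kg[symmetric] using c1 lam by (simp add: q_def)
    also have "K g e = g e + (\<Sum>e'\<in>E. s e e' * g e') / c"
    proof -
      have "k e e' * g e' = (if e = e' then g e' else 0) + s e e' * g e' / c" for e'
        by (simp add: k_def distrib_right)
      then show ?thesis using e fin by (simp add: K_def sum.distrib sum_divide_distrib)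
    qed
    finally have "(lam + c) * g e = F e + c * (g e + (\<Sum>e'\<in>E. s e e' * g e') / c)" .
    also have "c * (g e + (\<Sum>e'\<in>E. s e e' * g e') / c) = c * g e + (\<Sum>e'\<in>E. s e e' * g e')"
      using c1 by (simp add: distrib_left)
    finally show ?thesis by (simp add: distrib_right)
  qed
  then show ?thesis using that by blast
qed

section \<open>Finite jump processes with uniform invariant measure\<close>

lemma avg_add: "avg E (\<lambda>e. f e + g e) = avg E f + avg E g"
  by (simp add: avg_def sum.distrib add_divide_distrib)

lemma avg_diff: "avg E (\<lambda>e. f e - g e) = avg E f - avg E g"
  by (simp add: avg_def sum_subtractf diff_divide_distrib)

lemma avg_cmult: "avg E (\<lambda>e. c * f e) = c * avg E f"
  by (simp add: avg_def sum_distrib_left)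

lemma avg_sum: "avg E (\<lambda>e. \<Sum>i\<in>I. f i e) = (\<Sum>i\<in>I. avg E (f i))"
  unfolding avg_def by (subst sum.swap) (simp add: sum_divide_distrib)

lemma avg_cong: "(\<And>e. e \<in> E \<Longrightarrow> f e = g e) \<Longrightarrow> avg E f = avg E g"
  unfolding avg_def by (metis sum.cong)

lemma avg_mono: "(\<And>e. e \<in> E \<Longrightarrow> f e \<le> g e) \<Longrightarrow> avg E f \<le> avg E g"
  unfolding avg_def by (intro divide_right_mono sum_mono) auto

lemma avg_nonneg: "(\<And>e. e \<in> E \<Longrightarrow> 0 \<le> f e) \<Longrightarrow> 0 \<le> avg E f"
  unfolding avg_def by (intro divide_nonneg_nonneg sum_nonneg) auto

lemma avg_tendsto: "(\<And>e. e \<in> E \<Longrightarrow> (\<lambda>n. f n e) \<longlonglongrightarrow> g e) \<Longrightarrow> (\<lambda>n. avg E (f n)) \<longlonglongrightarrow> avg E g"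
  unfolding avg_def divide_inverse by (intro tendsto_intros) auto

lemma ind_bound: "\<bar>indicat_real {e'} e\<bar> \<le> 1"
  by (simp add: indicator_def)

lemma exp_summable: "summable (\<lambda>k. x ^ k / fact k :: real)"
  using summable_exp[of x] by (simp add: divide_inverse mult.commute)

lemma exp_suminf: "(\<Sum>k. x ^ k / fact k :: real) = exp x"
  by (simp add: exp_def divide_inverse scaleR_conv_of_real mult.commute)

lemma suminf_head:
  fixes f :: "nat \<Rightarrow> real"
  assumes "\<And>k. 0 < k \<Longrightarrow> f k = 0"
  shows "(\<Sum>k. f k) = f 0"
  by (subst suminf_finite[of "{0}"]) (use assms in auto)

text \<open>Here \<open>h N\<close> is one step of length \<open>T / N\<close> applied to
  \<open>g\<close>, and \<open>l\<close> its derivative. Factor the difference of squares: N (h - g)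
  tends to \<open>T * l\<close> and h + g to \<open>2 * g\<close>. With \<open>l\<close> equal to
  \<open>L g\<close> the limit is \<open>2 * T\<close> times the Dirichlet form.\<close>

lemma scaled_var_tendsto:
  fixes h :: "nat \<Rightarrow> 's \<Rightarrow> real"
  assumes T: "0 < T"
    and h: "\<And>N e. e \<in> E \<Longrightarrow> 0 < N \<Longrightarrow> \<bar>h N e - g e - T / real N * l e\<bar> \<le> (T / real N)\<^sup>2 * c"
  shows "(\<lambda>N. real N * avg E (\<lambda>e. (g e)\<^sup>2 - (h N e)\<^sup>2)) \<longlonglongrightarrow> 2 * T * avg E (\<lambda>e. - g e * l e)"
proof -
  have 1: "(\<lambda>N. real N * (h N e - g e)) \<longlonglongrightarrow> T * l e" if e: "e \<in> E" for e
  proof (rule LIM_zero_cancel, rule Lim_null_comparison)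
    show "\<forall>\<^sub>F N in sequentially. norm (real N * (h N e - g e) - T * l e) \<le> T\<^sup>2 * c * inverse (real N)"
    proof (rule eventually_sequentiallyI[of 1])
      fix N :: nat assume "1 \<le> N"
      then have N: "0 < N" by simp
      have "real N * (h N e - g e) - T * l e = real N * (h N e - g e - T / real N * l e)"
        using N by (simp add: field_simps)
      then have "norm (real N * (h N e - g e) - T * l e) = real N * \<bar>h N e - g e - T / real N * l e\<bar>"
        by (simp add: abs_mult)
      also have "\<dots> \<le> real N * ((T / real N)\<^sup>2 * c)"
        by (intro mult_left_mono h e N) auto
      also have "\<dots> = T\<^sup>2 * c * inverse (real N)"
        using N by (simp add: field_simps power2_eq_square)
      finally show "norm (real N * (h N e - g e) - T * l e) \<le> T\<^sup>2 * c * inverse (real N)" .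
    qed
    show "(\<lambda>N. T\<^sup>2 * c * inverse (real N)) \<longlonglongrightarrow> 0"
      using tendsto_mult_left[OF lim_inverse_n, of "T\<^sup>2 * c"] by simp
  qed
  have 2: "(\<lambda>N. h N e) \<longlonglongrightarrow> g e" if e: "e \<in> E" for e
  proof -
    have "(\<lambda>N. g e + real N * (h N e - g e) * inverse (real N)) \<longlonglongrightarrow> g e + T * l e * 0"
      by (intro tendsto_intros 1 e lim_inverse_n)
    moreover have "\<forall>\<^sub>F N in sequentially. g e + real N * (h N e - g e) * inverse (real N) = h N e"
      by (rule eventually_sequentiallyI[of 1]) (simp add: field_simps)
    ultimately show ?thesis using tendsto_cong by force
  qed
  have "(\<lambda>N. avg E (\<lambda>e. - (real N * (h N e - g e)) * (g e + h N e))) \<longlonglongrightarrow> avg E (\<lambda>e. - (T * l e) * (g e + g e))"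
    by (intro avg_tendsto tendsto_intros 1 2)
  moreover have "real N * avg E (\<lambda>e. (g e)\<^sup>2 - (h N e)\<^sup>2) = avg E (\<lambda>e. - (real N * (h N e - g e)) * (g e + h N e))" for N
    unfolding avg_cmult[symmetric] by (rule avg_cong) (simp add: power2_eq_square algebra_simps)
  moreover have "avg E (\<lambda>e. - (T * l e) * (g e + g e)) = 2 * T * avg E (\<lambda>e. - g e * l e)"
    unfolding avg_cmult[symmetric] by (rule avg_cong) (simp add: algebra_simps)
  ultimately show ?thesis by simp
qed

text \<open>Jumps are indexed by a finite set of types, so that exchanges and flips fit one scheme.
  \<open>L\<close> is prescribed on \<open>E\<close> only, and \<open>invariant\<close> states
  stationarity of the uniform law without reversibility.\<close>

locale jump_generator =
  fixes E :: "'s set" and K :: "'k set" and r :: "'k \<Rightarrow> 's \<Rightarrow> real" and \<tau> :: "'k \<Rightarrow> 's \<Rightarrow> 's"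
    and L :: "('s \<Rightarrow> real) \<Rightarrow> 's \<Rightarrow> real"
  assumes finite_E: "finite E" and nonempty_E: "E \<noteq> {}" and finite_K: "finite K"
    and target: "\<And>k e. k \<in> K \<Longrightarrow> e \<in> E \<Longrightarrow> \<tau> k e \<in> E"
    and rate_nonneg: "\<And>k e. k \<in> K \<Longrightarrow> e \<in> E \<Longrightarrow> 0 \<le> r k e"
    and L_eq: "\<And>f e. e \<in> E \<Longrightarrow> L f e = (\<Sum>k\<in>K. r k e * (f (\<tau> k e) - f e))"
    and invariant: "\<And>f. (\<Sum>e\<in>E. L f e) = 0"
begin

lemma L_cong: "(\<And>e. e \<in> E \<Longrightarrow> f e = g e) \<Longrightarrow> e \<in> E \<Longrightarrow> L f e = L g e"
  by (simp add: L_eq target)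

lemma L_sum:
  assumes "finite I" "e \<in> E"
  shows "L (\<lambda>x. \<Sum>i\<in>I. c i * f i x) e = (\<Sum>i\<in>I. c i * L (f i) e)"
proof -
  have "L (\<lambda>x. \<Sum>i\<in>I. c i * f i x) e = (\<Sum>k\<in>K. \<Sum>i\<in>I. c i * (r k e * (f i (\<tau> k e) - f i e)))"
    using assms by (simp add: L_eq sum_subtractf[symmetric] sum_distrib_left algebra_simps)
  also have "\<dots> = (\<Sum>i\<in>I. c i * L (f i) e)"
    using assms by (subst sum.swap) (simp add: L_eq sum_distrib_left)
  finally show ?thesis .
qed

lemma pow_cong: "(\<And>e. e \<in> E \<Longrightarrow> f e = g e) \<Longrightarrow> e \<in> E \<Longrightarrow> (L ^^ n) f e = (L ^^ n) g e"
proof (induction n arbitrary: e)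
  case (Suc n)
  then show ?case by (auto intro!: L_cong)
qed simp

lemma pow_sum:
  assumes "finite I" "e \<in> E"
  shows "(L ^^ n) (\<lambda>x. \<Sum>i\<in>I. c i * f i x) e = (\<Sum>i\<in>I. c i * (L ^^ n) (f i) e)"
  using assms(2)
proof (induction n arbitrary: e)
  case (Suc n)
  have "(L ^^ Suc n) (\<lambda>x. \<Sum>i\<in>I. c i * f i x) e = L (\<lambda>x. \<Sum>i\<in>I. c i * (L ^^ n) (f i) x) e"
    using Suc by (auto intro!: L_cong)
  then show ?case using L_sum[OF assms(1) Suc.prems] by simp
qed simp

lemma expand: "e \<in> E \<Longrightarrow> f e = (\<Sum>e'\<in>E. f e' * indicat_real {e'} e)"
  using finite_E by (simp add: indicator_def if_distrib cong: if_cong)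

text \<open>Identifies \<open>L (indicat_real {e'}) e\<close> as the matrix entry of the generator
  at (e, e').\<close>

lemma L_expand: "e \<in> E \<Longrightarrow> L f e = (\<Sum>e'\<in>E. f e' * L (indicat_real {e'}) e)"
  using L_cong[of f "\<lambda>e. \<Sum>e'\<in>E. f e' * indicat_real {e'} e" e] expand
    L_sum[OF finite_E, of e f "\<lambda>e'. indicat_real {e'}"] by simp

text \<open>A crude bound for the operator norm in the supremum norm: rates are summed, not
  maximised, over states.\<close>

definition rate_bound :: real where "rate_bound = 2 * (\<Sum>e\<in>E. \<Sum>k\<in>K. r k e)"

lemma rate_bound_nonneg: "0 \<le> rate_bound"
  unfolding rate_bound_def by (intro mult_nonneg_nonneg sum_nonneg rate_nonneg) auto

lemma L_bound:
  assumes "e \<in> E" and a: "\<And>e. e \<in> E \<Longrightarrow> \<bar>f e\<bar> \<le> a"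
  shows "\<bar>L f e\<bar> \<le> rate_bound * a"
proof -
  have a0: "0 \<le> a" using a[OF assms(1)] by simp
  have "\<bar>L f e\<bar> \<le> (\<Sum>k\<in>K. \<bar>r k e * (f (\<tau> k e) - f e)\<bar>)"
    using assms by (simp add: L_eq sum_abs)
  also have "\<dots> \<le> (\<Sum>k\<in>K. r k e * (2 * a))"
  proof (rule sum_mono)
    fix k assume k: "k \<in> K"
    have "\<bar>f (\<tau> k e) - f e\<bar> \<le> 2 * a"
      using a[OF assms(1)] a[OF target[OF k assms(1)]] by linarith
    then show "\<bar>r k e * (f (\<tau> k e) - f e)\<bar> \<le> r k e * (2 * a)"
      using rate_nonneg[OF k assms(1)] by (simp add: abs_mult mult_left_mono)
  qed
  also have "\<dots> = 2 * (\<Sum>k\<in>K. r k e) * a" by (simp add: sum_distrib_right[symmetric])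
  also have "\<dots> \<le> rate_bound * a"
    unfolding rate_bound_def using a0 assms(1) finite_E rate_nonneg
    by (intro mult_right_mono mult_left_mono member_le_sum[where f="\<lambda>e. \<Sum>k\<in>K. r k e"] sum_nonneg) auto
  finally show ?thesis .
qed

lemma pow_bound:
  assumes "e \<in> E" and a: "\<And>e. e \<in> E \<Longrightarrow> \<bar>f e\<bar> \<le> a"
  shows "\<bar>(L ^^ n) f e\<bar> \<le> rate_bound ^ n * a"
  using assms(1)
proof (induction n arbitrary: e)
  case 0
  then show ?case using a by simp
next
  case (Suc n)
  have "\<bar>L ((L ^^ n) f) e\<bar> \<le> rate_bound * (rate_bound ^ n * a)"
    by (rule L_bound[OF Suc.prems Suc.IH])
  then show ?case by (simp add: mult.assoc)
qed

definition trans_prob :: "real \<Rightarrow> 's \<Rightarrow> 's \<Rightarrow> real" where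
  "trans_prob t e e' = semigroup_of L t (indicat_real {e'}) e"

lemma term_bound:
  assumes "e \<in> E" "0 \<le> t"
  shows "\<bar>t ^ k / fact k * (L ^^ k) (indicat_real {e'}) e\<bar> \<le> (t * rate_bound) ^ k / fact k"
proof -
  have "\<bar>t ^ k / fact k * (L ^^ k) (indicat_real {e'}) e\<bar> = t ^ k / fact k * \<bar>(L ^^ k) (indicat_real {e'}) e\<bar>"
    using assms(2) by (simp add: abs_mult)
  also have "\<dots> \<le> t ^ k / fact k * (rate_bound ^ k * 1)"
    using assms by (intro mult_left_mono pow_bound ind_bound) auto
  finally show ?thesis by (simp add: power_mult_distrib)
qed

lemma term_summable:
  assumes "e \<in> E" "0 \<le> t"
  shows "summable (\<lambda>k. t ^ k / fact k * (L ^^ k) (indicat_real {e'}) e)"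
  by (rule summable_comparison_test'[OF exp_summable[of "t * rate_bound"]])
    (use term_bound[OF assms] in simp)

text \<open>\<open>L\<close> kills constants, so only the term k = 0 of the series survives; powers
  are unfolded with one \<open>L\<close> innermost.\<close>

lemma trans_prob_row:
  assumes "e \<in> E" "0 \<le> t" shows "(\<Sum>e'\<in>E. trans_prob t e e') = 1"
proof -
  have "(\<Sum>e'\<in>E. trans_prob t e e') = (\<Sum>k. \<Sum>e'\<in>E. t ^ k / fact k * (L ^^ k) (indicat_real {e'}) e)"
    unfolding trans_prob_def semigroup_of_def using term_summable assms by (intro suminf_sum[symmetric]) auto
  also have "\<dots> = (\<Sum>k. t ^ k / fact k * (L ^^ k) (\<lambda>_. 1) e)"
  proof (rule suminf_cong)
    fix k
    have "(L ^^ k) (\<lambda>_. 1) e = (L ^^ k) (\<lambda>x. \<Sum>e'\<in>E. 1 * indicat_real {e'} x) e"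
      using expand[of _ "\<lambda>_. 1"] assms(1) by (intro pow_cong) auto
    also have "\<dots> = (\<Sum>e'\<in>E. (L ^^ k) (indicat_real {e'}) e)"
      using pow_sum[OF finite_E assms(1), of k "\<lambda>_. 1" "\<lambda>e'. indicat_real {e'}"] by simp
    finally show "(\<Sum>e'\<in>E. t ^ k / fact k * (L ^^ k) (indicat_real {e'}) e) = t ^ k / fact k * (L ^^ k) (\<lambda>_. 1) e"
      by (simp add: sum_distrib_left)
  qed
  also have "\<dots> = 1"
  proof (subst suminf_head)
    fix k :: nat assume "0 < k"
    then obtain j where k: "k = Suc j" by (cases k) auto
    have "\<bar>(L ^^ j) (L (\<lambda>_. 1)) e\<bar> \<le> rate_bound ^ j * 0"
      by (rule pow_bound[OF assms(1)]) (simp add: L_eq)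
    then show "t ^ k / fact k * (L ^^ k) (\<lambda>_. 1) e = 0"
      by (simp add: k funpow_Suc_right del: funpow.simps)
  qed simp
  finally show ?thesis .
qed

text \<open>Dual to the row sums: powers are unfolded with one \<open>L\<close> outermost, and
  invariance kills every term with k > 0.\<close>

lemma trans_prob_col:
  assumes "e' \<in> E" "0 \<le> t" shows "(\<Sum>e\<in>E. trans_prob t e e') = 1"
proof -
  have "(\<Sum>e\<in>E. trans_prob t e e') = (\<Sum>k. \<Sum>e\<in>E. t ^ k / fact k * (L ^^ k) (indicat_real {e'}) e)"
    unfolding trans_prob_def semigroup_of_def using term_summable assms by (intro suminf_sum[symmetric]) auto
  also have "\<dots> = (\<Sum>e\<in>E. indicat_real {e'} e)"
  proof (subst suminf_head)
    fix k :: nat assume "0 < k"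
    then obtain j where k: "k = Suc j" by (cases k) auto
    show "(\<Sum>e\<in>E. t ^ k / fact k * (L ^^ k) (indicat_real {e'}) e) = 0"
      by (simp only: k funpow.simps o_apply sum_distrib_left[symmetric] invariant mult_zero_right)
  qed simp
  also have "\<dots> = 1" using expand[OF assms(1), of "\<lambda>_. 1"] finite_E assms by (simp add: indicator_def)
  finally show ?thesis .
qed

text \<open>The series from k = 2 on; relaxing \<open>fact (k + 2)\<close> to \<open>fact k\<close>
  turns its majorant into an exponential.\<close>

lemma trans_prob_expansion:
  assumes "e \<in> E" "0 \<le> t"
  shows "\<bar>trans_prob t e e' - indicat_real {e'} e - t * L (indicat_real {e'}) e\<bar> \<le> (t * rate_bound)\<^sup>2 * exp (t * rate_bound)"
proof -
  let ?f = "\<lambda>k. t ^ k / fact k * (L ^^ k) (indicat_real {e'}) e"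
  have "trans_prob t e e' = (\<Sum>k. ?f (k + 2)) + (\<Sum>k<2. ?f k)"
    unfolding trans_prob_def semigroup_of_def by (rule suminf_split_initial_segment[OF term_summable[OF assms]])
  then have eq: "trans_prob t e e' - indicat_real {e'} e - t * L (indicat_real {e'}) e = (\<Sum>k. ?f (k + 2))"
    by (simp add: numeral_2_eq_2)
  have sm: "summable (\<lambda>k. (t * rate_bound)\<^sup>2 * ((t * rate_bound) ^ k / fact k))"
    by (intro summable_mult exp_summable)
  have "norm (\<Sum>k. ?f (k + 2)) \<le> (\<Sum>k. (t * rate_bound)\<^sup>2 * ((t * rate_bound) ^ k / fact k))"
  proof (rule norm_suminf_le[OF _ sm])
    fix k
    have "\<bar>?f (k + 2)\<bar> \<le> (t * rate_bound) ^ (k + 2) / fact (k + 2)" by (rule term_bound[OF assms])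
    also have "\<dots> \<le> (t * rate_bound) ^ (k + 2) / fact k"
      using assms rate_bound_nonneg by (intro divide_left_mono fact_mono) auto
    finally show "norm (?f (k + 2)) \<le> (t * rate_bound)\<^sup>2 * ((t * rate_bound) ^ k / fact k)"
      by (simp only: real_norm_def power_add) (simp add: mult_ac)
  qed
  also have "\<dots> = (t * rate_bound)\<^sup>2 * exp (t * rate_bound)"
    by (subst suminf_mult[OF exp_summable]) (simp only: exp_suminf)
  finally show ?thesis by (simp only: eq real_norm_def)
qed

section \<open>Dirichlet form, adjoint generator and energy of the resolvent\<close>

definition dirichlet :: "('s \<Rightarrow> real) \<Rightarrow> real" where
  "dirichlet g = avg E (\<lambda>e. - g e * L g e)"

text \<open>Carre du champ: pointwise, L(g^2) - 2 g L g is the weighted sum of squared increments.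
  The mean of L(g^2) vanishes by invariance, so the identity holds without reversibility.\<close>

lemma dirichlet_eq: "dirichlet g = 1/2 * avg E (\<lambda>e. \<Sum>k\<in>K. r k e * (g (\<tau> k e) - g e)\<^sup>2)"
proof -
  have "L (\<lambda>x. (g x)\<^sup>2) e - 2 * (g e * L g e) = (\<Sum>k\<in>K. r k e * (g (\<tau> k e) - g e)\<^sup>2)" if "e \<in> E" for e
    using that by (simp add: L_eq sum_distrib_left sum_subtractf[symmetric] power2_eq_square algebra_simps)
  then have "(\<Sum>e\<in>E. \<Sum>k\<in>K. r k e * (g (\<tau> k e) - g e)\<^sup>2) = (\<Sum>e\<in>E. L (\<lambda>x. (g x)\<^sup>2) e - 2 * (g e * L g e))"
    by simp
  also have "\<dots> = - 2 * (\<Sum>e\<in>E. g e * L g e)"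
    by (simp only: sum_subtractf invariant sum_distrib_left[symmetric])
  finally show ?thesis by (simp add: dirichlet_def avg_def sum_negf)
qed

lemma dirichlet_nonneg: "0 \<le> dirichlet g"
  unfolding dirichlet_eq by (intro mult_nonneg_nonneg avg_nonneg sum_nonneg) (auto simp: rate_nonneg)

text \<open>The transposed matrix, that is the adjoint of \<open>L\<close> for the uniform law and
  the generator of the reversed process.\<close>

definition Ladj :: "('s \<Rightarrow> real) \<Rightarrow> 's \<Rightarrow> real" where
  "Ladj g e = (\<Sum>e'\<in>E. g e' * L (indicat_real {e}) e')"

lemma avg_Ladj: "avg E (\<lambda>e. g e * Ladj g e) = avg E (\<lambda>e. g e * L g e)"
proof -
  have "(\<Sum>e\<in>E. g e * Ladj g e) = (\<Sum>e\<in>E. \<Sum>e'\<in>E. g e' * (g e * L (indicat_real {e}) e'))"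
    unfolding Ladj_def by (simp add: sum_distrib_left mult_ac)
  also have "\<dots> = (\<Sum>e'\<in>E. g e' * L g e')"
    by (subst sum.swap) (simp add: L_expand[of _ g] sum_distrib_left)
  finally show ?thesis by (simp add: avg_def)
qed

text \<open>The symmetrised matrix is again a generator: off-diagonal entries are sums of rates, and
  the row sums of the transpose vanish by invariance.\<close>

lemma sym_resolvent:
  assumes "0 < lam"
  obtains g where "\<And>e. e \<in> E \<Longrightarrow> F e = lam * g e - (L g e + Ladj g e) / 2"
proof -
  define s where "s e e' = (L (indicat_real {e'}) e + L (indicat_real {e}) e') / 2" for e e'
  have off: "0 \<le> L (indicat_real {e'}) e" if "e \<in> E" "e' \<in> E" "e \<noteq> e'" for e e'
    using that by (auto simp: L_eq rate_nonneg intro!: sum_nonneg mult_nonneg_nonneg)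
  have row1: "(\<Sum>e'\<in>E. L (indicat_real {e'}) e) = 0" if "e \<in> E" for e
    using L_expand[OF that, of "\<lambda>_. 1"] that by (simp add: L_eq)
  have "\<exists>g. \<forall>e\<in>E. F e = lam * g e - (\<Sum>e'\<in>E. s e e' * g e')"
  proof (rule resolvent_exists[where E=E and s=s and F=F and lam=lam])
    show "finite E" by (rule finite_E)
    show "0 \<le> s e e'" if "e \<in> E" "e' \<in> E" "e \<noteq> e'" for e e'
      using off[OF that] off[of e' e] that by (simp add: s_def)
    show "(\<Sum>e'\<in>E. s e e') = 0" if "e \<in> E" for e
      using row1[OF that] invariant[of "indicat_real {e}"] by (simp add: s_def sum.distrib sum_divide_distrib[symmetric])
  qed (use assms in auto)
  moreover have "(\<Sum>e'\<in>E. s e e' * g e') = (L g e + Ladj g e) / 2" if "e \<in> E" for g e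
    unfolding s_def Ladj_def L_expand[OF that, of g]
    by (simp add: sum.distrib[symmetric] sum_divide_distrib algebra_simps)
  ultimately show ?thesis using that by auto
qed

text \<open>Test the equation with \<open>g\<close>. With a = lam times the mean of g^2 and D the
  Dirichlet form, the mean of F g is a + D, and its square is at most C D \<le> C (a + D); hence a +
  D \<le> C. The constant does not depend on \<open>lam\<close>.\<close>

lemma resolvent_energy:
  assumes g: "\<And>e. e \<in> E \<Longrightarrow> F e = lam * g e - (L g e + Ladj g e) / 2" and lam: "0 \<le> lam" and C: "0 \<le> C"
    and static: "(avg E (\<lambda>e. F e * g e))\<^sup>2 \<le> C * dirichlet g"
  shows "lam * avg E (\<lambda>e. (g e)\<^sup>2) \<le> C" and "dirichlet g \<le> C"
proof -
  let ?a = "lam * avg E (\<lambda>e. (g e)\<^sup>2)" and ?D = "dirichlet g"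
  have "avg E (\<lambda>e. F e * g e) = avg E (\<lambda>e. lam * (g e)\<^sup>2 - (1/2 * (g e * L g e) + 1/2 * (g e * Ladj g e)))"
    by (rule avg_cong) (simp add: g field_simps power2_eq_square)
  also have "\<dots> = ?a - avg E (\<lambda>e. g e * L g e)"
    by (simp only: avg_diff avg_add avg_cmult avg_Ladj)
  also have "\<dots> = ?a + ?D"
    by (simp add: dirichlet_def avg_def sum_negf)
  finally have eq: "avg E (\<lambda>e. F e * g e) = ?a + ?D" .
  have a0: "0 \<le> ?a" using lam by (intro mult_nonneg_nonneg avg_nonneg) auto
  have D0: "0 \<le> ?D" by (rule dirichlet_nonneg)
  have "?a + ?D \<le> C"
  proof (rule ccontr)
    assume n: "\<not> ?a + ?D \<le> C"
    have "C * ?D \<le> C * (?a + ?D)" using a0 C by (intro mult_left_mono) auto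
    also have "\<dots> < (?a + ?D) * (?a + ?D)" using n C by (intro mult_strict_right_mono) auto
    finally show False using static by (simp add: eq power2_eq_square)
  qed
  then show "?a \<le> C" "?D \<le> C" using a0 D0 by linarith+
qed

end

section \<open>Time discretisation of the semigroup\<close>

context jump_generator
begin

lemma trans_prob_doubly_stochastic:
  assumes "\<And>e e'. e \<in> E \<Longrightarrow> e' \<in> E \<Longrightarrow> 0 \<le> trans_prob t e e'" "0 \<le> t"
  shows "doubly_stochastic E (trans_prob t)"
  by unfold_locales (use assms finite_E nonempty_E trans_prob_row trans_prob_col in auto)

definition rem_const :: "real \<Rightarrow> ('s \<Rightarrow> real) \<Rightarrow> real" where
  "rem_const T g = rate_bound\<^sup>2 * exp (T * rate_bound) * (\<Sum>e\<in>E. \<bar>g e\<bar>)"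

lemma entry_expansion:
  assumes "e \<in> E" "0 \<le> t" "t \<le> T"
  shows "\<bar>g x * (trans_prob t e e' - indicat_real {e'} e - t * L (indicat_real {e'}) e)\<bar>
    \<le> \<bar>g x\<bar> * (t\<^sup>2 * (rate_bound\<^sup>2 * exp (T * rate_bound)))"
proof -
  have "(t * rate_bound)\<^sup>2 * exp (t * rate_bound) \<le> (t * rate_bound)\<^sup>2 * exp (T * rate_bound)"
    using assms rate_bound_nonneg by (intro mult_left_mono) (auto intro: mult_right_mono)
  then have "\<bar>trans_prob t e e' - indicat_real {e'} e - t * L (indicat_real {e'}) e\<bar> \<le> t\<^sup>2 * (rate_bound\<^sup>2 * exp (T * rate_bound))"
    using trans_prob_expansion[OF assms(1,2), of e'] by (simp add: power_mult_distrib mult_ac)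
  then show ?thesis by (simp only: abs_mult) (intro mult_left_mono, auto)
qed

lemma step_expansion:
  assumes "e \<in> E" "0 \<le> t" "t \<le> T"
  shows "\<bar>(\<Sum>e'\<in>E. trans_prob t e e' * g e') - g e - t * L g e\<bar> \<le> t\<^sup>2 * rem_const T g"
proof -
  have "(\<Sum>e'\<in>E. trans_prob t e e' * g e') - g e - t * L g e
     = (\<Sum>e'\<in>E. g e' * (trans_prob t e e' - indicat_real {e'} e - t * L (indicat_real {e'}) e))"
    by (subst expand[OF assms(1), of g], subst L_expand[OF assms(1), of g])
       (simp add: sum_subtractf sum.distrib sum_distrib_left algebra_simps)
  also have "\<bar>\<dots>\<bar> \<le> (\<Sum>e'\<in>E. \<bar>g e'\<bar> * (t\<^sup>2 * (rate_bound\<^sup>2 * exp (T * rate_bound))))"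
    by (rule order.trans[OF sum_abs]) (intro sum_mono entry_expansion assms)
  also have "\<dots> = t\<^sup>2 * rem_const T g"
    by (simp add: rem_const_def sum_distrib_right[symmetric])
  finally show ?thesis .
qed

lemma back_step_expansion:
  assumes "e \<in> E" "0 \<le> t" "t \<le> T"
  shows "\<bar>(\<Sum>e'\<in>E. trans_prob t e' e * g e') - g e - t * Ladj g e\<bar> \<le> t\<^sup>2 * rem_const T g"
proof -
  have "g e = (\<Sum>e'\<in>E. g e' * indicat_real {e} e')"
    using assms(1) finite_E by (simp add: indicator_def if_distrib cong: if_cong)
  then have "(\<Sum>e'\<in>E. trans_prob t e' e * g e') - g e - t * Ladj g e
     = (\<Sum>e'\<in>E. g e' * (trans_prob t e' e - indicat_real {e} e' - t * L (indicat_real {e}) e'))"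
    unfolding Ladj_def by (simp add: sum_subtractf sum.distrib sum_distrib_left algebra_simps)
  also have "\<bar>\<dots>\<bar> \<le> (\<Sum>e'\<in>E. \<bar>g e'\<bar> * (t\<^sup>2 * (rate_bound\<^sup>2 * exp (T * rate_bound))))"
    by (rule order.trans[OF sum_abs]) (intro sum_mono entry_expansion assms)
  also have "\<dots> = t\<^sup>2 * rem_const T g"
    by (simp add: rem_const_def sum_distrib_right[symmetric])
  finally show ?thesis .
qed

text \<open>Applies the discrete decomposition with time step \<open>T / N\<close>, splitting
  \<open>F\<close> into \<open>F1\<close>, estimated by its second moment, and \<open>F2\<close>,
  estimated in the dual norm of the Dirichlet form. The bound \<open>R N\<close> serves all grid
  times at once, and its mean has a limit that no longer sees the discretisation. Positivity of
  \<open>trans_prob\<close> is assumed here because it is later read off the process.\<close>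

lemma grid_bound:
  assumes nonneg: "\<And>t e e'. 0 \<le> t \<Longrightarrow> e \<in> E \<Longrightarrow> e' \<in> E \<Longrightarrow> 0 \<le> trans_prob t e e'"
    and T: "0 < T" and lam: "0 < lam" and C: "0 \<le> C"
    and F: "\<And>e. e \<in> E \<Longrightarrow> F e = F1 e + F2 e"
    and static: "\<And>g. (avg E (\<lambda>e. F2 e * g e))\<^sup>2 \<le> C * dirichlet g"
  shows "\<exists>R u U. (\<forall>N>0. \<forall>w\<in>PiE {..N} (\<lambda>_. E). \<forall>j\<le>N. (\<Sum>k=1..j. T / real N * F (w k))\<^sup>2 \<le> R N w) \<and>
    (\<forall>N>0. path_mean E (trans_prob (T / real N)) N (R N) \<le> u N) \<and> u \<longlonglongrightarrow> U \<and>
    U \<le> 5 * T\<^sup>2 * avg E (\<lambda>e. (F1 e)\<^sup>2) + 5 * T\<^sup>2 * lam * C + 100 * T * C"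
proof -
  obtain g where g: "\<And>e. e \<in> E \<Longrightarrow> F2 e = lam * g e - (L g e + Ladj g e) / 2"
    using sym_resolvent[OF lam] by blast
  define A where "A = (\<Sum>e\<in>E. \<bar>L g e\<bar>)"
  let ?P = "\<lambda>N. trans_prob (T / real N)"
  let ?st = "\<lambda>N e. \<Sum>e'\<in>E. ?P N e e' * g e'" and ?bk = "\<lambda>N e. \<Sum>e'\<in>E. ?P N e' e * g e'"
  define c where "c N = 2 * ((T / real N)\<^sup>2 * rem_const T g)" for N
  define c' where "c' N = T / real N * A + (T / real N)\<^sup>2 * rem_const T g" for N
  define u where "u N = 5 * (T\<^sup>2 * avg E (\<lambda>e. (F1 e)\<^sup>2) + lam\<^sup>2 * T\<^sup>2 * avg E (\<lambda>e. (g e)\<^sup>2)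
        + 2 * (real N * avg E (\<lambda>e. (g e)\<^sup>2 - (?st N e)\<^sup>2))
        + 8 * (real N * avg E (\<lambda>e. (g e)\<^sup>2 - (?bk N e)\<^sup>2)) + (real N * c N + 2 * c' N)\<^sup>2 / 4)" for N
  have half: "2 * x * ((a + b) / 2) = x * a + x * b" for x a b :: real
    by (simp add: algebra_simps)
  have small: "0 \<le> T / real N" "T / real N \<le> T" if "0 < N" for N
    using that T by (auto simp: field_simps)
  have "\<exists>R. (\<forall>w\<in>PiE {..N} (\<lambda>_. E). \<forall>j\<le>N. (\<Sum>k=1..j. T / real N * F (w k))\<^sup>2 \<le> R w) \<and>
    path_mean E (?P N) N R \<le> u N" if N: "0 < N" for N
  proof -
    interpret D: doubly_stochastic E "?P N"
      by (rule trans_prob_doubly_stochastic) (use small[OF N] nonneg in auto)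
    have "\<exists>R. (\<forall>w\<in>PiE {..N} (\<lambda>_. E). \<forall>j\<le>N. (\<Sum>k=1..j. T / real N * F (w k))\<^sup>2 \<le> R w) \<and>
      path_mean E (?P N) N R \<le> 5 * ((T / real N * real N)\<^sup>2 * avg E (\<lambda>e. (F1 e)\<^sup>2)
        + lam\<^sup>2 * (T / real N * real N)\<^sup>2 * avg E (\<lambda>e. (g e)\<^sup>2)
        + 2 * (real N * D.step_var g) + 8 * (real N * avg E (\<lambda>e. (g e)\<^sup>2 - (?bk N e)\<^sup>2)) + (real N * c N + 2 * c' N)\<^sup>2 / 4)"
    proof (rule D.additive_functional_bound[where S = "\<lambda>e. (L g e + Ladj g e) / 2"])
      show "0 \<le> T / real N" "0 \<le> lam" using small[OF N] lam by auto
      show "F e = F1 e + (lam * g e - (L g e + Ladj g e) / 2)" if "e \<in> E" for e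
        using F g that by simp
      show "\<bar>(D.step g e - g e) + (?bk N e - g e) - 2 * (T / real N) * ((L g e + Ladj g e) / 2)\<bar> \<le> c N" if "e \<in> E" for e
      proof -
        have "\<bar>D.step g e - g e - T / real N * L g e\<bar> \<le> (T / real N)\<^sup>2 * rem_const T g"
          unfolding D.step_def by (rule step_expansion[OF that small[OF N]])
        moreover have "\<bar>?bk N e - g e - T / real N * Ladj g e\<bar> \<le> (T / real N)\<^sup>2 * rem_const T g"
          by (rule back_step_expansion[OF that small[OF N]])
        moreover have "2 * (T / real N) * ((L g e + Ladj g e) / 2) = T / real N * L g e + T / real N * Ladj g e"
          using half[of "T / real N"] by simp
        ultimately show ?thesis unfolding c_def by linarith
      qed
      show "\<bar>D.step g e - g e\<bar> \<le> c' N" if "e \<in> E" for e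
      proof -
        have "\<bar>D.step g e - g e - T / real N * L g e\<bar> \<le> (T / real N)\<^sup>2 * rem_const T g"
          unfolding D.step_def by (rule step_expansion[OF that small[OF N]])
        moreover have "\<bar>L g e\<bar> \<le> A" unfolding A_def using finite_E that by (intro member_le_sum) auto
        then have "\<bar>T / real N * L g e\<bar> \<le> T / real N * A"
          using small[OF N] by (simp only: abs_mult abs_of_nonneg mult_left_mono)
        ultimately show ?thesis unfolding c'_def by linarith
      qed
    qed
    then show ?thesis using N by (simp add: u_def D.step_var_def D.step_def)
  qed
  then obtain R where R: "\<forall>N>0. (\<forall>w\<in>PiE {..N} (\<lambda>_. E). \<forall>j\<le>N. (\<Sum>k=1..j. T / real N * F (w k))\<^sup>2 \<le> R N w) \<and>
    path_mean E (?P N) N (R N) \<le> u N"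
    by metis
  \<comment> \<open>Both variances converge to \<open>2 * T\<close> times the Dirichlet form; with
    weights 2 and 8 and the overall factor 5 this makes 100.\<close>
  define U where "U = 5 * (T\<^sup>2 * avg E (\<lambda>e. (F1 e)\<^sup>2) + lam\<^sup>2 * T\<^sup>2 * avg E (\<lambda>e. (g e)\<^sup>2)
        + 2 * (2 * T * avg E (\<lambda>e. - g e * L g e)) + 8 * (2 * T * avg E (\<lambda>e. - g e * Ladj g e)) + 0\<^sup>2 / 4)"
  have err: "(\<lambda>N. real N * c N + 2 * c' N) \<longlonglongrightarrow> 0"
  proof -
    have inv: "(\<lambda>N. inverse (real N)) \<longlonglongrightarrow> 0" by (rule lim_inverse_n)
    have "(\<lambda>N. 2 * T\<^sup>2 * rem_const T g * inverse (real N) + 2 * (T * inverse (real N) * A + (T * inverse (real N))\<^sup>2 * rem_const T g)) \<longlonglongrightarrow>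
       2 * T\<^sup>2 * rem_const T g * 0 + 2 * (T * 0 * A + (T * 0)\<^sup>2 * rem_const T g)"
      by (intro tendsto_intros inv)
    moreover have "\<forall>\<^sub>F N in sequentially. 2 * T\<^sup>2 * rem_const T g * inverse (real N) + 2 * (T * inverse (real N) * A + (T * inverse (real N))\<^sup>2 * rem_const T g)
       = real N * c N + 2 * c' N"
      by (rule eventually_sequentiallyI[of 1]) (simp add: c_def c'_def divide_inverse power2_eq_square)
    ultimately show ?thesis using tendsto_cong by force
  qed
  have "(\<lambda>N. real N * avg E (\<lambda>e. (g e)\<^sup>2 - (?st N e)\<^sup>2)) \<longlonglongrightarrow> 2 * T * avg E (\<lambda>e. - g e * L g e)"
    by (rule scaled_var_tendsto[OF T, where c="rem_const T g"]) (intro step_expansion small)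
  moreover have "(\<lambda>N. real N * avg E (\<lambda>e. (g e)\<^sup>2 - (?bk N e)\<^sup>2)) \<longlonglongrightarrow> 2 * T * avg E (\<lambda>e. - g e * Ladj g e)"
    by (rule scaled_var_tendsto[OF T, where c="rem_const T g"]) (intro back_step_expansion small)
  ultimately have "u \<longlonglongrightarrow> U"
    unfolding u_def[abs_def] U_def
    by (intro tendsto_add[OF tendsto_add[OF tendsto_add[OF tendsto_add]]] tendsto_mult_left
        tendsto_divide tendsto_power err tendsto_const) auto
  moreover have "U \<le> 5 * T\<^sup>2 * avg E (\<lambda>e. (F1 e)\<^sup>2) + 5 * T\<^sup>2 * lam * C + 100 * T * C"
  proof -
    note en = resolvent_energy[of F2 lam g C, OF g less_imp_le[OF lam] C static]
    have "avg E (\<lambda>e. - g e * Ladj g e) = dirichlet g"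
      using avg_Ladj[of g] by (simp add: dirichlet_def avg_def sum_negf)
    then have "U = 5 * T\<^sup>2 * avg E (\<lambda>e. (F1 e)\<^sup>2) + 5 * T\<^sup>2 * lam * (lam * avg E (\<lambda>e. (g e)\<^sup>2)) + 100 * T * dirichlet g"
      unfolding U_def dirichlet_def[symmetric] by (simp add: power2_eq_square algebra_simps)
    also have "\<dots> \<le> 5 * T\<^sup>2 * avg E (\<lambda>e. (F1 e)\<^sup>2) + 5 * T\<^sup>2 * lam * C + 100 * T * C"
      using en T lam by (intro add_mono mult_left_mono) auto
    finally show ?thesis .
  qed
  ultimately show ?thesis using R by blast
qed

end

section \<open>From the time grid to the process\<close>

context
  fixes h :: "real \<Rightarrow> real" and b T :: real
  assumes right_cont: "\<And>t. 0 \<le> t \<Longrightarrow> (h \<longlongrightarrow> h t) (at_right t)"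
    and bdd: "\<And>t. 0 \<le> t \<Longrightarrow> \<bar>h t\<bar> \<le> b"
    and T: "0 < T"
begin

text \<open>\<open>h\<close> at the right end of the grid cell containing \<open>s\<close>. Adding 1
  to the floor puts that point strictly to the right of \<open>s\<close>, so right-continuity alone
  yields pointwise convergence.\<close>

definition grid_fun :: "nat \<Rightarrow> real \<Rightarrow> real" where
  "grid_fun N s = h (real_of_int (\<lfloor>s * real N / T\<rfloor> + 1) * (T / real N))"

lemma grid_fun_has_integral:
  assumes N: "0 < N"
  shows "(grid_fun N has_integral (\<Sum>k=1..j. T / real N * h (real k * (T / real N)))) {0..real j * (T / real N)}"
proof (induction j)
  case 0
  then show ?case using has_integral_null_real[of 0 0 "grid_fun N"] by simp
next
  case (Suc j)
  let ?d = "T / real N"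
  have d: "0 < ?d" using N T by simp
  have suc_mult: "real (Suc j) * x - real j * x = x" for x by (simp add: algebra_simps)
  have le: "real j * ?d \<le> real (Suc j) * ?d" using d by (intro mult_right_mono) auto
  have "((\<lambda>_. h (real (Suc j) * ?d)) has_integral (real (Suc j) * ?d - real j * ?d) *\<^sub>R h (real (Suc j) * ?d)) {real j * ?d..real (Suc j) * ?d}"
    by (rule has_integral_const_real[THEN has_integral_eq_rhs]) (simp only: content_real[OF le])
  then have c: "((\<lambda>_. h (real (Suc j) * ?d)) has_integral ?d * h (real (Suc j) * ?d)) {real j * ?d..real (Suc j) * ?d}"
    by (simp only: suc_mult real_scaleR_def)
  have "(grid_fun N has_integral ?d * h (real (Suc j) * ?d)) {real j * ?d..real (Suc j) * ?d}"
  proof (rule has_integral_spike_finite[OF _ _ c])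
    show "finite {real (Suc j) * ?d}" by simp
    fix s assume s: "s \<in> {real j * ?d..real (Suc j) * ?d} - {real (Suc j) * ?d}"
    then have "real j \<le> s * real N / T" "s * real N / T < real j + 1"
      using N T by (auto simp: field_simps)
    then have "\<lfloor>s * real N / T\<rfloor> = int j" by (simp add: floor_eq_iff)
    then show "grid_fun N s = h (real (Suc j) * ?d)" by (simp add: grid_fun_def add.commute)
  qed
  then have "(grid_fun N has_integral (\<Sum>k=1..j. ?d * h (real k * ?d)) + ?d * h (real (Suc j) * ?d)) {0..real (Suc j) * ?d}"
    by (intro has_integral_combine[OF _ le Suc]) (use T in simp)
  then show ?case by simp
qed

lemma grid_fun_integrable:
  assumes "0 \<le> u"
  shows "grid_fun N integrable_on {u..t}"
proof (cases "N = 0")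
  case True
  \<comment> \<open>For \<open>N = 0\<close>, division by zero puts every grid point at 0.\<close>
  then have "grid_fun N = (\<lambda>s. h 0)" by (simp add: grid_fun_def fun_eq_iff)
  then show ?thesis by (simp add: integrable_on_const)
next
  case False
  define j where "j = nat \<lceil>t * real N / T\<rceil>"
  have "t * real N / T \<le> real j" unfolding j_def by linarith
  then have "t \<le> real j * (T / real N)" using False T by (simp add: field_simps)
  then have "{u..t} \<subseteq> {0..real j * (T / real N)}" using assms by auto
  then show ?thesis
    using grid_fun_has_integral[of N j] False by (auto intro: integrable_on_subinterval)
qed

lemma grid_fun_bound: "0 \<le> s \<Longrightarrow> \<bar>grid_fun N s\<bar> \<le> b"
  unfolding grid_fun_def using T by (intro bdd mult_nonneg_nonneg) auto

lemma grid_fun_tendsto: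
  assumes s: "0 \<le> s" shows "(\<lambda>N. grid_fun N s) \<longlonglongrightarrow> h s"
proof -
  define x where "x N = real_of_int (\<lfloor>s * real N / T\<rfloor> + 1) * (T / real N)" for N
  have x: "s < x N \<and> x N \<le> s + T * inverse (real N)" if "1 \<le> N" for N
  proof -
    have "s * real N / T < real_of_int (\<lfloor>s * real N / T\<rfloor> + 1)" "real_of_int (\<lfloor>s * real N / T\<rfloor> + 1) \<le> s * real N / T + 1"
      by linarith+
    then have "s * real N / T * (T / real N) < x N" "x N \<le> (s * real N / T + 1) * (T / real N)"
      unfolding x_def using that T by (intro mult_strict_right_mono mult_right_mono; simp)+
    moreover have "s * real N / T * (T / real N) = s" "(s * real N / T + 1) * (T / real N) = s + T * inverse (real N)"
      using that T by (auto simp: field_simps)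
    ultimately show ?thesis by simp
  qed
  have "(\<lambda>N. s + T * inverse (real N)) \<longlonglongrightarrow> s + T * 0" by (intro tendsto_intros lim_inverse_n)
  then have lim: "x \<longlonglongrightarrow> s"
    by (intro tendsto_sandwich[OF _ _ tendsto_const, of s x sequentially "\<lambda>N. s + T * inverse (real N)"])
      (auto intro!: eventually_sequentiallyI[of 1] dest: x less_imp_le)
  have "filterlim x (at_right s) sequentially"
    unfolding filterlim_at
  proof
    show "\<forall>\<^sub>F N in sequentially. x N \<in> {s<..} \<and> x N \<noteq> s"
      by (rule eventually_sequentiallyI[of 1]) (use x in fastforce)
  qed (rule lim)
  then show ?thesis
    unfolding grid_fun_def x_def[symmetric] by (rule filterlim_compose[OF right_cont[OF s]])
qed

text \<open>Dominated convergence handles the step functions. The sum stops at the last grid point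
  up to \<open>t\<close>, and the incomplete cell beyond it costs at most
  \<open>b * T / N\<close>.\<close>

lemma right_riemann_sums:
  assumes t: "0 \<le> t"
  shows "(\<lambda>N. \<Sum>k=1..nat \<lfloor>t * real N / T\<rfloor>. T / real N * h (real k * (T / real N))) \<longlonglongrightarrow> integral {0..t} h"
    and "h integrable_on {0..t}"
proof -
  have *: "h integrable_on {0..t} \<and> (\<lambda>N. integral {0..t} (grid_fun N)) \<longlonglongrightarrow> integral {0..t} h"
    using dominated_convergence[of grid_fun "{0..t}" "\<lambda>_. b" h] grid_fun_integrable[of 0 _ t] grid_fun_bound grid_fun_tendsto
    by (simp add: integrable_on_const)
  then show "h integrable_on {0..t}" by simp
  have b: "0 \<le> b" using bdd[of 0] by simp
  let ?S = "\<lambda>N. \<Sum>k=1..nat \<lfloor>t * real N / T\<rfloor>. T / real N * h (real k * (T / real N))"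
  have "(\<lambda>N. integral {0..t} (grid_fun N) - ?S N) \<longlonglongrightarrow> 0"
  proof (rule Lim_null_comparison)
    show "\<forall>\<^sub>F N in sequentially. norm (integral {0..t} (grid_fun N) - ?S N) \<le> b * T * inverse (real N)"
    proof (rule eventually_sequentiallyI[of 1])
      fix N :: nat assume N: "1 \<le> N"
      define j where "j = nat \<lfloor>t * real N / T\<rfloor>"
      have j: "real j \<le> t * real N / T" "t * real N / T < real j + 1"
        unfolding j_def using t T by (simp_all add: of_nat_nat)
      let ?u = "real j * (T / real N)"
      have tt: "t * real N / T * (T / real N) = t" using N T by simp
      have "real j * (T / real N) \<le> t * real N / T * (T / real N)"
        using j(1) T by (intro mult_right_mono) auto
      moreover have "t * real N / T * (T / real N) \<le> (real j + 1) * (T / real N)"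
        using j(2) T by (intro mult_right_mono) auto
      ultimately have u: "0 \<le> ?u" "?u \<le> t" "t - ?u \<le> T * inverse (real N)"
        using T unfolding tt by (auto simp: distrib_right divide_inverse)
      have "integral {0..?u} (grid_fun N) + integral {?u..t} (grid_fun N) = integral {0..t} (grid_fun N)"
        using u by (intro Henstock_Kurzweil_Integration.integral_combine grid_fun_integrable) auto
      moreover have "integral {0..?u} (grid_fun N) = (\<Sum>k=1..j. T / real N * h (real k * (T / real N)))"
        using N by (intro integral_unique grid_fun_has_integral) auto
      moreover have "norm (integral {?u..t} (grid_fun N)) \<le> b * (t - ?u)"
        using has_integral_bound_real[OF b finite.emptyI integrable_integral[OF grid_fun_integrable[OF u(1), of N t]]]
          grid_fun_bound u by auto
      moreover have "b * (t - ?u) \<le> b * (T * inverse (real N))" using u b by (intro mult_left_mono) auto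
      ultimately show "norm (integral {0..t} (grid_fun N) - ?S N) \<le> b * T * inverse (real N)"
        unfolding j_def[symmetric] real_norm_def mult.assoc by linarith
    qed
    show "(\<lambda>N. b * T * inverse (real N)) \<longlonglongrightarrow> 0"
      using tendsto_mult_left[OF lim_inverse_n, of "b * T"] by simp
  qed
  from tendsto_diff[OF conjunct2[OF *] this] show "?S \<longlonglongrightarrow> integral {0..t} h" by simp
qed

end

section \<open>Laws on the grid, Fatou's lemma and the removal of the resolvent parameter\<close>

context jump_generator
begin

context
  fixes M :: "'a measure" and X :: "real \<Rightarrow> 'a \<Rightarrow> 's" and \<mu> :: "'s pmf"
  assumes process: "markov_process M X E \<mu> L"
    and uniform: "\<And>e. e \<in> E \<Longrightarrow> pmf \<mu> e = 1 / real (card E)"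
begin

lemma prob_space_M: "prob_space M"
  using process by (simp add: markov_process_def)

lemma X_measurable: "0 \<le> t \<Longrightarrow> X t \<in> M \<rightarrow>\<^sub>M count_space E"
  using process by (simp add: markov_process_def)

lemma X_in_E: "0 \<le> t \<Longrightarrow> \<omega> \<in> space M \<Longrightarrow> X t \<omega> \<in> E"
  using measurable_space[OF X_measurable] by simp

lemma fdd:
  assumes "t 0 = 0" "\<And>i. i < k \<Longrightarrow> t i \<le> t (Suc i)" "\<And>i. i \<le> k \<Longrightarrow> e i \<in> E"
  shows "measure M {\<omega> \<in> space M. \<forall>i\<le>k. X (t i) \<omega> = e i} =
    (\<Prod>i<k. trans_prob (t (Suc i) - t i) (e i) (e (Suc i))) / real (card E)"
proof -
  have "measure M {\<omega> \<in> space M. \<forall>i\<le>k. X (t i) \<omega> = e i} =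
      pmf \<mu> (e 0) * (\<Prod>i<k. semigroup_of L (t (Suc i) - t i) (indicat_real {e (Suc i)}) (e i))"
    using process assms unfolding markov_process_def by blast
  then show ?thesis using uniform[of "e 0"] assms by (simp add: trans_prob_def)
qed

lemma card_E_pos: "0 < real (card E)"
  using finite_E nonempty_E by (simp add: card_gt_0_iff)

text \<open>The process supplies positivity: up to the positive weight \<open>1 / card E\<close> of
  the initial state, the number is a two-time probability.\<close>

lemma trans_prob_nonneg:
  assumes "0 \<le> t" "e \<in> E" "e' \<in> E" shows "0 \<le> trans_prob t e e'"
proof -
  define s where "s i = (if i = 0 then 0 else t)" for i :: nat
  define w where "w i = (if i = 0 then e else e')" for i :: nat
  have "measure M {\<omega> \<in> space M. \<forall>i\<le>1. X (s i) \<omega> = w i}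
      = (\<Prod>i<1. trans_prob (s (Suc i) - s i) (w i) (w (Suc i))) / real (card E)"
    using assms by (intro fdd) (auto simp: s_def w_def)
  then have "measure M {\<omega> \<in> space M. \<forall>i\<le>1. X (s i) \<omega> = w i} = trans_prob t e e' / real (card E)"
    by (simp only: lessThan_Suc One_nat_def lessThan_0 prod.insert[OF finite.emptyI] empty_iff not_False_eq_True prod.empty)
      (simp add: s_def w_def)
  moreover have "0 \<le> measure M {\<omega> \<in> space M. \<forall>i\<le>1. X (s i) \<omega> = w i}"
    by (rule measure_nonneg)
  ultimately have "0 \<le> trans_prob t e e' / real (card E)" by (simp only:)
  then show ?thesis using card_E_pos by (simp add: zero_le_divide_iff)
qed

lemma path_event:
  fixes t :: "nat \<Rightarrow> real" and k :: nat
  shows "\<forall>i\<le>k. 0 \<le> t i \<Longrightarrow> {\<omega> \<in> space M. \<forall>i\<le>k. X (t i) \<omega> = e i} \<in> sets M"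
proof -
  assume t: "\<forall>i\<le>k. 0 \<le> t i"
  have "{\<omega> \<in> space M. \<forall>i\<in>{..k}. X (t i) \<omega> = e i} \<in> sets M"
  proof (rule sets.sets_Collect_finite_All)
    fix i assume i: "i \<in> {..k}"
    have "X (t i) -` {e i} \<inter> space M \<in> sets M"
    proof (cases "e i \<in> E")
      case True
      then show ?thesis using X_measurable t i by (intro measurable_sets[of _ _ "count_space E"]) auto
    next
      case False
      then have "X (t i) -` {e i} \<inter> space M = {}" using X_in_E[of "t i"] t i by fastforce
      then show ?thesis by simp
    qed
    then show "{\<omega> \<in> space M. X (t i) \<omega> = e i} \<in> sets M" by (simp add: vimage_def Int_def conj_commute)
  qed simp
  then show ?thesis by (simp only: Ball_def atMost_iff)
qed

text \<open>Observed on the grid, the process takes finitely many paths, so a path functional is a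
  finite combination of indicators of cylinder events, whose probabilities are the
  finite-dimensional distributions.\<close>

lemma
  assumes T: "0 \<le> d" and \<Phi>: "\<And>w. w \<in> PiE {..N} (\<lambda>_. E) \<Longrightarrow> 0 \<le> \<Phi> w"
  defines "Y \<equiv> \<lambda>\<omega>. restrict (\<lambda>k. X (real k * d) \<omega>) {..N}"
  shows nn_integral_path: "(\<integral>\<^sup>+\<omega>. ennreal (\<Phi> (Y \<omega>)) \<partial>M) = ennreal (path_mean E (trans_prob d) N \<Phi>)" (is ?int)
    and measurable_path: "(\<lambda>\<omega>. ennreal (\<Phi> (Y \<omega>))) \<in> borel_measurable M" (is ?meas)
proof -
  interpret prob_space M by (rule prob_space_M)
  let ?A = "\<lambda>w. {\<omega> \<in> space M. \<forall>i\<le>N. X (real i * d) \<omega> = w i}"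
  have A: "?A w \<in> sets M" for w using T by (intro path_event) auto
  have fin: "finite (PiE {..N} (\<lambda>_. E))" using finite_E by (intro finite_PiE) auto
  have eq: "ennreal (\<Phi> (Y \<omega>)) = (\<Sum>w\<in>PiE {..N} (\<lambda>_. E). ennreal (\<Phi> w) * indicator (?A w) \<omega>)" if \<omega>: "\<omega> \<in> space M" for \<omega>
  proof -
    have YE: "Y \<omega> \<in> PiE {..N} (\<lambda>_. E)" using X_in_E[OF _ \<omega>] T by (auto simp: Y_def)
    have "indicator (?A w) \<omega> = (if w = Y \<omega> then 1 else 0 :: ennreal)" if w: "w \<in> PiE {..N} (\<lambda>_. E)" for w
    proof -
      have "\<omega> \<in> ?A w \<longleftrightarrow> w = Y \<omega>"
      proof
        assume "\<omega> \<in> ?A w"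
        then show "w = Y \<omega>" using PiE_arb[OF w] by (intro ext) (auto simp: Y_def)
      qed (auto simp: Y_def \<omega>)
      then show ?thesis by (simp add: indicator_def)
    qed
    then have "(\<Sum>w\<in>PiE {..N} (\<lambda>_. E). ennreal (\<Phi> w) * indicator (?A w) \<omega>)
      = (\<Sum>w\<in>PiE {..N} (\<lambda>_. E). if w = Y \<omega> then ennreal (\<Phi> w) else 0)"
      by (intro sum.cong) auto
    then show ?thesis using fin YE by simp
  qed
  have meas1: "(\<lambda>\<omega>. \<Sum>w\<in>PiE {..N} (\<lambda>_. E). ennreal (\<Phi> w) * indicator (?A w) \<omega>) \<in> borel_measurable M"
    using A by (intro borel_measurable_sum borel_measurable_times_ennreal borel_measurable_const borel_measurable_indicator)
  show ?meas by (rule measurable_cong[THEN iffD2, OF eq meas1])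
  have "(\<integral>\<^sup>+\<omega>. ennreal (\<Phi> (Y \<omega>)) \<partial>M) = (\<integral>\<^sup>+\<omega>. (\<Sum>w\<in>PiE {..N} (\<lambda>_. E). ennreal (\<Phi> w) * indicator (?A w) \<omega>) \<partial>M)"
    by (rule nn_integral_cong) (rule eq)
  also have "\<dots> = (\<Sum>w\<in>PiE {..N} (\<lambda>_. E). ennreal (\<Phi> w) * emeasure M (?A w))"
  proof -
    have "(\<integral>\<^sup>+\<omega>. (\<Sum>w\<in>PiE {..N} (\<lambda>_. E). ennreal (\<Phi> w) * indicator (?A w) \<omega>) \<partial>M)
      = (\<Sum>w\<in>PiE {..N} (\<lambda>_. E). \<integral>\<^sup>+\<omega>. ennreal (\<Phi> w) * indicator (?A w) \<omega> \<partial>M)"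
      by (rule nn_integral_sum) (intro borel_measurable_times_ennreal borel_measurable_const borel_measurable_indicator A)
    then show ?thesis by (simp only: nn_integral_cmult_indicator[OF A])
  qed
  also have "\<dots> = (\<Sum>w\<in>PiE {..N} (\<lambda>_. E). ennreal ((\<Prod>i<N. trans_prob d (w i) (w (Suc i))) * \<Phi> w / real (card E)))"
  proof (rule sum.cong)
    fix w assume w: "w \<in> PiE {..N} (\<lambda>_. E)"
    have "measure M (?A w) = (\<Prod>i<N. trans_prob d (w i) (w (Suc i))) / real (card E)"
      using T PiE_mem[OF w] by (subst fdd) (auto simp: algebra_simps)
    then show "ennreal (\<Phi> w) * emeasure M (?A w) = ennreal ((\<Prod>i<N. trans_prob d (w i) (w (Suc i))) * \<Phi> w / real (card E))"
      using \<Phi>[OF w] by (simp add: emeasure_eq_measure ennreal_mult'[symmetric] mult_ac)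
  qed simp
  also have "\<dots> = ennreal (path_mean E (trans_prob d) N \<Phi>)"
    unfolding path_mean_def sum_divide_distrib
  proof (rule sum_ennreal)
    fix w assume w: "w \<in> PiE {..N} (\<lambda>_. E)"
    show "0 \<le> (\<Prod>i<N. trans_prob d (w i) (w (Suc i))) * \<Phi> w / real (card E)"
      using PiE_mem[OF w] \<Phi>[OF w] T
      by (intro divide_nonneg_nonneg mult_nonneg_nonneg prod_nonneg) (auto intro!: trans_prob_nonneg)
  qed
  finally show ?int .
qed

text \<open>For each t the time integral is a limit of Riemann sums with at most \<open>N\<close>
  terms, all bounded by the same \<open>R N\<close>. The resulting lower limit does not depend on t,
  so it dominates the supremum, and Fatou's lemma applies to the measurable majorants
  \<open>Z N\<close>.\<close>

lemma sup_sq_integral_bound_aux: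
  assumes T: "0 < T" and lam: "0 < lam" and C: "0 \<le> C"
    and F: "\<And>e. e \<in> E \<Longrightarrow> F e = F1 e + F2 e"
    and static: "\<And>g. (avg E (\<lambda>e. F2 e * g e))\<^sup>2 \<le> C * dirichlet g"
  shows "sup_sq_integral M T (\<lambda>s \<omega>. F (X s \<omega>)) \<le>
    ennreal (5 * T\<^sup>2 * avg E (\<lambda>e. (F1 e)\<^sup>2) + 5 * T\<^sup>2 * lam * C + 100 * T * C)" (is "_ \<le> ennreal ?rhs")
proof -
  have gb: "\<exists>R u U. (\<forall>N>0. \<forall>w\<in>PiE {..N} (\<lambda>_. E). \<forall>j\<le>N. (\<Sum>k=1..j. T / real N * F (w k))\<^sup>2 \<le> R N w) \<and>
    (\<forall>N>0. path_mean E (trans_prob (T / real N)) N (R N) \<le> u N) \<and> u \<longlonglongrightarrow> U \<and> U \<le> ?rhs"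
    by (rule grid_bound[OF trans_prob_nonneg T lam C F static])
  obtain R u U where R': "\<forall>N>0. \<forall>w\<in>PiE {..N} (\<lambda>_. E). \<forall>j\<le>N. (\<Sum>k=1..j. T / real N * F (w k))\<^sup>2 \<le> R N w"
    and u': "\<forall>N>0. path_mean E (trans_prob (T / real N)) N (R N) \<le> u N"
    and U: "u \<longlonglongrightarrow> U" "U \<le> ?rhs"
    using gb by (elim exE conjE) (rule that)
  have R: "(\<Sum>k=1..j. T / real N * F (w k))\<^sup>2 \<le> R N w" if "0 < N" "w \<in> PiE {..N} (\<lambda>_. E)" "j \<le> N" for N w j
    using R' that by blast
  have u: "path_mean E (trans_prob (T / real N)) N (R N) \<le> u N" if "0 < N" for N
    using u' that by blast
  define Y where "Y N \<omega> = restrict (\<lambda>k. X (real k * (T / real N)) \<omega>) {..N}" for N \<omega>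
  \<comment> \<open>\<open>R N\<close> is controlled for positive \<open>N\<close> only, hence the
    dummy value at 0.\<close>
  define Z where "Z N \<omega> = (if N = 0 then 0 else ennreal (R N (Y N \<omega>)))" for N \<omega>
  have d: "0 \<le> T / real N" for N using T by simp
  have Rpos: "0 \<le> R N w" if "0 < N" "w \<in> PiE {..N} (\<lambda>_. E)" for N w
    using R[OF that, of 0] by simp
  have Zint: "(\<integral>\<^sup>+\<omega>. Z N \<omega> \<partial>M) \<le> ennreal (u N)" if "0 < N" for N
  proof -
    have "(\<integral>\<^sup>+\<omega>. Z N \<omega> \<partial>M) = ennreal (path_mean E (trans_prob (T / real N)) N (R N))"
      using nn_integral_path[of "T / real N" N "R N", OF d Rpos[OF that]] that
      by (simp only: Z_def Y_def if_False less_numeral_extra(3) neq0_conv[symmetric])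
    then show ?thesis using u[OF that] by (simp add: ennreal_leI)
  qed
  have Zmeas: "Z N \<in> borel_measurable M" for N
  proof (cases "N = 0")
    case False
    then show ?thesis
      using measurable_path[of "T / real N" N "R N", OF d Rpos] unfolding Z_def[abs_def] Y_def by simp
  qed (simp add: Z_def[abs_def])
  have "(SUP t\<in>{0..T}. ennreal ((integral {0..t} (\<lambda>s. F (X s \<omega>)))\<^sup>2)) \<le> liminf (\<lambda>N. Z N \<omega>)"
    if \<omega>: "\<omega> \<in> space M" for \<omega>
  proof (rule SUP_least)
    fix t assume t: "t \<in> {0..T}"
    let ?h = "\<lambda>s. F (X s \<omega>)"
    let ?S = "\<lambda>N. \<Sum>k=1..nat \<lfloor>t * real N / T\<rfloor>. T / real N * ?h (real k * (T / real N))"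
    have rc: "(?h \<longlongrightarrow> ?h s) (at_right s)" if "0 \<le> s" for s
    proof (rule tendsto_eventually)
      have "\<forall>\<^sub>F r in at_right s. X r \<omega> = X s \<omega>"
        using process \<omega> that unfolding markov_process_def by blast
      then show "\<forall>\<^sub>F r in at_right s. ?h r = ?h s" by eventually_elim simp
    qed
    have "\<bar>?h s\<bar> \<le> (\<Sum>e\<in>E. \<bar>F e\<bar>)" if "0 \<le> s" for s
      using X_in_E[OF that \<omega>] finite_E by (intro member_le_sum) auto
    then have "?S \<longlonglongrightarrow> integral {0..t} ?h"
      using right_riemann_sums(1)[of ?h _ T t] rc T t by auto
    then have "(\<lambda>N. ennreal ((?S N)\<^sup>2)) \<longlonglongrightarrow> ennreal ((integral {0..t} ?h)\<^sup>2)"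
      by (intro tendsto_ennrealI tendsto_power)
    then have "ennreal ((integral {0..t} ?h)\<^sup>2) = liminf (\<lambda>N. ennreal ((?S N)\<^sup>2))"
      by (intro lim_imp_Liminf[symmetric]) auto
    also have "\<dots> \<le> liminf (\<lambda>N. Z N \<omega>)"
    proof (rule Liminf_mono, rule eventually_sequentiallyI[of 1])
      fix N :: nat assume N: "1 \<le> N"
      define j where "j = nat \<lfloor>t * real N / T\<rfloor>"
      have "t * real N / T \<le> real N" using t T N by (simp add: field_simps mult_right_mono)
      then have "\<lfloor>t * real N / T\<rfloor> \<le> int N" by linarith
      then have j: "j \<le> N" unfolding j_def by simp
      have YE: "Y N \<omega> \<in> PiE {..N} (\<lambda>_. E)" using X_in_E[OF _ \<omega>] T by (auto simp: Y_def)
      have "?S N = (\<Sum>k=1..j. T / real N * F (Y N \<omega> k))"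
        unfolding j_def[symmetric] using j by (intro sum.cong) (auto simp: Y_def)
      then have "(?S N)\<^sup>2 \<le> R N (Y N \<omega>)" using R[OF _ YE j] N by simp
      then show "ennreal ((?S N)\<^sup>2) \<le> Z N \<omega>" using N by (simp add: Z_def ennreal_leI)
    qed
    finally show "ennreal ((integral {0..t} ?h)\<^sup>2) \<le> liminf (\<lambda>N. Z N \<omega>)" .
  qed
  then have "sup_sq_integral M T (\<lambda>s \<omega>. F (X s \<omega>)) \<le> (\<integral>\<^sup>+\<omega>. liminf (\<lambda>N. Z N \<omega>) \<partial>M)"
    unfolding sup_sq_integral_def by (intro nn_integral_mono)
  also have "\<dots> \<le> liminf (\<lambda>N. \<integral>\<^sup>+\<omega>. Z N \<omega> \<partial>M)"
    by (rule nn_integral_liminf) (rule Zmeas)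
  also have "\<dots> \<le> liminf (\<lambda>N. ennreal (u N))"
    by (intro Liminf_mono eventually_sequentiallyI[of 1] Zint) auto
  also have "\<dots> = ennreal U"
    by (intro lim_imp_Liminf tendsto_ennrealI U(1)) auto
  also have "\<dots> \<le> ennreal ?rhs" using U(2) by (rule ennreal_leI)
  finally show ?thesis .
qed

text \<open>The static constant \<open>C\<close> does not depend on \<open>lam\<close>, so
  \<open>lam\<close> can be sent to 0 in the previous bound.\<close>

theorem sup_sq_integral_bound:
  assumes T: "0 < T" and C: "0 \<le> C"
    and F: "\<And>e. e \<in> E \<Longrightarrow> F e = F1 e + F2 e"
    and static: "\<And>g. (avg E (\<lambda>e. F2 e * g e))\<^sup>2 \<le> C * dirichlet g"
  shows "sup_sq_integral M T (\<lambda>s \<omega>. F (X s \<omega>)) \<le> ennreal (5 * T\<^sup>2 * avg E (\<lambda>e. (F1 e)\<^sup>2) + 100 * T * C)"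
proof (rule ennreal_le_epsilon)
  fix \<delta> :: real assume \<delta>: "0 < \<delta>"
  have q: "0 < 5 * T\<^sup>2 * C + 1" using C by (simp add: add_nonneg_pos)
  \<comment> \<open>Makes the \<open>lam\<close> term at most \<open>\<delta>\<close>; the summand 1
    covers the case C = 0.\<close>
  define lam where "lam = \<delta> / (5 * T\<^sup>2 * C + 1)"
  have lam: "0 < lam" using \<delta> q by (simp add: lam_def)
  have "5 * T\<^sup>2 * lam * C = \<delta> * (5 * T\<^sup>2 * C / (5 * T\<^sup>2 * C + 1))" by (simp add: lam_def)
  also have "\<dots> \<le> \<delta> * 1" using \<delta> q by (intro mult_left_mono) auto
  finally have "5 * T\<^sup>2 * lam * C \<le> \<delta>" by simp
  then have "sup_sq_integral M T (\<lambda>s \<omega>. F (X s \<omega>)) \<le> ennreal ((5 * T\<^sup>2 * avg E (\<lambda>e. (F1 e)\<^sup>2) + 100 * T * C) + \<delta>)"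
    by (intro order.trans[OF sup_sq_integral_bound_aux[OF T lam C F static]] ennreal_leI) auto
  also have "\<dots> = ennreal (5 * T\<^sup>2 * avg E (\<lambda>e. (F1 e)\<^sup>2) + 100 * T * C) + ennreal \<delta>"
    using T C \<delta> by (intro ennreal_plus add_nonneg_nonneg mult_nonneg_nonneg avg_nonneg) auto
  finally show "sup_sq_integral M T (\<lambda>s \<omega>. F (X s \<omega>)) \<le> ennreal (5 * T\<^sup>2 * avg E (\<lambda>e. (F1 e)\<^sup>2) + 100 * T * C) + ennreal \<delta>" .
qed

end

end

section \<open>The exclusion generator\<close>

lemma finite_Sites [simp]: "finite (Sites n)"
  by (simp add: Sites_def)

lemma finite_configs [simp]: "finite (configs n)"
  by (simp add: configs_def finite_PiE)

lemma configs_nonempty: "configs n \<noteq> {}"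
  by (simp add: configs_def PiE_eq_empty_iff)

lemma config_cases: "\<eta> \<in> configs n \<Longrightarrow> x \<in> Sites n \<Longrightarrow> \<eta> x = 0 \<or> \<eta> x = 1"
  unfolding configs_def by (drule PiE_mem) auto

lemma swap_in_configs: "\<eta> \<in> configs n \<Longrightarrow> x \<in> Sites n \<Longrightarrow> y \<in> Sites n \<Longrightarrow> swap x y \<eta> \<in> configs n"
  by (auto simp: configs_def swap_def PiE_def extensional_def Pi_def)

lemma flip_in_configs: "\<eta> \<in> configs n \<Longrightarrow> x \<in> Sites n \<Longrightarrow> flip x \<eta> \<in> configs n"
  by (auto simp: configs_def flip_def PiE_def extensional_def Pi_def)

lemma swap_swap [simp]: "swap x y (swap x y \<eta>) = \<eta>"
  by (auto simp: swap_def fun_eq_iff)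

lemma flip_flip [simp]: "flip x (flip x \<eta>) = \<eta>"
  by (auto simp: flip_def fun_eq_iff)

lemma swap_commute: "swap x y = swap y x"
  by (auto simp: swap_def fun_eq_iff)

lemma sum_swap:
  assumes "x \<in> Sites n" "y \<in> Sites n"
  shows "(\<Sum>\<eta>\<in>configs n. f (swap x y \<eta>)) = (\<Sum>\<eta>\<in>configs n. f \<eta>)"
  by (rule sum.reindex_bij_witness[where i="swap x y" and j="swap x y"]) (auto simp: swap_in_configs assms)

lemma sum_flip:
  assumes "x \<in> Sites n"
  shows "(\<Sum>\<eta>\<in>configs n. f (flip x \<eta>)) = (\<Sum>\<eta>\<in>configs n. f \<eta>)"
  by (rule sum.reindex_bij_witness[where i="flip x" and j="flip x"]) (auto simp: flip_in_configs assms)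

lemma nu_half_uniform:
  assumes "\<eta> \<in> configs n" shows "pmf (nu_half n) \<eta> = 1 / real (card (configs n))"
proof -
  let ?q = "map_pmf of_bool (bernoulli_pmf (1/2)) :: real pmf"
  have inj: "inj (of_bool :: bool \<Rightarrow> real)" by (auto simp: inj_def)
  have "pmf ?q (of_bool b) = 1/2" for b
    by (subst pmf_map_inj'[OF inj]) (cases b, auto)
  from this[of True] this[of False] have q: "pmf ?q 1 = 1/2" "pmf ?q 0 = 1/2" by simp_all
  have "pmf (nu_half n) \<eta> = (\<Prod>x\<in>Sites n. pmf ?q (\<eta> x))"
    unfolding nu_half_def using assms by (intro pmf_Pi') (auto simp: configs_def PiE_def extensional_def)
  also have "\<dots> = (\<Prod>x\<in>Sites n. 1/2)"
  proof (rule prod.cong)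
    fix x assume "x \<in> Sites n"
    from config_cases[OF assms this] show "pmf ?q (\<eta> x) = 1/2"
      by (elim disjE) (simp_all only: q)
  qed simp
  also have "\<dots> = 1 / real (card (configs n))"
    by (simp add: configs_def card_PiE power_divide)
  finally show ?thesis .
qed

section \<open>Jump rates and invariance of the uniform law\<close>

lemma p_rate_nonneg: "0 \<le> p_rate \<gamma> x"
  by (simp add: p_rate_def)

lemma s_rate_nonneg: "0 \<le> s_rate \<alpha> x"
  by (simp add: s_rate_def)

lemma p_rate_summable:
  assumes "0 < \<gamma>" shows "p_rate \<gamma> summable_on A"
proof -
  have "summable (\<lambda>k. real (Suc k) powr (-1 - \<gamma>))"
    using assms summable_Suc_iff[of "\<lambda>k. real k powr (-1 - \<gamma>)"] by (simp add: summable_real_powr_iff)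
  then have "(\<lambda>k. real (Suc k) powr (-1 - \<gamma>)) summable_on UNIV"
    by (intro norm_summable_imp_summable_on) simp
  then have "(p_rate \<gamma> \<circ> (\<lambda>k. int (Suc k))) summable_on UNIV"
    by (simp add: p_rate_def o_def)
  then have "p_rate \<gamma> summable_on range (\<lambda>k. int (Suc k))"
    by (subst summable_on_reindex) (auto simp: inj_on_def)
  moreover have "p_rate \<gamma> x = 0" if "x \<notin> range (\<lambda>k. int (Suc k))" for x
  proof (rule ccontr)
    assume "p_rate \<gamma> x \<noteq> 0"
    then have "x = int (Suc (nat (x - 1)))" by (auto simp: p_rate_def split: if_splits)
    with that show False by blast
  qed
  ultimately have "p_rate \<gamma> summable_on UNIV"
    by (subst summable_on_cong_neutral[where T="range (\<lambda>k. int (Suc k))" and g="p_rate \<gamma>"]) auto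
  then show ?thesis by (rule summable_on_subset_banach) simp
qed

text \<open>Jumps into \<open>z\<close> start to its left, so sites and reservoir positions on the
  right contribute nothing. Together with the outgoing version: with its reservoir included, each
  site has equal total rates in and out.\<close>

lemma p_rate_in_total:
  assumes "0 < \<gamma>" "z \<in> Sites n"
  shows "(\<Sum>x\<in>Sites n. p_rate \<gamma> (z - x)) + (\<Sum>\<^sub>\<infinity>y\<in>{..0}. p_rate \<gamma> (z - y)) = (\<Sum>\<^sub>\<infinity>k. p_rate \<gamma> k)"
proof -
  have sm: "(\<lambda>y. p_rate \<gamma> (z - y)) summable_on A" for A
  proof -
    have "p_rate \<gamma> summable_on ((\<lambda>y. z - y) ` A)" by (rule p_rate_summable[OF assms(1)])
    then show ?thesis by (subst (asm) summable_on_reindex) (auto simp: inj_on_def o_def)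
  qed
  have "(\<Sum>x\<in>Sites n. p_rate \<gamma> (z - x)) + (\<Sum>\<^sub>\<infinity>y\<in>{..0}. p_rate \<gamma> (z - y))
      = (\<Sum>\<^sub>\<infinity>y\<in>Sites n \<union> {..0}. p_rate \<gamma> (z - y))"
    by (subst infsum_Un_disjoint[OF sm sm]) (auto simp: Sites_def)
  also have "\<dots> = (\<Sum>\<^sub>\<infinity>y\<in>UNIV. p_rate \<gamma> (z - y))"
    using assms(2) by (intro infsum_cong_neutral) (auto simp: Sites_def p_rate_def)
  also have "\<dots> = (\<Sum>\<^sub>\<infinity>k\<in>(\<lambda>y. z - y) ` UNIV. p_rate \<gamma> k)"
    by (subst infsum_reindex) (auto simp: inj_on_def o_def)
  also have "(\<lambda>y. z - y) ` UNIV = UNIV" using surj_def[of "\<lambda>y. z - y"] by (metis diff_diff_eq2 diff_add_cancel add_diff_cancel_left' minus_diff_eq surjI)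
  finally show ?thesis .
qed

lemma p_rate_out_total:
  assumes "0 < \<gamma>" "z \<in> Sites n"
  shows "(\<Sum>y\<in>Sites n. p_rate \<gamma> (y - z)) + (\<Sum>\<^sub>\<infinity>y\<in>{int n..}. p_rate \<gamma> (y - z)) = (\<Sum>\<^sub>\<infinity>k. p_rate \<gamma> k)"
proof -
  have sm: "(\<lambda>y. p_rate \<gamma> (y - z)) summable_on A" for A
  proof -
    have "p_rate \<gamma> summable_on ((\<lambda>y. y - z) ` A)" by (rule p_rate_summable[OF assms(1)])
    then show ?thesis by (subst (asm) summable_on_reindex) (auto simp: inj_on_def o_def)
  qed
  have "(\<Sum>y\<in>Sites n. p_rate \<gamma> (y - z)) + (\<Sum>\<^sub>\<infinity>y\<in>{int n..}. p_rate \<gamma> (y - z))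
      = (\<Sum>\<^sub>\<infinity>y\<in>Sites n \<union> {int n..}. p_rate \<gamma> (y - z))"
    by (subst infsum_Un_disjoint[OF sm sm]) (auto simp: Sites_def)
  also have "\<dots> = (\<Sum>\<^sub>\<infinity>y\<in>UNIV. p_rate \<gamma> (y - z))"
    using assms(2) by (intro infsum_cong_neutral) (auto simp: Sites_def p_rate_def)
  also have "\<dots> = (\<Sum>\<^sub>\<infinity>k\<in>(\<lambda>y. y - z) ` UNIV. p_rate \<gamma> k)"
    by (subst infsum_reindex) (auto simp: inj_on_def o_def)
  also have "(\<lambda>y. y - z) ` UNIV = UNIV" by (rule surjI[of _ "\<lambda>k. k + z"]) simp
  finally show ?thesis .
qed

text \<open>Exchanges are indexed by ordered pairs, so each occurs twice; this compensates the
  factor 1/2 in the Dirichlet form.\<close>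

definition moves :: "nat \<Rightarrow> (int \<times> int + int) set" where
  "moves n = (Sites n \<times> Sites n) <+> Sites n"

fun move :: "int \<times> int + int \<Rightarrow> config \<Rightarrow> config" where
  "move (Inl (x, y)) = swap x y"
| "move (Inr x) = flip x"

fun move_rate :: "real \<Rightarrow> real \<Rightarrow> real \<Rightarrow> nat \<Rightarrow> int \<times> int + int \<Rightarrow> config \<Rightarrow> real" where
  "move_rate \<alpha> \<gamma> \<theta> n (Inl (x, y)) \<eta> =
     real n ^ 2 * s_rate \<alpha> (x - y) + real n powr \<theta> * (p_rate \<gamma> (y - x) * \<eta> x * (1 - \<eta> y))"
| "move_rate \<alpha> \<gamma> \<theta> n (Inr x) \<eta> =
     real n ^ 2 * (1/2 * (\<Sum>\<^sub>\<infinity>y\<in>- Sites n. s_rate \<alpha> (x - y)))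
     + real n powr \<theta> * (1/2 * (\<Sum>\<^sub>\<infinity>y\<in>{..0}. p_rate \<gamma> (x - y)) * (1 - \<eta> x) + 1/2 * (\<Sum>\<^sub>\<infinity>y\<in>{int n..}. p_rate \<gamma> (y - x)) * \<eta> x)"

lemma generator_eq_moves:
  "generator \<alpha> \<gamma> \<theta> n f \<eta> = (\<Sum>k\<in>moves n. move_rate \<alpha> \<gamma> \<theta> n k \<eta> * (f (move k \<eta>) - f \<eta>))"
proof -
  have "(\<Sum>k\<in>moves n. move_rate \<alpha> \<gamma> \<theta> n k \<eta> * (f (move k \<eta>) - f \<eta>))
    = (\<Sum>(x, y)\<in>Sites n \<times> Sites n. move_rate \<alpha> \<gamma> \<theta> n (Inl (x, y)) \<eta> * (f (swap x y \<eta>) - f \<eta>))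
      + (\<Sum>x\<in>Sites n. move_rate \<alpha> \<gamma> \<theta> n (Inr x) \<eta> * (f (flip x \<eta>) - f \<eta>))"
    unfolding moves_def by (subst sum.Plus) (auto simp: o_def intro!: sum.cong)
  also have "(\<Sum>(x, y)\<in>Sites n \<times> Sites n. move_rate \<alpha> \<gamma> \<theta> n (Inl (x, y)) \<eta> * (f (swap x y \<eta>) - f \<eta>))
    = real n ^ 2 * (\<Sum>x\<in>Sites n. \<Sum>y\<in>Sites n. s_rate \<alpha> (x - y) * (f (swap x y \<eta>) - f \<eta>))
    + real n powr \<theta> * (\<Sum>x\<in>Sites n. \<Sum>y\<in>Sites n. p_rate \<gamma> (y - x) * \<eta> x * (1 - \<eta> y) * (f (swap x y \<eta>) - f \<eta>))"
    by (simp add: sum.cartesian_product[symmetric] distrib_right sum.distrib sum_distrib_left mult.assoc)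
  also have "(\<Sum>x\<in>Sites n. move_rate \<alpha> \<gamma> \<theta> n (Inr x) \<eta> * (f (flip x \<eta>) - f \<eta>))
    = real n ^ 2 * (1/2 * (\<Sum>x\<in>Sites n. (\<Sum>\<^sub>\<infinity>y\<in>- Sites n. s_rate \<alpha> (x - y)) * (f (flip x \<eta>) - f \<eta>)))
    + real n powr \<theta> * (1/2 * (\<Sum>x\<in>Sites n. (\<Sum>\<^sub>\<infinity>y\<in>{..0}. p_rate \<gamma> (x - y)) * (1 - \<eta> x) * (f (flip x \<eta>) - f \<eta>))
      + 1/2 * (\<Sum>x\<in>Sites n. (\<Sum>\<^sub>\<infinity>y\<in>{int n..}. p_rate \<gamma> (y - x)) * \<eta> x * (f (flip x \<eta>) - f \<eta>)))"
    unfolding move_rate.simps distrib_right distrib_left sum.distrib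
    by (simp only: sum_distrib_left mult.assoc)
  finally show ?thesis
    unfolding generator_def gen_sym_def gen_asym_def infsum_cmult_left' by (simp only: distrib_left add_ac)
qed

text \<open>Exchanges and flips are bijections of the configurations, which settles the symmetric
  part. In the asymmetric part a change of variables moves everything onto \<open>f\<close>, leaving
  a bulk current and reservoir terms. The rate balance turns the bulk current into a boundary term,
  and reservoirs of density 1/2 cancel precisely that.\<close>

lemma generator_invariant:
  assumes "0 < \<gamma>" shows "(\<Sum>\<eta>\<in>configs n. generator \<alpha> \<gamma> \<theta> n f \<eta>) = 0"
proof -
  let ?S = "Sites n" and ?E = "configs n"
  define l where "l x = (\<Sum>\<^sub>\<infinity>y\<in>{..0}. p_rate \<gamma> (x - y))" for x
  define r where "r x = (\<Sum>\<^sub>\<infinity>y\<in>{int n..}. p_rate \<gamma> (y - x))" for x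
  have sym1: "(\<Sum>\<eta>\<in>?E. f (swap x y \<eta>) - f \<eta>) = 0" if "x \<in> ?S" "y \<in> ?S" for x y
    using sum_swap[OF that, of f] by (simp add: sum_subtractf)
  have sym2: "(\<Sum>\<eta>\<in>?E. f (flip x \<eta>) - f \<eta>) = 0" if "x \<in> ?S" for x
    using sum_flip[OF that, of f] by (simp add: sum_subtractf)
  have sym: "(\<Sum>\<eta>\<in>?E. gen_sym \<alpha> n f \<eta>) = 0"
  proof -
    have "(\<Sum>\<eta>\<in>?E. \<Sum>x\<in>?S. \<Sum>y\<in>?S. s_rate \<alpha> (x - y) * (f (swap x y \<eta>) - f \<eta>))
      = (\<Sum>x\<in>?S. \<Sum>y\<in>?S. s_rate \<alpha> (x - y) * (\<Sum>\<eta>\<in>?E. f (swap x y \<eta>) - f \<eta>))"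
      by (subst sum.swap, intro sum.cong refl, subst sum.swap) (simp add: sum_distrib_left)
    moreover have "(\<Sum>\<eta>\<in>?E. \<Sum>x\<in>?S. \<Sum>\<^sub>\<infinity>y\<in>- ?S. s_rate \<alpha> (x - y) * (f (flip x \<eta>) - f \<eta>))
      = (\<Sum>x\<in>?S. (\<Sum>\<^sub>\<infinity>y\<in>- ?S. s_rate \<alpha> (x - y)) * (\<Sum>\<eta>\<in>?E. f (flip x \<eta>) - f \<eta>))"
      unfolding infsum_cmult_left' by (subst sum.swap) (simp add: sum_distrib_left)
    ultimately show ?thesis
      unfolding gen_sym_def sum.distrib sum_distrib_left[symmetric] by (simp add: sym1 sym2)
  qed
  \<comment> \<open>After exchanging x and y the weight is \<eta> y (1 - \<eta> x) - \<eta> x (1 -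
    \<eta> y) = \<eta> y - \<eta> x.\<close>
  have asym1: "(\<Sum>\<eta>\<in>?E. \<eta> x * (1 - \<eta> y) * (f (swap x y \<eta>) - f \<eta>)) = (\<Sum>\<eta>\<in>?E. f \<eta> * (\<eta> y - \<eta> x))"
    if "x \<in> ?S" "y \<in> ?S" for x y
  proof -
    have "(\<Sum>\<eta>\<in>?E. \<eta> x * (1 - \<eta> y) * f (swap x y \<eta>)) = (\<Sum>\<eta>\<in>?E. (swap x y \<eta>) x * (1 - (swap x y \<eta>) y) * f \<eta>)"
      using sum_swap[OF that, of "\<lambda>\<eta>. \<eta> x * (1 - \<eta> y) * f (swap x y \<eta>)"] by simp
    also have "\<dots> = (\<Sum>\<eta>\<in>?E. \<eta> y * (1 - \<eta> x) * f \<eta>)"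
      by (intro sum.cong) (auto simp: swap_def)
    finally show ?thesis by (simp add: algebra_simps sum_subtractf sum.distrib)
  qed
  have asym2: "(\<Sum>\<eta>\<in>?E. (1 - \<eta> x) * (f (flip x \<eta>) - f \<eta>)) = (\<Sum>\<eta>\<in>?E. f \<eta> * (2 * \<eta> x - 1))"
    and asym3: "(\<Sum>\<eta>\<in>?E. \<eta> x * (f (flip x \<eta>) - f \<eta>)) = - (\<Sum>\<eta>\<in>?E. f \<eta> * (2 * \<eta> x - 1))"
    if "x \<in> ?S" for x
  proof -
    have fl: "flip x \<eta> x = 1 - \<eta> x" for \<eta> by (simp add: flip_def)
    have "(\<Sum>\<eta>\<in>?E. \<eta> x * f (flip x \<eta>)) = (\<Sum>\<eta>\<in>?E. (1 - \<eta> x) * f \<eta>)"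
      using sum_flip[OF that, of "\<lambda>\<eta>. (1 - \<eta> x) * f \<eta>"] by (simp add: fl)
    moreover have "(\<Sum>\<eta>\<in>?E. f (flip x \<eta>)) = (\<Sum>\<eta>\<in>?E. f \<eta>)"
      using sum_flip[OF that, of f] .
    moreover have "(\<Sum>\<eta>\<in>?E. f \<eta> * (2 * \<eta> x - 1)) = 2 * (\<Sum>\<eta>\<in>?E. \<eta> x * f \<eta>) - (\<Sum>\<eta>\<in>?E. f \<eta>)"
      by (simp add: sum_distrib_left sum_subtractf algebra_simps)
    ultimately show "(\<Sum>\<eta>\<in>?E. (1 - \<eta> x) * (f (flip x \<eta>) - f \<eta>)) = (\<Sum>\<eta>\<in>?E. f \<eta> * (2 * \<eta> x - 1))"
      "(\<Sum>\<eta>\<in>?E. \<eta> x * (f (flip x \<eta>) - f \<eta>)) = - (\<Sum>\<eta>\<in>?E. f \<eta> * (2 * \<eta> x - 1))"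
      by (simp_all only: right_diff_distrib left_diff_distrib mult_1 sum_subtractf)
  qed
  \<comment> \<open>Total in-rate equals total out-rate, so the imbalance inside the lattice is the
    difference of the reservoir rates.\<close>
  have bal: "(\<Sum>x\<in>?S. p_rate \<gamma> (z - x)) - (\<Sum>y\<in>?S. p_rate \<gamma> (y - z)) = r z - l z" if "z \<in> ?S" for z
    using p_rate_in_total[OF assms that] p_rate_out_total[OF assms that] unfolding l_def r_def by linarith
  have tot: "(\<Sum>z\<in>?S. r z - l z) = 0"
  proof -
    have "(\<Sum>z\<in>?S. r z - l z) = (\<Sum>z\<in>?S. \<Sum>x\<in>?S. p_rate \<gamma> (z - x)) - (\<Sum>z\<in>?S. \<Sum>y\<in>?S. p_rate \<gamma> (y - z))"
      using bal by (simp add: sum_subtractf[symmetric])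
    also have "(\<Sum>z\<in>?S. \<Sum>y\<in>?S. p_rate \<gamma> (y - z)) = (\<Sum>z\<in>?S. \<Sum>x\<in>?S. p_rate \<gamma> (z - x))"
      by (rule sum.swap)
    finally show ?thesis by simp
  qed
  have bulk: "(\<Sum>x\<in>?S. \<Sum>y\<in>?S. p_rate \<gamma> (y - x) * (\<eta> y - \<eta> x)) = (\<Sum>z\<in>?S. (r z - l z) * \<eta> z)" for \<eta> :: config
  proof -
    have "(\<Sum>x\<in>?S. \<Sum>y\<in>?S. p_rate \<gamma> (y - x) * (\<eta> y - \<eta> x))
      = (\<Sum>x\<in>?S. \<Sum>y\<in>?S. p_rate \<gamma> (y - x) * \<eta> y) - (\<Sum>x\<in>?S. \<Sum>y\<in>?S. p_rate \<gamma> (y - x) * \<eta> x)"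
      by (simp add: right_diff_distrib sum_subtractf)
    also have "(\<Sum>x\<in>?S. \<Sum>y\<in>?S. p_rate \<gamma> (y - x) * \<eta> y) = (\<Sum>z\<in>?S. \<Sum>x\<in>?S. p_rate \<gamma> (z - x) * \<eta> z)"
      by (rule sum.swap)
    also have "\<dots> - (\<Sum>x\<in>?S. \<Sum>y\<in>?S. p_rate \<gamma> (y - x) * \<eta> x) = (\<Sum>z\<in>?S. (r z - l z) * \<eta> z)"
    proof -
      have "(\<Sum>z\<in>?S. \<Sum>x\<in>?S. p_rate \<gamma> (z - x) * \<eta> z) - (\<Sum>x\<in>?S. \<Sum>y\<in>?S. p_rate \<gamma> (y - x) * \<eta> x)
        = (\<Sum>z\<in>?S. ((\<Sum>x\<in>?S. p_rate \<gamma> (z - x)) - (\<Sum>y\<in>?S. p_rate \<gamma> (y - z))) * \<eta> z)"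
        unfolding left_diff_distrib sum_subtractf[of _ _ ?S] by (simp only: sum_distrib_right)
      also have "\<dots> = (\<Sum>z\<in>?S. (r z - l z) * \<eta> z)"
        by (intro sum.cong) (simp_all only: bal)
      finally show ?thesis .
    qed
    finally show ?thesis .
  qed
  have "(\<Sum>\<eta>\<in>?E. gen_asym \<gamma> n f \<eta>) = (\<Sum>x\<in>?S. \<Sum>y\<in>?S. p_rate \<gamma> (y - x) * (\<Sum>\<eta>\<in>?E. \<eta> x * (1 - \<eta> y) * (f (swap x y \<eta>) - f \<eta>)))
    + 1/2 * (\<Sum>x\<in>?S. l x * (\<Sum>\<eta>\<in>?E. (1 - \<eta> x) * (f (flip x \<eta>) - f \<eta>)))
    + 1/2 * (\<Sum>x\<in>?S. r x * (\<Sum>\<eta>\<in>?E. \<eta> x * (f (flip x \<eta>) - f \<eta>)))"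
  proof -
    have "(\<Sum>\<eta>\<in>?E. \<Sum>x\<in>?S. \<Sum>y\<in>?S. p_rate \<gamma> (y - x) * \<eta> x * (1 - \<eta> y) * (f (swap x y \<eta>) - f \<eta>))
      = (\<Sum>x\<in>?S. \<Sum>y\<in>?S. p_rate \<gamma> (y - x) * (\<Sum>\<eta>\<in>?E. \<eta> x * (1 - \<eta> y) * (f (swap x y \<eta>) - f \<eta>)))"
      by (subst sum.swap, intro sum.cong refl, subst sum.swap) (simp add: sum_distrib_left mult.assoc)
    moreover have "(\<Sum>\<eta>\<in>?E. \<Sum>x\<in>?S. l x * (1 - \<eta> x) * (f (flip x \<eta>) - f \<eta>))
      = (\<Sum>x\<in>?S. l x * (\<Sum>\<eta>\<in>?E. (1 - \<eta> x) * (f (flip x \<eta>) - f \<eta>)))"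
      by (subst sum.swap) (simp add: sum_distrib_left mult.assoc)
    moreover have "(\<Sum>\<eta>\<in>?E. \<Sum>x\<in>?S. r x * \<eta> x * (f (flip x \<eta>) - f \<eta>))
      = (\<Sum>x\<in>?S. r x * (\<Sum>\<eta>\<in>?E. \<eta> x * (f (flip x \<eta>) - f \<eta>)))"
      by (subst sum.swap) (simp add: sum_distrib_left mult.assoc)
    ultimately show ?thesis
      unfolding gen_asym_def infsum_cmult_left' l_def[symmetric] r_def[symmetric] sum.distrib sum_distrib_left[symmetric]
      by simp
  qed
  also have "\<dots> = (\<Sum>x\<in>?S. \<Sum>y\<in>?S. p_rate \<gamma> (y - x) * (\<Sum>\<eta>\<in>?E. f \<eta> * (\<eta> y - \<eta> x)))
    - 1/2 * (\<Sum>x\<in>?S. (r x - l x) * (\<Sum>\<eta>\<in>?E. f \<eta> * (2 * \<eta> x - 1)))"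
  proof -
    let ?B = "\<lambda>x. \<Sum>\<eta>\<in>?E. f \<eta> * (2 * \<eta> x - 1)"
    have "(\<Sum>x\<in>?S. \<Sum>y\<in>?S. p_rate \<gamma> (y - x) * (\<Sum>\<eta>\<in>?E. \<eta> x * (1 - \<eta> y) * (f (swap x y \<eta>) - f \<eta>)))
      = (\<Sum>x\<in>?S. \<Sum>y\<in>?S. p_rate \<gamma> (y - x) * (\<Sum>\<eta>\<in>?E. f \<eta> * (\<eta> y - \<eta> x)))"
      by (intro sum.cong refl) (simp only: asym1)
    moreover have "(\<Sum>x\<in>?S. l x * (\<Sum>\<eta>\<in>?E. (1 - \<eta> x) * (f (flip x \<eta>) - f \<eta>))) = (\<Sum>x\<in>?S. l x * ?B x)"
      by (intro sum.cong refl) (simp only: asym2)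
    moreover have "(\<Sum>x\<in>?S. r x * (\<Sum>\<eta>\<in>?E. \<eta> x * (f (flip x \<eta>) - f \<eta>))) = - (\<Sum>x\<in>?S. r x * ?B x)"
      unfolding sum_negf[symmetric] by (intro sum.cong refl) (simp only: asym3 mult_minus_right)
    moreover have "(\<Sum>x\<in>?S. (r x - l x) * ?B x) = (\<Sum>x\<in>?S. r x * ?B x) - (\<Sum>x\<in>?S. l x * ?B x)"
      by (simp only: left_diff_distrib sum_subtractf)
    ultimately show ?thesis by linarith
  qed
  also have "(\<Sum>x\<in>?S. \<Sum>y\<in>?S. p_rate \<gamma> (y - x) * (\<Sum>\<eta>\<in>?E. f \<eta> * (\<eta> y - \<eta> x)))
    = (\<Sum>\<eta>\<in>?E. f \<eta> * (\<Sum>x\<in>?S. \<Sum>y\<in>?S. p_rate \<gamma> (y - x) * (\<eta> y - \<eta> x)))"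
  proof -
    have "(\<Sum>\<eta>\<in>?E. f \<eta> * (\<Sum>x\<in>?S. \<Sum>y\<in>?S. p_rate \<gamma> (y - x) * (\<eta> y - \<eta> x)))
      = (\<Sum>\<eta>\<in>?E. \<Sum>x\<in>?S. \<Sum>y\<in>?S. p_rate \<gamma> (y - x) * (f \<eta> * (\<eta> y - \<eta> x)))"
      by (simp add: sum_distrib_left mult.left_commute)
    also have "\<dots> = (\<Sum>x\<in>?S. \<Sum>y\<in>?S. p_rate \<gamma> (y - x) * (\<Sum>\<eta>\<in>?E. f \<eta> * (\<eta> y - \<eta> x)))"
      by (subst sum.swap, intro sum.cong refl, subst sum.swap) (simp add: sum_distrib_left)
    finally show ?thesis by simp
  qed
  also have "(\<Sum>x\<in>?S. (r x - l x) * (\<Sum>\<eta>\<in>?E. f \<eta> * (2 * \<eta> x - 1))) = (\<Sum>\<eta>\<in>?E. f \<eta> * (\<Sum>x\<in>?S. (r x - l x) * (2 * \<eta> x - 1)))"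
  proof -
    have "(\<Sum>x\<in>?S. (r x - l x) * (\<Sum>\<eta>\<in>?E. f \<eta> * (2 * \<eta> x - 1))) = (\<Sum>x\<in>?S. \<Sum>\<eta>\<in>?E. f \<eta> * ((r x - l x) * (2 * \<eta> x - 1)))"
      by (simp only: sum_distrib_left mult.left_commute)
    also have "\<dots> = (\<Sum>\<eta>\<in>?E. f \<eta> * (\<Sum>x\<in>?S. (r x - l x) * (2 * \<eta> x - 1)))"
      by (subst sum.swap) (simp only: sum_distrib_left)
    finally show ?thesis .
  qed
  \<comment> \<open>The bulk cancels the linear part of the reservoir terms, and their constant part
    vanishes because the total imbalance \<open>tot\<close> is zero.\<close>
  also have "(\<Sum>\<eta>\<in>?E. f \<eta> * (\<Sum>x\<in>?S. \<Sum>y\<in>?S. p_rate \<gamma> (y - x) * (\<eta> y - \<eta> x)))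
      - 1/2 * (\<Sum>\<eta>\<in>?E. f \<eta> * (\<Sum>x\<in>?S. (r x - l x) * (2 * \<eta> x - 1))) = 0"
  proof -
    have "(\<Sum>x\<in>?S. (r x - l x) * (2 * \<eta> x - 1)) = 2 * (\<Sum>z\<in>?S. (r z - l z) * \<eta> z)" for \<eta> :: config
    proof -
      have "(\<Sum>x\<in>?S. (r x - l x) * (2 * \<eta> x - 1)) = (\<Sum>x\<in>?S. 2 * ((r x - l x) * \<eta> x) - (r x - l x))"
        by (intro sum.cong) (auto simp: algebra_simps)
      then show ?thesis using tot by (simp only: sum_subtractf[of "\<lambda>x. 2 * ((r x - l x) * \<eta> x)"] sum_distrib_left[symmetric])
    qed
    then show ?thesis by (simp add: bulk sum_distrib_left mult.left_commute)
  qed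
  finally have "(\<Sum>\<eta>\<in>?E. gen_asym \<gamma> n f \<eta>) = 0" .
  with sym show ?thesis
    unfolding generator_def sum.distrib sum_distrib_left[symmetric] by simp
qed

lemma generator_jump_generator:
  assumes "0 < \<gamma>"
  shows "jump_generator (configs n) (moves n) (move_rate \<alpha> \<gamma> \<theta> n) move (generator \<alpha> \<gamma> \<theta> n)"
proof
  show "finite (moves n)" by (simp add: moves_def)
  show "move k \<eta> \<in> configs n" if "k \<in> moves n" "\<eta> \<in> configs n" for k \<eta>
    using that by (cases k) (auto simp: moves_def swap_in_configs flip_in_configs)
  show "0 \<le> move_rate \<alpha> \<gamma> \<theta> n k \<eta>" if "k \<in> moves n" "\<eta> \<in> configs n" for k \<eta>
  proof (cases k)
    case (Inl xy)
    then obtain x y where k: "k = Inl (x, y)" by (cases xy) auto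
    have "x \<in> Sites n" "y \<in> Sites n" using that k by (auto simp: moves_def)
    then have "0 \<le> \<eta> x" "0 \<le> 1 - \<eta> y" using config_cases[OF that(2)] by fastforce+
    then show ?thesis
      by (auto simp: k intro!: add_nonneg_nonneg mult_nonneg_nonneg s_rate_nonneg p_rate_nonneg)
  next
    case (Inr x)
    then have "x \<in> Sites n" using that by (auto simp: moves_def)
    then have "0 \<le> \<eta> x" "0 \<le> 1 - \<eta> x" using config_cases[OF that(2)] by fastforce+
    then show ?thesis
      by (auto simp: Inr intro!: add_nonneg_nonneg mult_nonneg_nonneg infsum_nonneg s_rate_nonneg p_rate_nonneg)
  qed
qed (use configs_nonempty generator_eq_moves generator_invariant[OF assms] in auto)

section \<open>Comparison with nearest-neighbour exchanges\<close>

definition bonds :: "nat \<Rightarrow> int set" where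
  "bonds n = {1..int n - 2}"

lemma bond_sites: "x \<in> bonds n \<Longrightarrow> x \<in> Sites n \<and> x + 1 \<in> Sites n"
  by (auto simp: bonds_def Sites_def)

lemma finite_bonds [simp]: "finite (bonds n)"
  by (simp add: bonds_def)

text \<open>All moves have nonnegative rates, so only nearest-neighbour exchanges are kept, with
  just their symmetric rate: \<open>s_rate\<close> at distance one is 1 for every \<alpha>.\<close>

lemma dirichlet_lower_bound:
  assumes "0 < \<gamma>"
  shows "real n ^ 2 * (\<Sum>x\<in>bonds n. avg (configs n) (\<lambda>\<eta>. (g (swap x (x + 1) \<eta>) - g \<eta>)\<^sup>2))
     \<le> jump_generator.dirichlet (configs n) (generator \<alpha> \<gamma> \<theta> n) g"
proof -
  interpret J: jump_generator "configs n" "moves n" "move_rate \<alpha> \<gamma> \<theta> n" move "generator \<alpha> \<gamma> \<theta> n"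
    by (rule generator_jump_generator[OF assms])
  have "real n ^ 2 * (\<Sum>x\<in>bonds n. (g (swap x (x + 1) \<eta>) - g \<eta>)\<^sup>2)
      \<le> 1/2 * (\<Sum>k\<in>moves n. move_rate \<alpha> \<gamma> \<theta> n k \<eta> * (g (move k \<eta>) - g \<eta>)\<^sup>2)" if \<eta>: "\<eta> \<in> configs n" for \<eta>
  proof -
    let ?t = "\<lambda>k. move_rate \<alpha> \<gamma> \<theta> n k \<eta> * (g (move k \<eta>) - g \<eta>)\<^sup>2"
    let ?q = "\<lambda>x. real n ^ 2 * (g (swap x (x + 1) \<eta>) - g \<eta>)\<^sup>2"
    have nn: "real n ^ 2 \<le> move_rate \<alpha> \<gamma> \<theta> n (Inl (x, y)) \<eta>" if "x \<in> Sites n" "y \<in> Sites n" "\<bar>x - y\<bar> = 1" for x y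
    proof -
      have "s_rate \<alpha> (x - y) = 1" using that(3) by (auto simp: s_rate_def)
      moreover have "0 \<le> \<eta> x" "0 \<le> 1 - \<eta> y" using config_cases[OF \<eta>] that by fastforce+
      ultimately show ?thesis by (auto intro!: mult_nonneg_nonneg p_rate_nonneg)
    qed
    have A: "?q x \<le> ?t (Inl (x, x + 1))" "?q x \<le> ?t (Inl (x + 1, x))" if "x \<in> bonds n" for x
      using nn[of x "x + 1"] nn[of "x + 1" x] bond_sites[OF that]
      by (auto intro!: mult_right_mono simp: swap_commute[of "x + 1" x] simp del: move_rate.simps)
    let ?A = "(\<lambda>x. Inl (x, x + 1)) ` bonds n" and ?B = "(\<lambda>x. Inl (x + 1, x)) ` bonds n"
    \<comment> \<open>Each bond appears in both orders, whence the 2 that offsets the 1/2 of the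
      Dirichlet form.\<close>
    have "2 * (\<Sum>x\<in>bonds n. ?q x) \<le> (\<Sum>x\<in>bonds n. ?t (Inl (x, x + 1))) + (\<Sum>x\<in>bonds n. ?t (Inl (x + 1, x)))"
      using sum_mono[of "bonds n" ?q "\<lambda>x. ?t (Inl (x, x + 1))", OF A(1)]
        sum_mono[of "bonds n" ?q "\<lambda>x. ?t (Inl (x + 1, x))", OF A(2)] by linarith
    also have "\<dots> = sum ?t ?A + sum ?t ?B"
      by (subst (1 2) sum.reindex) (auto simp: inj_on_def)
    also have "\<dots> = sum ?t (?A \<union> ?B)"
      by (rule sum.union_disjoint[symmetric]) auto
    also have "\<dots> \<le> sum ?t (moves n)"
      using J.rate_nonneg[OF _ \<eta>] J.finite_K bond_sites
      by (intro sum_mono2) (auto simp: moves_def simp del: move_rate.simps intro!: mult_nonneg_nonneg)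
    finally show ?thesis unfolding sum_distrib_left[of "real n ^ 2" _ "bonds n"] by linarith
  qed
  then have "avg (configs n) (\<lambda>\<eta>. real n ^ 2 * (\<Sum>x\<in>bonds n. (g (swap x (x + 1) \<eta>) - g \<eta>)\<^sup>2)) \<le> J.dirichlet g"
    unfolding J.dirichlet_eq avg_cmult[symmetric] by (intro avg_mono) (simp add: avg_cmult)
  then show ?thesis by (simp only: avg_cmult avg_sum)
qed

section \<open>Flows along bonds\<close>

lemma swap_apply: "swap x y \<eta> z = (if z = y then \<eta> x else if z = x then \<eta> y else \<eta> z)"
  by (simp add: swap_def)

lemma centred_sq: "\<eta> \<in> configs n \<Longrightarrow> x \<in> Sites n \<Longrightarrow> (centred \<eta> x)\<^sup>2 = 1/4"
  using config_cases[of \<eta> n x] by (auto simp: centred_def power2_eq_square)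

lemma avg_odd:
  assumes "a \<in> Sites n" "\<And>\<eta>. \<eta> \<in> configs n \<Longrightarrow> f (flip a \<eta>) = - f \<eta>"
  shows "avg (configs n) f = 0"
proof -
  have "(\<Sum>\<eta>\<in>configs n. f \<eta>) = (\<Sum>\<eta>\<in>configs n. - f \<eta>)"
    using sum_flip[OF assms(1), of f] assms(2) by simp
  then show ?thesis by (simp add: avg_def sum_negf)
qed

lemma prod_centred_flip:
  assumes "finite A"
  shows "(\<Prod>x\<in>A. centred (flip a \<eta>) x) = (if a \<in> A then - 1 else 1) * (\<Prod>x\<in>A. centred \<eta> x)"
proof (cases "a \<in> A")
  case True
  have "(\<Prod>x\<in>A - {a}. centred (flip a \<eta>) x) = (\<Prod>x\<in>A - {a}. centred \<eta> x)"
    by (intro prod.cong) (auto simp: centred_def flip_def)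
  then show ?thesis using True
    by (subst (1 2) prod.remove[OF assms True]) (simp add: centred_def flip_def left_diff_distrib)
next
  case False
  then show ?thesis by (auto simp: centred_def flip_def intro!: prod.cong)
qed

lemma avg_const: "avg (configs n) (\<lambda>_. c) = c"
  using configs_nonempty[of n] by (simp add: avg_def)

text \<open>Products of centred occupations over distinct sets are orthogonal (Walsh functions):
  flipping a site that lies in only one of two sets changes the sign of their product. Each centred
  occupation squares to 1/4.\<close>

lemma avg_sq_multilinear:
  assumes I: "finite I" "inj_on A I" and A: "\<And>i. i \<in> I \<Longrightarrow> A i \<subseteq> Sites n"
  shows "avg (configs n) (\<lambda>\<eta>. (\<Sum>i\<in>I. c i * (\<Prod>x\<in>A i. centred \<eta> x))\<^sup>2) = (\<Sum>i\<in>I. (c i)\<^sup>2 * (1/4) ^ card (A i))"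
proof -
  let ?u = "\<lambda>i \<eta>. \<Prod>x\<in>A i. centred \<eta> x"
  have fin: "finite (A i)" if "i \<in> I" for i by (rule finite_subset[OF A[OF that] finite_Sites])
  have off: "avg (configs n) (\<lambda>\<eta>. ?u i \<eta> * ?u j \<eta>) = 0" if "i \<in> I" "j \<in> I" "i \<noteq> j" for i j
  proof -
    have "A i \<noteq> A j" using that I(2) by (auto dest: inj_onD)
    then obtain a where a: "a \<in> A i \<and> a \<notin> A j \<or> a \<in> A j \<and> a \<notin> A i" by blast
    then have "a \<in> Sites n" using A that by blast
    then show ?thesis
      by (rule avg_odd) (use a fin that in \<open>auto simp: prod_centred_flip\<close>)
  qed
  have diag: "avg (configs n) (\<lambda>\<eta>. ?u i \<eta> * ?u i \<eta>) = (1/4) ^ card (A i)" if "i \<in> I" for i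
  proof -
    have "?u i \<eta> * ?u i \<eta> = (1/4) ^ card (A i)" if "\<eta> \<in> configs n" for \<eta>
    proof -
      have "?u i \<eta> * ?u i \<eta> = (\<Prod>x\<in>A i. (centred \<eta> x)\<^sup>2)"
        by (simp add: prod.distrib[symmetric] power2_eq_square)
      also have "\<dots> = (\<Prod>x\<in>A i. 1/4)"
        using A[OF \<open>i \<in> I\<close>] by (intro prod.cong centred_sq[OF that]) auto
      finally show ?thesis by simp
    qed
    then have "avg (configs n) (\<lambda>\<eta>. ?u i \<eta> * ?u i \<eta>) = avg (configs n) (\<lambda>_. (1/4) ^ card (A i))"
      by (rule avg_cong)
    then show ?thesis by (simp only: avg_const)
  qed
  have "avg (configs n) (\<lambda>\<eta>. (\<Sum>i\<in>I. c i * ?u i \<eta>)\<^sup>2)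
      = avg (configs n) (\<lambda>\<eta>. \<Sum>i\<in>I. \<Sum>j\<in>I. (c i * c j) * (?u i \<eta> * ?u j \<eta>))"
    by (simp add: power2_eq_square sum_product mult_ac)
  also have "\<dots> = (\<Sum>i\<in>I. \<Sum>j\<in>I. (c i * c j) * avg (configs n) (\<lambda>\<eta>. ?u i \<eta> * ?u j \<eta>))"
    by (simp only: avg_sum avg_cmult)
  also have "\<dots> = (\<Sum>i\<in>I. \<Sum>j\<in>I. if i = j then (c i)\<^sup>2 * (1/4) ^ card (A i) else 0)"
    using off diag by (intro sum.cong) (auto simp: power2_eq_square)
  also have "\<dots> = (\<Sum>i\<in>I. (c i)\<^sup>2 * (1/4) ^ card (A i))"
    using I(1) by simp
  finally show ?thesis .
qed

text \<open>\<open>F\<close> splits into a part with second moment at most \<open>A\<close> and a part of finite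
  \<open>H\<^sub>-\<^sub>1\<close> norm, controlled by \<open>B / n\<^sup>2\<close>: since \<open>Z b\<close> does not see the exchange
  across the bond \<open>b\<close>, the latter can be integrated by parts bond by bond.\<close>

definition decomp :: "nat \<Rightarrow> (config \<Rightarrow> real) \<Rightarrow> real \<Rightarrow> real \<Rightarrow> bool" where
  "decomp n F A B \<longleftrightarrow> (\<exists>F1 Z.
     (\<forall>\<eta>\<in>configs n. F \<eta> = F1 \<eta> + (\<Sum>b\<in>bonds n. Z b \<eta> * (centred \<eta> b - centred \<eta> (b + 1)))) \<and>
     (\<forall>b\<in>bonds n. \<forall>\<eta>\<in>configs n. Z b (swap b (b + 1) \<eta>) = Z b \<eta>) \<and>
     avg (configs n) (\<lambda>\<eta>. (F1 \<eta>)\<^sup>2) \<le> A \<and> (\<Sum>b\<in>bonds n. avg (configs n) (\<lambda>\<eta>. (Z b \<eta>)\<^sup>2)) \<le> B)"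

lemma sq_add_le: "(a + b)\<^sup>2 \<le> 2 * a\<^sup>2 + 2 * (b::real)\<^sup>2"
  using zero_le_power2[of "a - b"] by (simp add: power2_eq_square algebra_simps)

lemma decomp_add:
  assumes "decomp n F A B" "decomp n F' A' B'"
  shows "decomp n (\<lambda>\<eta>. F \<eta> + F' \<eta>) (2 * A + 2 * A') (2 * B + 2 * B')"
proof -
  let ?a = "avg (configs n)"
  obtain F1 Z where 1: "\<forall>\<eta>\<in>configs n. F \<eta> = F1 \<eta> + (\<Sum>b\<in>bonds n. Z b \<eta> * (centred \<eta> b - centred \<eta> (b + 1)))"
     "\<forall>b\<in>bonds n. \<forall>\<eta>\<in>configs n. Z b (swap b (b + 1) \<eta>) = Z b \<eta>"
     "?a (\<lambda>\<eta>. (F1 \<eta>)\<^sup>2) \<le> A" "(\<Sum>b\<in>bonds n. ?a (\<lambda>\<eta>. (Z b \<eta>)\<^sup>2)) \<le> B"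
    using assms(1) unfolding decomp_def by blast
  obtain F1' Z' where 2: "\<forall>\<eta>\<in>configs n. F' \<eta> = F1' \<eta> + (\<Sum>b\<in>bonds n. Z' b \<eta> * (centred \<eta> b - centred \<eta> (b + 1)))"
     "\<forall>b\<in>bonds n. \<forall>\<eta>\<in>configs n. Z' b (swap b (b + 1) \<eta>) = Z' b \<eta>"
     "?a (\<lambda>\<eta>. (F1' \<eta>)\<^sup>2) \<le> A'" "(\<Sum>b\<in>bonds n. ?a (\<lambda>\<eta>. (Z' b \<eta>)\<^sup>2)) \<le> B'"
    using assms(2) unfolding decomp_def by blast
  have add: "?a (\<lambda>\<eta>. (f \<eta> + g \<eta>)\<^sup>2) \<le> 2 * ?a (\<lambda>\<eta>. (f \<eta>)\<^sup>2) + 2 * ?a (\<lambda>\<eta>. (g \<eta>)\<^sup>2)" for f g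
    unfolding avg_cmult[symmetric] avg_add[symmetric] by (intro avg_mono sq_add_le)
  have "(\<Sum>b\<in>bonds n. ?a (\<lambda>\<eta>. (Z b \<eta> + Z' b \<eta>)\<^sup>2)) \<le> (\<Sum>b\<in>bonds n. 2 * ?a (\<lambda>\<eta>. (Z b \<eta>)\<^sup>2) + 2 * ?a (\<lambda>\<eta>. (Z' b \<eta>)\<^sup>2))"
    by (intro sum_mono add)
  also have "\<dots> \<le> 2 * B + 2 * B'" using 1(4) 2(4) by (simp add: sum.distrib sum_distrib_left[symmetric])
  finally have B: "(\<Sum>b\<in>bonds n. ?a (\<lambda>\<eta>. (Z b \<eta> + Z' b \<eta>)\<^sup>2)) \<le> 2 * B + 2 * B'" .
  have A: "?a (\<lambda>\<eta>. (F1 \<eta> + F1' \<eta>)\<^sup>2) \<le> 2 * A + 2 * A'" using add[of F1 F1'] 1(3) 2(3) by linarith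
  show ?thesis unfolding decomp_def
    by (rule exI[of _ "\<lambda>\<eta>. F1 \<eta> + F1' \<eta>"], rule exI[of _ "\<lambda>b \<eta>. Z b \<eta> + Z' b \<eta>"])
      (use 1 2 A B in \<open>simp add: distrib_right sum.distrib\<close>)
qed

lemma decomp_cong:
  assumes "decomp n F A B" "\<And>\<eta>. \<eta> \<in> configs n \<Longrightarrow> F' \<eta> = F \<eta>" "A \<le> A'" "B \<le> B'"
  shows "decomp n F' A' B'"
proof -
  obtain F1 Z where *: "\<forall>\<eta>\<in>configs n. F \<eta> = F1 \<eta> + (\<Sum>b\<in>bonds n. Z b \<eta> * (centred \<eta> b - centred \<eta> (b + 1)))"
     "\<forall>b\<in>bonds n. \<forall>\<eta>\<in>configs n. Z b (swap b (b + 1) \<eta>) = Z b \<eta>"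
     "avg (configs n) (\<lambda>\<eta>. (F1 \<eta>)\<^sup>2) \<le> A" "(\<Sum>b\<in>bonds n. avg (configs n) (\<lambda>\<eta>. (Z b \<eta>)\<^sup>2)) \<le> B"
    using assms(1) unfolding decomp_def by blast
  show ?thesis unfolding decomp_def
    by (rule exI[of _ F1], rule exI[of _ Z])
      (intro conjI ballI order.trans[OF *(3) assms(3)] order.trans[OF *(4) assms(4)]; simp add: *(1,2) assms(2))
qed

lemma decomp_L2:
  assumes "avg (configs n) (\<lambda>\<eta>. (F \<eta>)\<^sup>2) \<le> A" shows "decomp n F A 0"
  unfolding decomp_def
  by (rule exI[of _ F], rule exI[of _ "\<lambda>_ _. 0"]) (use assms in \<open>simp add: avg_const\<close>)

text \<open>The exchange across b preserves the uniform law and \<open>Z b\<close> and changes the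
  sign of the occupation difference, so the mean against \<open>g\<close> is half the mean against
  the increment of \<open>g\<close> across b. Cauchy-Schwarz and the Dirichlet comparison give the
  static constant \<open>B / (4 * n^2)\<close>; 100 / 4 is the 25 of the statement.\<close>

lemma decomp_sup_sq_integral:
  assumes proc: "markov_process M X (configs n) (nu_half n) (generator \<alpha> \<gamma> \<theta> n)" and \<gamma>: "0 < \<gamma>"
    and n: "0 < n" and T: "0 < T" and dec: "decomp n F A B"
  shows "sup_sq_integral M T (\<lambda>s \<omega>. F (X s \<omega>)) \<le> ennreal (5 * T\<^sup>2 * A + 25 * T * (B / real n ^ 2))"
proof -
  interpret J: jump_generator "configs n" "moves n" "move_rate \<alpha> \<gamma> \<theta> n" move "generator \<alpha> \<gamma> \<theta> n"
    by (rule generator_jump_generator[OF \<gamma>])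
  let ?E = "configs n" and ?a = "avg (configs n)"
  obtain F1 Z where F: "\<forall>\<eta>\<in>?E. F \<eta> = F1 \<eta> + (\<Sum>b\<in>bonds n. Z b \<eta> * (centred \<eta> b - centred \<eta> (b + 1)))"
    and Z: "\<forall>b\<in>bonds n. \<forall>\<eta>\<in>configs n. Z b (swap b (b + 1) \<eta>) = Z b \<eta>"
    and A: "?a (\<lambda>\<eta>. (F1 \<eta>)\<^sup>2) \<le> A" and B: "(\<Sum>b\<in>bonds n. ?a (\<lambda>\<eta>. (Z b \<eta>)\<^sup>2)) \<le> B"
    using dec unfolding decomp_def by blast
  define D where "D b \<eta> = centred \<eta> b - centred \<eta> (b + 1)" for b \<eta>
  define F2 where "F2 \<eta> = (\<Sum>b\<in>bonds n. Z b \<eta> * D b \<eta>)" for \<eta>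
  have B0: "0 \<le> B" by (rule order.trans[OF _ B]) (intro sum_nonneg avg_nonneg, auto)
  have static: "(?a (\<lambda>\<eta>. F2 \<eta> * g \<eta>))\<^sup>2 \<le> B / (4 * real n ^ 2) * J.dirichlet g" for g
  proof -
    define h where "h b \<eta> = g \<eta> - g (swap b (b + 1) \<eta>)" for b \<eta>
    have one: "?a (\<lambda>\<eta>. Z b \<eta> * D b \<eta> * g \<eta>) = 1/2 * ?a (\<lambda>\<eta>. Z b \<eta> * D b \<eta> * h b \<eta>)" if b: "b \<in> bonds n" for b
    proof -
      have s: "b \<in> Sites n" "b + 1 \<in> Sites n" using bond_sites[OF b] by auto
      have "(\<Sum>\<eta>\<in>?E. Z b \<eta> * D b \<eta> * g (swap b (b + 1) \<eta>)) = (\<Sum>\<eta>\<in>?E. Z b (swap b (b + 1) \<eta>) * D b (swap b (b + 1) \<eta>) * g \<eta>)"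
        using sum_swap[OF s, of "\<lambda>\<eta>. Z b \<eta> * D b \<eta> * g (swap b (b + 1) \<eta>)"] by simp
      also have "\<dots> = (\<Sum>\<eta>\<in>?E. - (Z b \<eta> * D b \<eta> * g \<eta>))"
        using Z b by (intro sum.cong) (auto simp: D_def centred_def swap_apply algebra_simps)
      finally have "?a (\<lambda>\<eta>. Z b \<eta> * D b \<eta> * g (swap b (b + 1) \<eta>)) = - ?a (\<lambda>\<eta>. Z b \<eta> * D b \<eta> * g \<eta>)"
        by (simp add: avg_def sum_negf)
      moreover have "?a (\<lambda>\<eta>. Z b \<eta> * D b \<eta> * h b \<eta>) = ?a (\<lambda>\<eta>. Z b \<eta> * D b \<eta> * g \<eta>) - ?a (\<lambda>\<eta>. Z b \<eta> * D b \<eta> * g (swap b (b + 1) \<eta>))"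
        unfolding avg_diff[symmetric] by (simp add: h_def algebra_simps)
      ultimately show ?thesis by simp
    qed
    have "?a (\<lambda>\<eta>. F2 \<eta> * g \<eta>) = (\<Sum>b\<in>bonds n. ?a (\<lambda>\<eta>. Z b \<eta> * D b \<eta> * g \<eta>))"
      unfolding F2_def avg_sum[symmetric] by (simp add: sum_distrib_right)
    also have "\<dots> = 1/2 * (\<Sum>b\<in>bonds n. ?a (\<lambda>\<eta>. Z b \<eta> * D b \<eta> * h b \<eta>))"
      by (simp add: one sum_distrib_left)
    also have "\<dots> = 1/2 * ((\<Sum>p\<in>bonds n \<times> ?E. (Z (fst p) (snd p) * D (fst p) (snd p)) * h (fst p) (snd p)) / real (card ?E))"
      by (simp add: avg_def sum.cartesian_product' sum_divide_distrib)
    finally have eq: "(?a (\<lambda>\<eta>. F2 \<eta> * g \<eta>))\<^sup>2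
        = 1/4 * ((\<Sum>p\<in>bonds n \<times> ?E. (Z (fst p) (snd p) * D (fst p) (snd p)) * h (fst p) (snd p))\<^sup>2 / (real (card ?E))\<^sup>2)"
      by (simp add: power_mult_distrib power_divide power2_eq_square)
    \<comment> \<open>One application over bonds and configurations jointly, so that all bonds share
      a single Dirichlet form.\<close>
    have "(\<Sum>p\<in>bonds n \<times> ?E. (Z (fst p) (snd p) * D (fst p) (snd p)) * h (fst p) (snd p))\<^sup>2
      \<le> (\<Sum>p\<in>bonds n \<times> ?E. (Z (fst p) (snd p) * D (fst p) (snd p))\<^sup>2) * (\<Sum>p\<in>bonds n \<times> ?E. (h (fst p) (snd p))\<^sup>2)"
      by (rule Cauchy_Schwarz_ineq_sum)
    also have "\<dots> \<le> (\<Sum>p\<in>bonds n \<times> ?E. (Z (fst p) (snd p))\<^sup>2) * (\<Sum>p\<in>bonds n \<times> ?E. (h (fst p) (snd p))\<^sup>2)"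
    proof (intro mult_right_mono sum_mono sum_nonneg)
      fix p assume p: "p \<in> bonds n \<times> ?E"
      have "\<bar>D (fst p) (snd p)\<bar> \<le> 1"
        using p bond_sites[of "fst p" n] config_cases[of "snd p" n "fst p"] config_cases[of "snd p" n "fst p + 1"]
        by (auto simp: D_def centred_def)
      then have "(D (fst p) (snd p))\<^sup>2 \<le> 1" by (simp add: abs_square_le_1)
      then show "(Z (fst p) (snd p) * D (fst p) (snd p))\<^sup>2 \<le> (Z (fst p) (snd p))\<^sup>2"
        by (simp add: power_mult_distrib mult_left_le)
    qed auto
    finally have "(?a (\<lambda>\<eta>. F2 \<eta> * g \<eta>))\<^sup>2
        \<le> 1/4 * ((\<Sum>p\<in>bonds n \<times> ?E. (Z (fst p) (snd p))\<^sup>2) * (\<Sum>p\<in>bonds n \<times> ?E. (h (fst p) (snd p))\<^sup>2) / (real (card ?E))\<^sup>2)"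
      unfolding eq by (intro mult_left_mono divide_right_mono) auto
    also have "\<dots> = 1/4 * ((\<Sum>b\<in>bonds n. ?a (\<lambda>\<eta>. (Z b \<eta>)\<^sup>2)) * (\<Sum>b\<in>bonds n. ?a (\<lambda>\<eta>. (h b \<eta>)\<^sup>2)))"
      by (simp add: avg_def sum.cartesian_product' sum_divide_distrib[symmetric] power2_eq_square)
    also have "\<dots> \<le> 1/4 * (B * (J.dirichlet g / real n ^ 2))"
    proof -
      have "real n ^ 2 * (\<Sum>b\<in>bonds n. ?a (\<lambda>\<eta>. (h b \<eta>)\<^sup>2)) \<le> J.dirichlet g"
        using dirichlet_lower_bound[OF \<gamma>, of n g \<alpha> \<theta>] by (simp add: h_def power2_commute)
      then have "(\<Sum>b\<in>bonds n. ?a (\<lambda>\<eta>. (h b \<eta>)\<^sup>2)) \<le> J.dirichlet g / real n ^ 2"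
        using n by (simp add: field_simps)
      then show ?thesis using B B0
        by (intro mult_left_mono mult_mono) (auto intro!: sum_nonneg avg_nonneg)
    qed
    finally show ?thesis by simp
  qed
  have "sup_sq_integral M T (\<lambda>s \<omega>. F (X s \<omega>)) \<le> ennreal (5 * T\<^sup>2 * ?a (\<lambda>\<eta>. (F1 \<eta>)\<^sup>2) + 100 * T * (B / (4 * real n ^ 2)))"
    by (rule J.sup_sq_integral_bound[OF proc nu_half_uniform T _ _ static]) (use F B0 in \<open>auto simp: F2_def D_def\<close>)
  also have "\<dots> \<le> ennreal (5 * T\<^sup>2 * A + 25 * T * (B / real n ^ 2))"
  proof (intro ennreal_leI add_mono)
    show "5 * T\<^sup>2 * ?a (\<lambda>\<eta>. (F1 \<eta>)\<^sup>2) \<le> 5 * T\<^sup>2 * A" using A by (intro mult_left_mono) auto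
  qed (simp add: mult_ac)
  finally show ?thesis .
qed

text \<open>\<open>bond_of s i x\<close> is the left end of the bond joining \<open>x + s * i\<close> and \<open>x + s * (i + 1)\<close>,
  and \<open>base_of s i\<close> recovers \<open>x\<close> from it.\<close>

definition bond_of :: "int \<Rightarrow> nat \<Rightarrow> int \<Rightarrow> int" where
  "bond_of s i x = (if s = 1 then x + int i else x - int i - 1)"

definition base_of :: "int \<Rightarrow> nat \<Rightarrow> int \<Rightarrow> int" where
  "base_of s i b = (if s = 1 then b - int i else b + 1 + int i)"

lemma base_bond [simp]: "base_of s i (bond_of s i x) = x" and bond_base [simp]: "bond_of s i (base_of s i b) = b"
  by (simp_all add: base_of_def bond_of_def)

text \<open>For fixed \<open>i\<close> a bond determines its row, so terms sorted by row can be
  sorted by the bond they cross.\<close>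

lemma bond_regroup:
  fixes H :: "int \<Rightarrow> nat \<Rightarrow> int \<Rightarrow> real"
  assumes "finite R" and "\<And>x i. x \<in> R \<Longrightarrow> i \<in> I \<Longrightarrow> bond_of s i x \<in> bonds n"
  shows "(\<Sum>b\<in>bonds n. \<Sum>i\<in>I. if base_of s i b \<in> R then H b i (base_of s i b) else 0)
       = (\<Sum>x\<in>R. \<Sum>i\<in>I. H (bond_of s i x) i x)"
proof -
  have "(\<Sum>b\<in>bonds n. if base_of s i b \<in> R then H b i (base_of s i b) else 0) = (\<Sum>x\<in>R. H (bond_of s i x) i x)"
    if "i \<in> I" for i
  proof -
    have "(\<Sum>b\<in>bonds n. if base_of s i b \<in> R then H b i (base_of s i b) else 0)
      = (\<Sum>b\<in>{b\<in>bonds n. base_of s i b \<in> R}. H b i (base_of s i b))"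
      by (subst sum.inter_filter) auto
    also have "\<dots> = (\<Sum>x\<in>R. H (bond_of s i x) i x)"
      by (rule sum.reindex_bij_witness[where i="bond_of s i" and j="base_of s i"]) (use assms that in auto)
    finally show ?thesis .
  qed
  then have "(\<Sum>i\<in>I. \<Sum>b\<in>bonds n. if base_of s i b \<in> R then H b i (base_of s i b) else 0)
      = (\<Sum>i\<in>I. \<Sum>x\<in>R. H (bond_of s i x) i x)"
    by (rule sum.cong[OF refl])
  then show ?thesis by (simp only: sum.swap[of _ I])
qed

text \<open>\<open>z x i\<close> is the current of row \<open>x\<close> across its
  \<open>i\<close>-th bond; the sign \<open>s\<close> translates the row's direction into the fixed
  orientation of bonds. The hypothesis \<open>G\<close> leaves open how the currents of different
  rows through one bond are combined: \<open>decomp_rows\<close> uses orthogonality,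
  \<open>decomp_blocks\<close> Cauchy-Schwarz.\<close>

lemma decomp_moving:
  assumes s: "s = 1 \<or> s = - 1" and R: "finite R" and I: "finite I"
    and bond: "\<And>x i. x \<in> R \<Longrightarrow> i \<in> I \<Longrightarrow> bond_of s i x \<in> bonds n"
    and inv: "\<And>x i \<eta>. x \<in> R \<Longrightarrow> i \<in> I \<Longrightarrow> \<eta> \<in> configs n \<Longrightarrow>
        z x i (swap (bond_of s i x) (bond_of s i x + 1) \<eta>) = z x i \<eta>"
    and G: "\<And>b. b \<in> bonds n \<Longrightarrow>
        avg (configs n) (\<lambda>\<eta>. (\<Sum>i\<in>I. if base_of s i b \<in> R then real_of_int s * z (base_of s i b) i \<eta> else 0)\<^sup>2)
        \<le> (\<Sum>i\<in>I. if base_of s i b \<in> R then G (base_of s i b) i else 0)"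
  shows "decomp n (\<lambda>\<eta>. \<Sum>x\<in>R. \<Sum>i\<in>I. z x i \<eta> * (centred \<eta> (x + s * int i) - centred \<eta> (x + s * (int i + 1))))
     0 (\<Sum>x\<in>R. \<Sum>i\<in>I. G x i)"
proof -
  define Z where "Z b \<eta> = (\<Sum>i\<in>I. if base_of s i b \<in> R then real_of_int s * z (base_of s i b) i \<eta> else 0)" for b \<eta>
  have "(\<Sum>b\<in>bonds n. Z b \<eta> * (centred \<eta> b - centred \<eta> (b + 1)))
      = (\<Sum>x\<in>R. \<Sum>i\<in>I. z x i \<eta> * (centred \<eta> (x + s * int i) - centred \<eta> (x + s * (int i + 1))))" for \<eta>
  proof -
    have "(\<Sum>b\<in>bonds n. Z b \<eta> * (centred \<eta> b - centred \<eta> (b + 1)))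
      = (\<Sum>b\<in>bonds n. \<Sum>i\<in>I. if base_of s i b \<in> R then real_of_int s * z (base_of s i b) i \<eta> * (centred \<eta> b - centred \<eta> (b + 1)) else 0)"
      unfolding Z_def sum_distrib_right by (intro sum.cong) auto
    also have "\<dots> = (\<Sum>x\<in>R. \<Sum>i\<in>I. real_of_int s * z x i \<eta> * (centred \<eta> (bond_of s i x) - centred \<eta> (bond_of s i x + 1)))"
      by (rule bond_regroup[OF R bond, where H="\<lambda>b i x. real_of_int s * z x i \<eta> * (centred \<eta> b - centred \<eta> (b + 1))"])
    also have "\<dots> = (\<Sum>x\<in>R. \<Sum>i\<in>I. z x i \<eta> * (centred \<eta> (x + s * int i) - centred \<eta> (x + s * (int i + 1))))"
      using s by (intro sum.cong) (auto simp: bond_of_def algebra_simps)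
    finally show ?thesis .
  qed
  moreover have "Z b (swap b (b + 1) \<eta>) = Z b \<eta>" if "b \<in> bonds n" "\<eta> \<in> configs n" for b \<eta>
    unfolding Z_def
  proof (rule sum.cong)
    fix i assume "i \<in> I"
    then show "(if base_of s i b \<in> R then real_of_int s * z (base_of s i b) i (swap b (b + 1) \<eta>) else 0)
        = (if base_of s i b \<in> R then real_of_int s * z (base_of s i b) i \<eta> else 0)"
      using inv[of "base_of s i b" i \<eta>] that by simp
  qed simp
  moreover have "(\<Sum>b\<in>bonds n. avg (configs n) (\<lambda>\<eta>. (Z b \<eta>)\<^sup>2)) \<le> (\<Sum>x\<in>R. \<Sum>i\<in>I. G x i)"
  proof -
    have "(\<Sum>b\<in>bonds n. avg (configs n) (\<lambda>\<eta>. (Z b \<eta>)\<^sup>2)) \<le> (\<Sum>b\<in>bonds n. \<Sum>i\<in>I. if base_of s i b \<in> R then G (base_of s i b) i else 0)"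
      unfolding Z_def by (intro sum_mono G)
    also have "\<dots> = (\<Sum>x\<in>R. \<Sum>i\<in>I. G x i)"
      by (rule bond_regroup[OF R bond, where H="\<lambda>b i x. G x i"])
    finally show ?thesis .
  qed
  ultimately show ?thesis
    unfolding decomp_def by (intro exI[of _ "\<lambda>_. 0"] exI[of _ Z]) (auto simp: avg_const)
qed

section \<open>Currents that equalise a row or a block\<close>

lemma abel_sum:
  fixes a f :: "nat \<Rightarrow> real"
  assumes "1 \<le> L"
  shows "(\<Sum>j=1..L. a j * f j) = (\<Sum>j=1..L. a j) * f L + (\<Sum>i\<in>{1..<L}. (\<Sum>j=1..i. a j) * (f i - f (Suc i)))"
  using assms
proof (induction L rule: dec_induct)
  case (step L)
  then show ?case by (simp add: algebra_simps)
qed simp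

text \<open>The partial sums \<open>\<Psi> x\<close> of the deviation from uniformity are the
  currents that spread the row evenly. The uniform row has second moment
  \<open>D^2 / (16 * L)\<close>; the currents are at most twice the absolute row mass, so a row
  costs \<open>L\<close> times its square. \<open>decomp_add\<close> doubles both.\<close>

lemma decomp_rows:
  assumes s: "s = 1 \<or> s = - 1" and R: "finite R" and L: "1 \<le> L"
    and sites: "\<And>x i. x \<in> R \<Longrightarrow> i \<le> L \<Longrightarrow> x + s * int i \<in> Sites n"
  shows "decomp n (\<lambda>\<eta>. \<Sum>x\<in>R. \<Sum>j=1..L. d x j * (centred \<eta> x * centred \<eta> (x + s * int j)))
     (1/8 * (\<Sum>x\<in>R. (\<Sum>j=1..L. d x j)\<^sup>2) / real L) (2 * (real L * (\<Sum>x\<in>R. (\<Sum>j=1..L. \<bar>d x j\<bar>)\<^sup>2)))"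
proof -
  define D where "D x = (\<Sum>j=1..L. d x j)" for x
  define \<Psi> where "\<Psi> x i = (\<Sum>j=1..i. d x j - D x / real L)" for x i
  define W1 where "W1 \<eta> = (\<Sum>p\<in>R \<times> {1..L}. (D (fst p) / real L) * (\<Prod>y\<in>{fst p, fst p + s * int (snd p)}. centred \<eta> y))" for \<eta>
  define W2 where "W2 \<eta> = (\<Sum>x\<in>R. \<Sum>i\<in>{1..<L}. (\<Psi> x i * centred \<eta> x) * (centred \<eta> (x + s * int i) - centred \<eta> (x + s * (int i + 1))))" for \<eta>
  have s0: "s \<noteq> 0" using s by auto
  have split: "(\<Sum>x\<in>R. \<Sum>j=1..L. d x j * (centred \<eta> x * centred \<eta> (x + s * int j))) = W1 \<eta> + W2 \<eta>" for \<eta>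
  proof -
    have "(\<Sum>j=1..L. d x j * (centred \<eta> x * centred \<eta> (x + s * int j)))
      = (\<Sum>j=1..L. D x / real L * (centred \<eta> x * centred \<eta> (x + s * int j)))
       + (\<Sum>i\<in>{1..<L}. (\<Psi> x i * centred \<eta> x) * (centred \<eta> (x + s * int i) - centred \<eta> (x + s * (int i + 1))))" for x
    proof -
      let ?f = "\<lambda>j. centred \<eta> x * centred \<eta> (x + s * int j)"
      have "(\<Sum>j=1..L. (d x j - D x / real L)) = 0" using L by (simp add: sum_subtractf D_def)
      then have "(\<Sum>j=1..L. (d x j - D x / real L) * ?f j) = (\<Sum>i\<in>{1..<L}. \<Psi> x i * (?f i - ?f (Suc i)))"
        using abel_sum[OF L, of "\<lambda>j. d x j - D x / real L" ?f] by (simp add: \<Psi>_def)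
      then have "(\<Sum>j=1..L. d x j * ?f j) = (\<Sum>j=1..L. D x / real L * ?f j) + (\<Sum>i\<in>{1..<L}. \<Psi> x i * (?f i - ?f (Suc i)))"
        by (simp add: left_diff_distrib sum_subtractf)
      then show ?thesis by (simp add: algebra_simps)
    qed
    moreover have "W1 \<eta> = (\<Sum>x\<in>R. \<Sum>j=1..L. D x / real L * (centred \<eta> x * centred \<eta> (x + s * int j)))"
      unfolding W1_def sum.cartesian_product' using s0 by (intro sum.cong) auto
    ultimately show ?thesis by (simp add: W2_def sum.distrib)
  qed
  have "avg (configs n) (\<lambda>\<eta>. (W1 \<eta>)\<^sup>2) = (\<Sum>p\<in>R \<times> {1..L}. (D (fst p) / real L)\<^sup>2 * (1/4) ^ card {fst p, fst p + s * int (snd p)})"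
    unfolding W1_def
  proof (rule avg_sq_multilinear)
    show "inj_on (\<lambda>p. {fst p, fst p + s * int (snd p)}) (R \<times> {1..L})"
      using s by (auto simp: inj_on_def doubleton_eq_iff)
    show "{fst p, fst p + s * int (snd p)} \<subseteq> Sites n" if "p \<in> R \<times> {1..L}" for p
      using sites[of "fst p" 0] sites[of "fst p" "snd p"] that by auto
  qed (use R in auto)
  also have "\<dots> = (\<Sum>p\<in>R \<times> {1..L}. (D (fst p))\<^sup>2 / (16 * (real L)\<^sup>2))"
    using s0 by (intro sum.cong) (auto simp: power_divide power2_eq_square)
  also have "\<dots> = (\<Sum>x\<in>R. real L * ((D x)\<^sup>2 / (16 * (real L)\<^sup>2)))"
    by (simp add: sum.cartesian_product')
  also have "\<dots> = 1/16 * (\<Sum>x\<in>R. (D x)\<^sup>2) / real L"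
    using L by (simp add: power2_eq_square sum_divide_distrib sum_distrib_left)
  finally have d1: "decomp n W1 (1/16 * (\<Sum>x\<in>R. (D x)\<^sup>2) / real L) 0"
    by (intro decomp_L2) simp
  have bond: "bond_of s i x \<in> bonds n" if "x \<in> R" "i \<in> {1..<L}" for x i
    using sites[of x i] sites[of x "Suc i"] that s by (auto simp: bond_of_def bonds_def Sites_def)
  have d2: "decomp n W2 0 (\<Sum>x\<in>R. \<Sum>i\<in>{1..<L}. (\<Psi> x i)\<^sup>2 / 4)"
    unfolding W2_def
  proof (rule decomp_moving[OF s R _ bond])
    \<comment> \<open>Since \<open>i\<close> starts at 1, the bonds used never touch
      \<open>x\<close>, and the factor \<open>centred \<eta> x\<close> is not affected by the
      exchange.\<close>
    fix x i \<eta> assume "x \<in> R" "i \<in> {1..<L}"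
    then show "\<Psi> x i * centred (swap (bond_of s i x) (bond_of s i x + 1) \<eta>) x = \<Psi> x i * centred \<eta> x"
      by (auto simp: bond_of_def centred_def swap_apply)
  next
    \<comment> \<open>Rows crossing the same bond at different positions \<open>i\<close> have
      different base sites, so their currents are orthogonal.\<close>
    fix b assume b: "b \<in> bonds n"
    let ?I = "{i\<in>{1..<L}. base_of s i b \<in> R}"
    have "(\<Sum>i\<in>{1..<L}. if base_of s i b \<in> R then real_of_int s * (\<Psi> (base_of s i b) i * centred \<eta> (base_of s i b)) else 0)
      = (\<Sum>i\<in>?I. (real_of_int s * \<Psi> (base_of s i b) i) * (\<Prod>y\<in>{base_of s i b}. centred \<eta> y))" for \<eta>
      by (subst sum.inter_filter) (auto intro!: sum.cong)
    moreover have "avg (configs n) (\<lambda>\<eta>. (\<Sum>i\<in>?I. (real_of_int s * \<Psi> (base_of s i b) i) * (\<Prod>y\<in>{base_of s i b}. centred \<eta> y))\<^sup>2)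
      = (\<Sum>i\<in>?I. (real_of_int s * \<Psi> (base_of s i b) i)\<^sup>2 * (1/4) ^ card {base_of s i b})"
    proof (rule avg_sq_multilinear)
      show "inj_on (\<lambda>i. {base_of s i b}) ?I" by (auto simp: inj_on_def base_of_def split: if_splits)
      show "{base_of s i b} \<subseteq> Sites n" if "i \<in> ?I" for i using sites[of "base_of s i b" 0] that by auto
    qed simp
    moreover have "(\<Sum>i\<in>?I. (real_of_int s * \<Psi> (base_of s i b) i)\<^sup>2 * (1/4) ^ card {base_of s i b})
      = (\<Sum>i\<in>{1..<L}. if base_of s i b \<in> R then (\<Psi> (base_of s i b) i)\<^sup>2 / 4 else 0)"
      using s by (subst sum.inter_filter) (auto intro!: sum.cong simp: power_mult_distrib)
    ultimately show "avg (configs n) (\<lambda>\<eta>. (\<Sum>i\<in>{1..<L}. if base_of s i b \<in> R then real_of_int s * (\<Psi> (base_of s i b) i * centred \<eta> (base_of s i b)) else 0)\<^sup>2)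
      \<le> (\<Sum>i\<in>{1..<L}. if base_of s i b \<in> R then (\<Psi> (base_of s i b) i)\<^sup>2 / 4 else 0)"
      by simp
  qed simp
  have "(\<Sum>x\<in>R. \<Sum>i\<in>{1..<L}. (\<Psi> x i)\<^sup>2 / 4) \<le> (\<Sum>x\<in>R. real L * (\<Sum>j=1..L. \<bar>d x j\<bar>)\<^sup>2)"
  proof (rule sum_mono)
    fix x assume "x \<in> R"
    let ?N = "\<Sum>j=1..L. \<bar>d x j\<bar>"
    have "(\<Psi> x i)\<^sup>2 / 4 \<le> ?N\<^sup>2" if i: "i \<in> {1..<L}" for i
    proof -
      have "\<Psi> x i = (\<Sum>j=1..i. d x j) - real i * (D x / real L)" by (simp add: \<Psi>_def sum_subtractf)
      moreover have "\<bar>\<Sum>j=1..i. d x j\<bar> \<le> ?N"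
        using i by (intro order.trans[OF sum_abs] sum_mono2) auto
      moreover have "\<bar>real i * (D x / real L)\<bar> \<le> ?N"
      proof -
        have "\<bar>D x\<bar> \<le> ?N" unfolding D_def by (rule sum_abs)
        then have "real i / real L * \<bar>D x\<bar> \<le> 1 * ?N" using i by (intro mult_mono) auto
        then show ?thesis by (simp add: abs_mult)
      qed
      ultimately have "\<bar>\<Psi> x i\<bar> \<le> 2 * ?N" by linarith
      then have "(\<Psi> x i)\<^sup>2 \<le> (2 * ?N)\<^sup>2" by (intro abs_le_square_iff[THEN iffD1]) simp
      then show ?thesis by (simp add: power_mult_distrib)
    qed
    then have "(\<Sum>i\<in>{1..<L}. (\<Psi> x i)\<^sup>2 / 4) \<le> (\<Sum>i\<in>{1..<L}. ?N\<^sup>2)" by (rule sum_mono)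
    also have "\<dots> \<le> real L * ?N\<^sup>2" by (simp add: mult_right_mono)
    finally show "(\<Sum>i\<in>{1..<L}. (\<Psi> x i)\<^sup>2 / 4) \<le> real L * ?N\<^sup>2" .
  qed
  then have "(\<Sum>x\<in>R. \<Sum>i\<in>{1..<L}. (\<Psi> x i)\<^sup>2 / 4) \<le> real L * (\<Sum>x\<in>R. (\<Sum>j=1..L. \<bar>d x j\<bar>)\<^sup>2)"
    by (simp only: sum_distrib_left)
  then show ?thesis
    by (intro decomp_cong[OF decomp_add[OF d1 d2] split]) (simp_all add: D_def)
qed

text \<open>With Y the centred block average, the diagonal term of centred \<eta> x times Y is
  exactly \<open>1 / (4 * l)\<close>, so the bracket equals -Y (centred \<eta> x - Y). The last
  factor is a sum of gradients along the block, and Y does not change under exchanges inside the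
  block: this is a flow.\<close>

lemma decomp_blocks:
  assumes s: "s = 1 \<or> s = - 1" and R: "finite R" and l: "1 \<le> l"
    and sites: "\<And>x i. x \<in> R \<Longrightarrow> i < l \<Longrightarrow> x + s * int i \<in> Sites n"
  shows "decomp n (\<lambda>\<eta>. \<Sum>x\<in>R. v x * (((\<Sum>i<l. centred \<eta> (x + s * int i)) / real l)\<^sup>2 - 1 / (4 * real l)
       - 1 / real l * (\<Sum>j\<in>{1..<l}. centred \<eta> x * centred \<eta> (x + s * int j))))
     0 (real l / 4 * (\<Sum>x\<in>R. (v x)\<^sup>2))"
proof -
  define Y where "Y x \<eta> = (\<Sum>i<l. centred \<eta> (x + s * int i)) / real l" for x \<eta>
  \<comment> \<open>The fraction of the block lying beyond its \<open>i\<close>-th bond: the current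
    needed to spread unit mass at \<open>x\<close> evenly.\<close>
  define A where "A i = 1 - (real i + 1) / real l" for i :: nat
  have s0: "s \<noteq> 0" using s by auto
  have split: "(\<Sum>x\<in>R. v x * (((\<Sum>i<l. centred \<eta> (x + s * int i)) / real l)\<^sup>2 - 1 / (4 * real l)
       - 1 / real l * (\<Sum>j\<in>{1..<l}. centred \<eta> x * centred \<eta> (x + s * int j))))
     = (\<Sum>x\<in>R. \<Sum>i\<in>{..<l - 1}. (- v x * A i * Y x \<eta>) * (centred \<eta> (x + s * int i) - centred \<eta> (x + s * (int i + 1))))"
    if \<eta>: "\<eta> \<in> configs n" for \<eta>
  proof (rule sum.cong)
    fix x assume x: "x \<in> R"
    let ?f = "\<lambda>i. centred \<eta> (x + s * int i)"
    have h: "{..<l} = insert 0 {1..<l}" using l by auto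
    have "centred \<eta> x * Y x \<eta> = (centred \<eta> x * centred \<eta> x + (\<Sum>j\<in>{1..<l}. centred \<eta> x * ?f j)) / real l"
      unfolding Y_def h by (simp add: sum_distrib_left distrib_left)
    also have "centred \<eta> x * centred \<eta> x = 1/4"
      using centred_sq[OF \<eta>, of x] sites[OF x, of 0] l by (simp add: power2_eq_square)
    finally have cY: "1 / real l * (\<Sum>j\<in>{1..<l}. centred \<eta> x * ?f j) = centred \<eta> x * Y x \<eta> - 1 / (4 * real l)"
      by (simp add: add_divide_distrib)
    have ab: "centred \<eta> x - Y x \<eta> = (\<Sum>i\<in>{..<l - 1}. A i * (?f i - ?f (Suc i)))"
    proof -
      \<comment> \<open>For general \<open>k\<close> boundary terms remain; at
        \<open>k = l - 1\<close> the weight \<open>A k\<close> vanishes and the last term completes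
        the average.\<close>
      have gen: "(\<Sum>i<k. A i * (?f i - ?f (Suc i))) = ?f 0 - (\<Sum>i<k. ?f i) / real l - A k * ?f k - ?f k / real l"
        for k
      proof (induction k)
        case (Suc k)
        have "A k = A (Suc k) + 1 / real l" by (simp add: A_def add_divide_distrib)
        then show ?case
          unfolding sum.lessThan_Suc Suc.IH add_divide_distrib by (simp add: right_diff_distrib distrib_right)
      qed (simp add: A_def left_diff_distrib)
      have "A (l - 1) = 0" using l by (simp add: A_def of_nat_diff)
      moreover have "(\<Sum>i<l. ?f i) = (\<Sum>i<l - 1. ?f i) + ?f (l - 1)" using l by (cases l) auto
      ultimately show ?thesis using gen[of "l - 1"] by (simp add: Y_def add_divide_distrib)
    qed
    have "v x * ((Y x \<eta>)\<^sup>2 - 1 / (4 * real l) - (centred \<eta> x * Y x \<eta> - 1 / (4 * real l))) = - v x * Y x \<eta> * (centred \<eta> x - Y x \<eta>)"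
      by (simp add: algebra_simps power2_eq_square)
    also have "\<dots> = (\<Sum>i\<in>{..<l - 1}. (- v x * A i * Y x \<eta>) * (?f i - ?f (Suc i)))"
      unfolding ab sum_distrib_left by (intro sum.cong) (auto simp: mult_ac)
    finally show "v x * (((\<Sum>i<l. ?f i) / real l)\<^sup>2 - 1 / (4 * real l) - 1 / real l * (\<Sum>j\<in>{1..<l}. centred \<eta> x * ?f j))
      = (\<Sum>i\<in>{..<l - 1}. (- v x * A i * Y x \<eta>) * (?f i - centred \<eta> (x + s * (int i + 1))))"
      unfolding cY Y_def by (simp add: add.commute)
  qed simp
  have bond: "bond_of s i x \<in> bonds n" if "x \<in> R" "i \<in> {..<l - 1}" for x i
  proof -
    have "i < l" "Suc i < l" using that(2) by auto
    then show ?thesis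
      using sites[of x i] sites[of x "Suc i"] that(1) s by (auto simp: bond_of_def bonds_def Sites_def)
  qed
  have Y2: "avg (configs n) (\<lambda>\<eta>. (Y x \<eta>)\<^sup>2) = 1 / (4 * real l)" if x: "x \<in> R" for x
  proof -
    have "Y x \<eta> = (\<Sum>i<l. 1 / real l * (\<Prod>y\<in>{x + s * int i}. centred \<eta> y))" for \<eta>
      by (simp add: Y_def sum_divide_distrib)
    moreover have "avg (configs n) (\<lambda>\<eta>. (\<Sum>i<l. 1 / real l * (\<Prod>y\<in>{x + s * int i}. centred \<eta> y))\<^sup>2)
      = (\<Sum>i<l. (1 / real l)\<^sup>2 * (1/4) ^ card {x + s * int i})"
      by (rule avg_sq_multilinear) (use s0 sites[OF x] in \<open>auto simp: inj_on_def\<close>)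
    ultimately show ?thesis using l by (simp add: power2_eq_square)
  qed
  have A1: "0 \<le> A i" "A i \<le> 1" if "i \<in> {..<l - 1}" for i
  proof -
    have "real i + 1 \<le> real l" using that by simp
    then show "0 \<le> A i" "A i \<le> 1" using l by (auto simp: A_def field_simps)
  qed
  have "decomp n (\<lambda>\<eta>. \<Sum>x\<in>R. \<Sum>i\<in>{..<l - 1}. (- v x * A i * Y x \<eta>) * (centred \<eta> (x + s * int i) - centred \<eta> (x + s * (int i + 1))))
     0 (\<Sum>x\<in>R. \<Sum>i\<in>{..<l - 1}. (v x)\<^sup>2 / 4)"
  proof (rule decomp_moving[OF s R _ bond])
    fix x i \<eta> assume x: "x \<in> R" and i: "i \<in> {..<l - 1}" and \<eta>: "\<eta> \<in> configs n"
    have "Y x (swap (bond_of s i x) (bond_of s i x + 1) \<eta>) = Y x \<eta>"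
    proof -
      define p q where "p = x + s * int i" and "q = x + s * int (Suc i)"
      have sw: "swap (bond_of s i x) (bond_of s i x + 1) = swap p q"
      proof (cases "s = 1")
        case True
        then show ?thesis by (simp add: bond_of_def p_def q_def algebra_simps)
      next
        case False
        then have "bond_of s i x = q" "bond_of s i x + 1 = p" using s by (auto simp: bond_of_def p_def q_def)
        then show ?thesis by (simp only: swap_commute[of q p])
      qed
      \<comment> \<open>The exchange acts on the block as a transposition of two neighbouring
        indices.\<close>
      define t where "t k = (if k = i then Suc i else if k = Suc i then i else k)" for k
      have "centred (swap p q \<eta>) (x + s * int k) = centred \<eta> (x + s * int (t k))" for k
        using s0 by (auto simp: centred_def swap_apply p_def q_def t_def)
      then have "(\<Sum>k<l. centred (swap p q \<eta>) (x + s * int k)) = (\<Sum>k<l. centred \<eta> (x + s * int (t k)))" by simp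
      also have "\<dots> = (\<Sum>k<l. centred \<eta> (x + s * int k))"
        by (rule sum.reindex_bij_witness[where i=t and j=t]) (use i in \<open>auto simp: t_def\<close>)
      finally show ?thesis by (simp add: Y_def sw)
    qed
    then show "- v x * A i * Y x (swap (bond_of s i x) (bond_of s i x + 1) \<eta>) = - v x * A i * Y x \<eta>" by simp
  next
    fix b assume b: "b \<in> bonds n"
    let ?t = "\<lambda>i \<eta>. if base_of s i b \<in> R then real_of_int s * (- v (base_of s i b) * A i * Y (base_of s i b) \<eta>) else 0"
    \<comment> \<open>Averages of overlapping blocks are correlated, so Cauchy-Schwarz replaces
      orthogonality; its factor \<open>l - 1\<close> is compensated by the second moment
      \<open>1 / (4 * l)\<close> of Y.\<close>
    have "avg (configs n) (\<lambda>\<eta>. (\<Sum>i<l - 1. ?t i \<eta>)\<^sup>2) \<le> avg (configs n) (\<lambda>\<eta>. (\<Sum>i<l - 1. (?t i \<eta>)\<^sup>2) * real (card {..<l - 1}))"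
      by (intro avg_mono sum_squared_le_sum_of_squares)
    also have "\<dots> = (\<Sum>i<l - 1. real (l - 1) * avg (configs n) (\<lambda>\<eta>. (?t i \<eta>)\<^sup>2))"
      unfolding sum_distrib_left[symmetric] avg_sum[symmetric] avg_cmult[symmetric] by (simp add: mult.commute)
    also have "\<dots> \<le> (\<Sum>i<l - 1. if base_of s i b \<in> R then (v (base_of s i b))\<^sup>2 / 4 else 0)"
    proof (rule sum_mono)
      fix i assume i: "i \<in> {..<l - 1}"
      show "real (l - 1) * avg (configs n) (\<lambda>\<eta>. (?t i \<eta>)\<^sup>2) \<le> (if base_of s i b \<in> R then (v (base_of s i b))\<^sup>2 / 4 else 0)"
      proof (cases "base_of s i b \<in> R")
        case True
        let ?x = "base_of s i b"
        have "(?t i \<eta>)\<^sup>2 = ((v ?x)\<^sup>2 * (A i)\<^sup>2) * (Y ?x \<eta>)\<^sup>2" for \<eta>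
          using True s by (auto simp: power_mult_distrib)
        then have "real (l - 1) * avg (configs n) (\<lambda>\<eta>. (?t i \<eta>)\<^sup>2) = real (l - 1) * ((v ?x)\<^sup>2 * (A i)\<^sup>2 * (1 / (4 * real l)))"
          by (simp only: avg_cmult Y2[OF True])
        also have "\<dots> = (v ?x)\<^sup>2 / 4 * ((A i)\<^sup>2 * (real (l - 1) / real l))" by simp
        also have "\<dots> \<le> (v ?x)\<^sup>2 / 4 * (1 * 1)"
          using A1[OF i] l by (intro mult_left_mono mult_mono) (auto simp: power_le_one)
        finally show ?thesis using True by simp
      qed (simp add: avg_const)
    qed
    finally show "avg (configs n) (\<lambda>\<eta>. (\<Sum>i\<in>{..<l - 1}. ?t i \<eta>)\<^sup>2) \<le> (\<Sum>i\<in>{..<l - 1}. if base_of s i b \<in> R then (v (base_of s i b))\<^sup>2 / 4 else 0)" .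
  qed simp
  moreover have "(\<Sum>x\<in>R. \<Sum>i\<in>{..<l - 1}. (v x)\<^sup>2 / 4) \<le> real l / 4 * (\<Sum>x\<in>R. (v x)\<^sup>2)"
    unfolding sum_distrib_left by (intro sum_mono) (auto simp: mult_right_mono)
  ultimately show ?thesis
    by (intro decomp_cong[OF _ split]) auto
qed

section \<open>The quadratic field as flows and remainders\<close>

definition pair_field :: "nat \<Rightarrow> (int \<Rightarrow> int \<Rightarrow> real) \<Rightarrow> config \<Rightarrow> real" where
  "pair_field n c \<eta> = (\<Sum>p\<in>{(x, y)\<in>Sites n \<times> Sites n. x < y}. c (fst p) (snd p) * (centred \<eta> (fst p) * centred \<eta> (snd p)))"

definition pair_coeff :: "real \<Rightarrow> real \<Rightarrow> nat \<Rightarrow> (real \<Rightarrow> real) \<Rightarrow> int \<Rightarrow> int \<Rightarrow> real" where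
  "pair_coeff \<gamma> \<theta> n H x y =
     - (real n powr \<theta> / sqrt (real n)) * p_rate \<gamma> (y - x) * (H (of_int y / real n) - H (of_int x / real n))"

text \<open>Both \<open>a_rate\<close> and the increment of \<open>H\<close> are antisymmetric, so
  the two orders of a pair contribute equally, which cancels the 1/2 in
  \<open>a_rate\<close>.\<close>

lemma A4_eq_pair_field: "A4 \<gamma> \<theta> n H \<eta> = pair_field n (pair_coeff \<gamma> \<theta> n H) \<eta>"
proof -
  let ?S = "Sites n" and ?h = "\<lambda>x::int. H (of_int x / real n)"
  let ?P = "{(x, y)\<in>?S \<times> ?S. x < y}" and ?Q = "{(x, y)\<in>?S \<times> ?S. y < x}"
  define t where "t p = a_rate \<gamma> (snd p - fst p) * (?h (snd p) - ?h (fst p)) * centred \<eta> (fst p) * centred \<eta> (snd p)" for p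
  have fin: "finite ?P" "finite ?Q"
    by (rule finite_subset[of _ "?S \<times> ?S"], auto)+
  have "(\<Sum>x\<in>?S. \<Sum>y\<in>?S. a_rate \<gamma> (y - x) * (?h y - ?h x) * centred \<eta> x * centred \<eta> y) = sum t (?S \<times> ?S)"
    by (simp add: sum.cartesian_product' t_def)
  also have "\<dots> = sum t (?P \<union> ?Q)"
    by (rule sum.mono_neutral_right) (auto simp: t_def, metis linorder_less_linear)
  also have "\<dots> = sum t ?P + sum t ?Q"
    using fin by (intro sum.union_disjoint) auto
  also have "sum t ?Q = sum t ?P"
    by (rule sum.reindex_bij_witness[where i="\<lambda>p. (snd p, fst p)" and j="\<lambda>p. (snd p, fst p)"])
      (auto simp: t_def a_rate_def algebra_simps)
  also have "sum t ?P + sum t ?P = (\<Sum>p\<in>?P. p_rate \<gamma> (snd p - fst p) * (?h (snd p) - ?h (fst p)) * (centred \<eta> (fst p) * centred \<eta> (snd p)))"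
    unfolding sum.distrib[symmetric]
    by (intro sum.cong) (auto simp: t_def a_rate_def p_rate_def)
  finally show ?thesis
    unfolding A4_def pair_field_def pair_coeff_def by (simp add: sum_distrib_left mult_ac)
qed

text \<open>A pair of sites at distance \<open>j < l\<close> is charged to its left site if the block of that site
  looks to the right, and otherwise to its right site, whose block then looks to the left.\<close>

definition near_coeff :: "nat \<Rightarrow> nat \<Rightarrow> (int \<Rightarrow> int \<Rightarrow> real) \<Rightarrow> int \<Rightarrow> nat \<Rightarrow> real" where
  "near_coeff n l c x j =
     (if x \<le> int n - int l - 1 then c x (x + int j)
      else if int n - int l \<le> x - int j then c (x - int j) x else 0)"

text \<open>The pairs left over by \<open>near_coeff\<close>; two sites among the last
  \<open>l\<close> are always at distance less than \<open>l\<close>.\<close>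

definition far_pairs :: "nat \<Rightarrow> nat \<Rightarrow> (int \<times> int) set" where
  "far_pairs n l = {(x, y)\<in>Sites n \<times> Sites n. x \<le> int n - int l - 1 \<and> x + int l \<le> y}"

definition right_rows :: "nat \<Rightarrow> nat \<Rightarrow> int set" where
  "right_rows n l = {1..int n - int l - 1}"

definition left_rows :: "nat \<Rightarrow> nat \<Rightarrow> int set" where
  "left_rows n l = {int n - int l..int n - 1}"

lemma rows_Un: "1 \<le> l \<Longrightarrow> l < n \<Longrightarrow> Sites n = right_rows n l \<union> left_rows n l"
  and rows_disjoint: "right_rows n l \<inter> left_rows n l = {}"
  and finite_rows: "finite (right_rows n l)" "finite (left_rows n l)"
  by (auto simp: right_rows_def left_rows_def Sites_def)

lemma pair_field_split:
  assumes l: "1 \<le> l" "2 * l \<le> n"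
  shows "pair_field n c \<eta> =
     (\<Sum>x\<in>right_rows n l. \<Sum>j=1..l - 1. near_coeff n l c x j * (centred \<eta> x * centred \<eta> (x + int j)))
   + (\<Sum>x\<in>left_rows n l. \<Sum>j=1..l - 1. near_coeff n l c x j * (centred \<eta> x * centred \<eta> (x - int j)))
   + (\<Sum>p\<in>far_pairs n l. c (fst p) (snd p) * (centred \<eta> (fst p) * centred \<eta> (snd p)))"
proof -
  let ?S = "Sites n"
  define t where "t p = c (fst p) (snd p) * (centred \<eta> (fst p) * centred \<eta> (snd p))" for p
  let ?A = "{(x, y)\<in>?S \<times> ?S. x < y \<and> x \<le> int n - int l - 1 \<and> y < x + int l}"
  let ?B = "{(x, y)\<in>?S \<times> ?S. x < y \<and> int n - int l \<le> x}"
  have fin: "finite ?A" "finite ?B" "finite (far_pairs n l)"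
    by (rule finite_subset[of _ "?S \<times> ?S"], auto simp: far_pairs_def)+
  have P: "{(x, y)\<in>?S \<times> ?S. x < y} = (?A \<union> ?B) \<union> far_pairs n l"
    using l by (auto simp: far_pairs_def)
  have "pair_field n c \<eta> = sum t ?A + sum t ?B + sum t (far_pairs n l)"
    unfolding pair_field_def P t_def[symmetric] using fin
    by (subst sum.union_disjoint, simp, simp, force simp: far_pairs_def, subst sum.union_disjoint, auto)
  also have "sum t ?A = (\<Sum>p\<in>right_rows n l \<times> {1..l - 1}. near_coeff n l c (fst p) (snd p) * (centred \<eta> (fst p) * centred \<eta> (fst p + int (snd p))))"
    by (rule sum.reindex_bij_witness[where i="\<lambda>p. (fst p, fst p + int (snd p))" and j="\<lambda>p. (fst p, nat (snd p - fst p))"])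
      (use l in \<open>auto simp: t_def near_coeff_def right_rows_def Sites_def\<close>)
  also have "\<dots> = (\<Sum>x\<in>right_rows n l. \<Sum>j=1..l - 1. near_coeff n l c x j * (centred \<eta> x * centred \<eta> (x + int j)))"
    by (simp add: sum.cartesian_product')
  also have "sum t ?B = (\<Sum>p\<in>{p\<in>left_rows n l \<times> {1..l - 1}. int n - int l \<le> fst p - int (snd p)}. near_coeff n l c (fst p) (snd p) * (centred \<eta> (fst p) * centred \<eta> (fst p - int (snd p))))"
    by (rule sum.reindex_bij_witness[where i="\<lambda>p. (fst p - int (snd p), fst p)" and j="\<lambda>p. (snd p, nat (snd p - fst p))"])
      (use l in \<open>auto simp: t_def near_coeff_def left_rows_def Sites_def mult_ac\<close>)
  \<comment> \<open>Where a left-looking row is shorter than \<open>l - 1\<close>,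
    \<open>near_coeff\<close> vanishes; the padding gives all rows a common length.\<close>
  also have "\<dots> = (\<Sum>p\<in>left_rows n l \<times> {1..l - 1}. near_coeff n l c (fst p) (snd p) * (centred \<eta> (fst p) * centred \<eta> (fst p - int (snd p))))"
    by (rule sum.mono_neutral_left) (auto simp: finite_rows near_coeff_def left_rows_def)
  also have "\<dots> = (\<Sum>x\<in>left_rows n l. \<Sum>j=1..l - 1. near_coeff n l c x j * (centred \<eta> x * centred \<eta> (x - int j)))"
    by (simp add: sum.cartesian_product')
  finally show ?thesis by (simp only: t_def)
qed

lemma block_field_split:
  assumes l: "1 \<le> l" "2 * l \<le> n"
  shows "block_field n l H \<eta> =
    (\<Sum>x\<in>right_rows n l. D01 H (of_int x / real n) * (((\<Sum>i<l. centred \<eta> (x + int i)) / real l)\<^sup>2 - 1 / (4 * real l)))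
  + (\<Sum>x\<in>left_rows n l. D01 H (of_int x / real n) * (((\<Sum>i<l. centred \<eta> (x - int i)) / real l)\<^sup>2 - 1 / (4 * real l)))"
proof -
  have r: "block_avg n l \<eta> x - 1/2 = (\<Sum>i<l. centred \<eta> (x + int i)) / real l" if "x \<in> right_rows n l" for x
    using that l by (simp add: block_avg_def right_rows_def centred_def sum_subtractf diff_divide_distrib)
  have lf: "block_avg n l \<eta> x - 1/2 = (\<Sum>i<l. centred \<eta> (x - int i)) / real l" if "x \<in> left_rows n l" for x
    using that l by (simp add: block_avg_def left_rows_def centred_def sum_subtractf diff_divide_distrib)
  have ln: "l < n" using l by linarith
  show ?thesis
    unfolding block_field_def rows_Un[OF l(1) ln] sum.union_disjoint[OF finite_rows rows_disjoint]
    by (intro arg_cong2[where f="(+)"] sum.cong refl) (simp_all only: r lf mult.commute)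
qed

text \<open>The block field is replaced by uniform rows through \<open>decomp_blocks\<close>, and
  these rows are merged with the near coefficients into \<open>d\<close> before anything is moved,
  so that their masses can cancel. Row and block terms pass through three uses of
  \<open>decomp_add\<close>, which multiply 1/8, 2 and 1/4 by 8; the far pairs pass through one, and
  1/16 becomes 1/8.\<close>

lemma decomp_pair_block:
  fixes \<kappa> :: real and H :: "real \<Rightarrow> real" and c :: "int \<Rightarrow> int \<Rightarrow> real"
  assumes l: "2 \<le> l" "2 * l \<le> n"
  defines "v \<equiv> \<lambda>x. D01 H (of_int x / real n)"
  defines "d \<equiv> \<lambda>x j. near_coeff n l c x j + \<kappa> * v x / real l"
  shows "decomp n (\<lambda>\<eta>. pair_field n c \<eta> + \<kappa> * block_field n l H \<eta>)
    (1/8 * (\<Sum>p\<in>far_pairs n l. (c (fst p) (snd p))\<^sup>2) + (\<Sum>x\<in>Sites n. (\<Sum>j=1..l - 1. d x j)\<^sup>2) / real (l - 1))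
    (16 * real l * (\<Sum>x\<in>Sites n. (\<Sum>j=1..l - 1. \<bar>d x j\<bar>)\<^sup>2) + 2 * real l * \<kappa>\<^sup>2 * (\<Sum>x\<in>Sites n. (v x)\<^sup>2))"
proof -
  let ?R = "right_rows n l" and ?L = "left_rows n l"
  have l1: "1 \<le> l" "1 \<le> l - 1" "l < n" using l by auto
  have rs: "x + 1 * int i \<in> Sites n" if "x \<in> ?R" "i < l" for x i
    using that l by (auto simp: right_rows_def Sites_def)
  have ls: "x + (- 1) * int i \<in> Sites n" if "x \<in> ?L" "i < l" for x i
    using that l by (auto simp: left_rows_def Sites_def)
  define ds where "ds x = (\<Sum>j=1..l - 1. d x j)\<^sup>2" for x
  define da where "da x = (\<Sum>j=1..l - 1. \<bar>d x j\<bar>)\<^sup>2" for x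
  define bl where "bl s x \<eta> = \<kappa> * v x * (((\<Sum>i<l. centred \<eta> (x + s * int i)) / real l)\<^sup>2 - 1 / (4 * real l)
       - 1 / real l * (\<Sum>j\<in>{1..<l}. centred \<eta> x * centred \<eta> (x + s * int j)))" for s x \<eta>
  define row where "row s x \<eta> = (\<Sum>j=1..l - 1. d x j * (centred \<eta> x * centred \<eta> (x + s * int j)))" for s x \<eta>
  define far where "far \<eta> = (\<Sum>p\<in>far_pairs n l. c (fst p) (snd p) * (\<Prod>y\<in>{fst p, snd p}. centred \<eta> y))" for \<eta>
  have rowR: "decomp n (\<lambda>\<eta>. \<Sum>x\<in>?R. row 1 x \<eta>) (1/8 * (\<Sum>x\<in>?R. ds x) / real (l - 1)) (2 * (real (l - 1) * (\<Sum>x\<in>?R. da x)))"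
    unfolding row_def ds_def da_def by (rule decomp_rows) (use l1 rs finite_rows in auto)
  have rowL: "decomp n (\<lambda>\<eta>. \<Sum>x\<in>?L. row (- 1) x \<eta>) (1/8 * (\<Sum>x\<in>?L. ds x) / real (l - 1)) (2 * (real (l - 1) * (\<Sum>x\<in>?L. da x)))"
    unfolding row_def ds_def da_def by (rule decomp_rows) (use l1 ls finite_rows in auto)
  have blR: "decomp n (\<lambda>\<eta>. \<Sum>x\<in>?R. bl 1 x \<eta>) 0 (real l / 4 * (\<Sum>x\<in>?R. (\<kappa> * v x)\<^sup>2))"
    unfolding bl_def by (rule decomp_blocks) (use l1 rs finite_rows in auto)
  have blL: "decomp n (\<lambda>\<eta>. \<Sum>x\<in>?L. bl (- 1) x \<eta>) 0 (real l / 4 * (\<Sum>x\<in>?L. (\<kappa> * v x)\<^sup>2))"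
    unfolding bl_def by (rule decomp_blocks) (use l1 ls finite_rows in auto)
  have farD: "decomp n far (1/16 * (\<Sum>p\<in>far_pairs n l. (c (fst p) (snd p))\<^sup>2)) 0"
  proof (rule decomp_L2)
    have fin: "finite (far_pairs n l)"
      by (rule finite_subset[of _ "Sites n \<times> Sites n"]) (auto simp: far_pairs_def)
    have "avg (configs n) (\<lambda>\<eta>. (far \<eta>)\<^sup>2) = (\<Sum>p\<in>far_pairs n l. (c (fst p) (snd p))\<^sup>2 * (1/4) ^ card {fst p, snd p})"
      unfolding far_def
      by (rule avg_sq_multilinear) (use fin l in \<open>auto simp: far_pairs_def inj_on_def doubleton_eq_iff\<close>)
    also have "\<dots> = (\<Sum>p\<in>far_pairs n l. 1/16 * (c (fst p) (snd p))\<^sup>2)"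
    proof (rule sum.cong)
      fix p assume "p \<in> far_pairs n l"
      then have "fst p \<noteq> snd p" using l by (auto simp: far_pairs_def)
      then show "(c (fst p) (snd p))\<^sup>2 * (1/4) ^ card {fst p, snd p} = 1/16 * (c (fst p) (snd p))\<^sup>2"
        by (simp add: power2_eq_square)
    qed simp
    finally show "avg (configs n) (\<lambda>\<eta>. (far \<eta>)\<^sup>2) \<le> 1/16 * (\<Sum>p\<in>far_pairs n l. (c (fst p) (snd p))\<^sup>2)"
      by (simp add: sum_distrib_left)
  qed
  have one: "near_coeff n l c x j * (centred \<eta> x * centred \<eta> (x + s * int j))
     = d x j * (centred \<eta> x * centred \<eta> (x + s * int j)) - \<kappa> * v x / real l * (centred \<eta> x * centred \<eta> (x + s * int j))" for x j s \<eta>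
    by (simp add: d_def algebra_simps)
  have row: "(\<Sum>j=1..l - 1. near_coeff n l c x j * (centred \<eta> x * centred \<eta> (x + s * int j)))
      + \<kappa> * (v x * (((\<Sum>i<l. centred \<eta> (x + s * int i)) / real l)\<^sup>2 - 1 / (4 * real l))) = row s x \<eta> + bl s x \<eta>" for s x \<eta>
  proof -
    have set: "{1..l - 1} = {1..<l}" using l by auto
    show ?thesis
      unfolding one sum_subtractf row_def bl_def sum_distrib_left[symmetric] set by (simp add: algebra_simps)
  qed
  have eq: "pair_field n c \<eta> + \<kappa> * block_field n l H \<eta>
     = (((\<Sum>x\<in>?R. row 1 x \<eta>) + (\<Sum>x\<in>?L. row (- 1) x \<eta>)) + ((\<Sum>x\<in>?R. bl 1 x \<eta>) + (\<Sum>x\<in>?L. bl (- 1) x \<eta>))) + far \<eta>" for \<eta>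
  proof -
    have vf: "D01 H (of_int x / real n) = v x" for x by (simp add: v_def)
    have regroup: "a + b + f' + (k1 + k2) = ((r1 + r2) + (b1 + b2)) + f"
      if "f = f'" "r1 + b1 = a + k1" "r2 + b2 = b + k2" for a b f' k1 k2 r1 r2 b1 b2 f :: real
      using that by linarith
    have "far \<eta> = (\<Sum>p\<in>far_pairs n l. c (fst p) (snd p) * (centred \<eta> (fst p) * centred \<eta> (snd p)))"
      unfolding far_def by (intro sum.cong) (use l in \<open>auto simp: far_pairs_def\<close>)
    moreover have "(\<Sum>x\<in>?R. row 1 x \<eta>) + (\<Sum>x\<in>?R. bl 1 x \<eta>)
       = (\<Sum>x\<in>?R. \<Sum>j=1..l - 1. near_coeff n l c x j * (centred \<eta> x * centred \<eta> (x + int j)))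
        + \<kappa> * (\<Sum>x\<in>?R. v x * (((\<Sum>i<l. centred \<eta> (x + int i)) / real l)\<^sup>2 - 1 / (4 * real l)))"
      unfolding sum.distrib[symmetric] row[symmetric] sum_distrib_left[of \<kappa>] by simp
    moreover have "(\<Sum>x\<in>?L. row (- 1) x \<eta>) + (\<Sum>x\<in>?L. bl (- 1) x \<eta>)
       = (\<Sum>x\<in>?L. \<Sum>j=1..l - 1. near_coeff n l c x j * (centred \<eta> x * centred \<eta> (x - int j)))
        + \<kappa> * (\<Sum>x\<in>?L. v x * (((\<Sum>i<l. centred \<eta> (x - int i)) / real l)\<^sup>2 - 1 / (4 * real l)))"
      unfolding sum.distrib[symmetric] row[symmetric] sum_distrib_left[of \<kappa>] by simp
    ultimately show ?thesis
      unfolding pair_field_split[OF l1(1) l(2)] block_field_split[OF l1(1) l(2)] vf distrib_left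
      by (intro regroup)
  qed
  have un: "(\<Sum>x\<in>Sites n. h x) = (\<Sum>x\<in>?R. h x) + (\<Sum>x\<in>?L. h x)" for h :: "int \<Rightarrow> real"
    unfolding rows_Un[OF l1(1,3)] by (rule sum.union_disjoint[OF finite_rows rows_disjoint])
  note dec = decomp_add[OF decomp_add[OF decomp_add[OF rowR rowL] decomp_add[OF blR blL]] farD]
  show ?thesis
    unfolding ds_def[symmetric] da_def[symmetric] un
  proof (rule decomp_cong[OF dec eq])
    have "0 \<le> (\<Sum>x\<in>?R. da x) + (\<Sum>x\<in>?L. da x)" unfolding da_def by (intro add_nonneg_nonneg sum_nonneg) auto
    then have "real (l - 1) * ((\<Sum>x\<in>?R. da x) + (\<Sum>x\<in>?L. da x)) \<le> real l * ((\<Sum>x\<in>?R. da x) + (\<Sum>x\<in>?L. da x))"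
      by (intro mult_right_mono) auto
    then show "2 * (2 * (2 * (2 * (real (l - 1) * (\<Sum>x\<in>?R. da x))) + 2 * (2 * (real (l - 1) * (\<Sum>x\<in>?L. da x))))
        + 2 * (2 * (real l / 4 * (\<Sum>x\<in>?R. (\<kappa> * v x)\<^sup>2)) + 2 * (real l / 4 * (\<Sum>x\<in>?L. (\<kappa> * v x)\<^sup>2)))) + 2 * 0
      \<le> 16 * real l * ((\<Sum>x\<in>?R. da x) + (\<Sum>x\<in>?L. da x)) + 2 * real l * \<kappa>\<^sup>2 * ((\<Sum>x\<in>?R. (v x)\<^sup>2) + (\<Sum>x\<in>?L. (v x)\<^sup>2))"
      unfolding power_mult_distrib sum_distrib_left[symmetric] by (simp add: algebra_simps)
  qed (simp add: add_divide_distrib)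
qed

section \<open>Analytic estimates\<close>

lemma test_function_derivative:
  assumes "H \<in> test_functions" "x \<in> {0..1}"
  shows "(((D01 ^^ i) H) has_vector_derivative (D01 ^^ Suc i) H x) (at x within {0..1})"
proof -
  have "(D01 ^^ i) H differentiable (at x within {0..1})"
    using assms by (auto simp: test_functions_def differentiable_on_def)
  then show ?thesis by (simp add: D01_def vector_derivative_works)
qed

lemma test_function_continuous:
  assumes "H \<in> test_functions" shows "continuous_on {0..1} ((D01 ^^ i) H)"
  using assms by (auto simp: test_functions_def intro: differentiable_imp_continuous_on)

lemma test_function_bounded:
  assumes "H \<in> test_functions"
  obtains K where "0 \<le> K" "\<And>x. x \<in> {0..1} \<Longrightarrow> \<bar>(D01 ^^ i) H x\<bar> \<le> K"
proof -
  have "compact ((D01 ^^ i) H ` {0..1})"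
    by (intro compact_continuous_image test_function_continuous assms) simp
  then obtain K where "\<forall>y\<in>(D01 ^^ i) H ` {0..1}. norm y \<le> K"
    using compact_imp_bounded bounded_iff by metis
  then have K: "\<bar>(D01 ^^ i) H x\<bar> \<le> K" if "x \<in> {0..1}" for x using that by auto
  moreover have "0 \<le> K" using K[of 0] by force
  ultimately show ?thesis using that by blast
qed

lemma test_function_mvt:
  assumes "H \<in> test_functions" "0 \<le> x" "x \<le> y" "y \<le> 1"
  obtains \<xi> where "\<xi> \<in> {x..y}" "(D01 ^^ i) H y - (D01 ^^ i) H x = (y - x) * (D01 ^^ Suc i) H \<xi>"
proof (cases "x = y")
  case True
  then show ?thesis using that[of x] by simp
next
  case False
  have "((D01 ^^ i) H has_derivative (\<lambda>h. h * (D01 ^^ Suc i) H u)) (at u within {x..y})" if "x \<le> u" "u \<le> y" for u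
  proof -
    have "((D01 ^^ i) H has_derivative (\<lambda>h. h *\<^sub>R (D01 ^^ Suc i) H u)) (at u within {0..1})"
      using test_function_derivative[OF assms(1), of u i] that assms unfolding has_vector_derivative_def by auto
    then show ?thesis
      by (rule has_derivative_subset[THEN has_derivative_eq_rhs]) (use assms in auto)
  qed
  then show ?thesis
    using mvt_very_simple[of x y "(D01 ^^ i) H" "\<lambda>u h. h * (D01 ^^ Suc i) H u"] assms that by auto
qed

text \<open>In the Taylor bound the derivative may be taken anywhere between the two points, because
  a pair is charged to its left site in some rows and to its right site in others.\<close>

lemma test_function_estimates:
  assumes H: "H \<in> test_functions"
  obtains K1 K2 where "0 \<le> K1" "0 \<le> K2" "\<And>x. x \<in> {0..1} \<Longrightarrow> \<bar>D01 H x\<bar> \<le> K1"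
    "\<And>x y. 0 \<le> x \<Longrightarrow> x \<le> y \<Longrightarrow> y \<le> 1 \<Longrightarrow> \<bar>H y - H x\<bar> \<le> K1 * (y - x)"
    "\<And>x y u. 0 \<le> x \<Longrightarrow> x \<le> u \<Longrightarrow> u \<le> y \<Longrightarrow> y \<le> 1 \<Longrightarrow> \<bar>H y - H x - (y - x) * D01 H u\<bar> \<le> K2 * (y - x)\<^sup>2"
proof -
  obtain K1 where K1: "0 \<le> K1" "\<And>x. x \<in> {0..1} \<Longrightarrow> \<bar>(D01 ^^ 1) H x\<bar> \<le> K1"
    using test_function_bounded[OF H] by metis
  obtain K2 where K2: "0 \<le> K2" "\<And>x. x \<in> {0..1} \<Longrightarrow> \<bar>(D01 ^^ 2) H x\<bar> \<le> K2"
    using test_function_bounded[OF H] by metis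
  have 1: "\<bar>D01 H x\<bar> \<le> K1" if "x \<in> {0..1}" for x using K1(2)[OF that] by simp
  have 2: "\<bar>H y - H x\<bar> \<le> K1 * (y - x)" if xy: "0 \<le> x" "x \<le> y" "y \<le> 1" for x y
  proof -
    obtain \<xi> where "\<xi> \<in> {x..y}" "H y - H x = (y - x) * D01 H \<xi>"
      using test_function_mvt[OF H xy, of 0] by auto
    moreover from this have "(y - x) * \<bar>D01 H \<xi>\<bar> \<le> (y - x) * K1"
      using xy by (intro mult_left_mono 1) auto
    ultimately show ?thesis using xy by (simp add: abs_mult mult.commute[of K1])
  qed
  have lip: "\<bar>D01 H y - D01 H x\<bar> \<le> K2 * (y - x)" if xy: "0 \<le> x" "x \<le> y" "y \<le> 1" for x y
  proof -
    obtain \<xi> where "\<xi> \<in> {x..y}" "D01 H y - D01 H x = (y - x) * (D01 ^^ 2) H \<xi>"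
      using test_function_mvt[OF H xy, of 1] by (auto simp: numeral_2_eq_2)
    moreover from this have "(y - x) * \<bar>(D01 ^^ 2) H \<xi>\<bar> \<le> (y - x) * K2"
      using xy by (intro mult_left_mono K2(2)) auto
    ultimately show ?thesis using xy by (simp add: abs_mult mult.commute[of K2])
  qed
  have 3: "\<bar>H y - H x - (y - x) * D01 H u\<bar> \<le> K2 * (y - x)\<^sup>2" if xy: "0 \<le> x" "x \<le> u" "u \<le> y" "y \<le> 1" for x y u
  proof -
    have "x \<le> y" using xy by simp
    then obtain \<xi> where \<xi>: "\<xi> \<in> {x..y}" "H y - H x = (y - x) * D01 H \<xi>"
      using test_function_mvt[OF H xy(1) _ xy(4), of 0] by auto
    have "\<bar>D01 H \<xi> - D01 H u\<bar> \<le> K2 * \<bar>\<xi> - u\<bar>"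
      using lip[of \<xi> u] lip[of u \<xi>] \<xi>(1) xy by (cases "\<xi> \<le> u") auto
    also have "\<dots> \<le> K2 * (y - x)" using \<xi>(1) xy K2(1) by (intro mult_left_mono) auto
    finally have "(y - x) * \<bar>D01 H \<xi> - D01 H u\<bar> \<le> (y - x) * (K2 * (y - x))"
      using xy by (intro mult_left_mono) auto
    moreover have "H y - H x - (y - x) * D01 H u = (y - x) * (D01 H \<xi> - D01 H u)"
      by (simp add: \<xi>(2) right_diff_distrib)
    ultimately show ?thesis using xy by (simp add: abs_mult power2_eq_square mult_ac)
  qed
  show ?thesis using that[OF K1(1) K2(1) 1 2 3] .
qed

section \<open>Sums of powers\<close>

definition zeta_sum :: "real \<Rightarrow> real" where
  "zeta_sum s = (\<Sum>k. real (Suc k) powr - s)"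

lemma zeta_summable: "1 < s \<Longrightarrow> summable (\<lambda>k. real (Suc k) powr - s)"
  using summable_Suc_iff[of "\<lambda>k. real k powr - s"] by (simp add: summable_real_powr_iff)

lemma zeta_partial:
  assumes "1 < s" shows "(\<Sum>j=1..n. real j powr - s) \<le> zeta_sum s"
proof -
  have "(\<Sum>j=1..n. real j powr - s) = (\<Sum>k<n. real (Suc k) powr - s)"
    by (simp add: sum.atLeast1_atMost_eq)
  also have "\<dots> \<le> zeta_sum s"
    unfolding zeta_sum_def by (intro sum_le_suminf zeta_summable assms) auto
  finally show ?thesis .
qed

lemma zeta_sum_nonneg: "1 < s \<Longrightarrow> 0 \<le> zeta_sum s"
  using zeta_partial[of s 0] by simp

text \<open>Splitting the power \<open>r\<close> off each summand gives a decay rate for the tail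
  without comparing with integrals.\<close>

lemma zeta_tail:
  assumes "0 \<le> r" "1 < s - r"
  shows "0 \<le> zeta_sum s - (\<Sum>j=1..k. real j powr - s)"
    and "zeta_sum s - (\<Sum>j=1..k. real j powr - s) \<le> zeta_sum (s - r) * real (k + 1) powr - r"
proof -
  have s: "1 < s" using assms by simp
  show "0 \<le> zeta_sum s - (\<Sum>j=1..k. real j powr - s)" using zeta_partial[OF s] by simp
  have "zeta_sum s - (\<Sum>j=1..k. real j powr - s) = (\<Sum>i. real (Suc (i + k)) powr - s)"
    unfolding zeta_sum_def
    using suminf_split_initial_segment[OF zeta_summable[OF s], of k] by (simp add: sum.atLeast1_atMost_eq)
  also have "\<dots> \<le> (\<Sum>i. real (Suc (i + k)) powr - (s - r) * real (k + 1) powr - r)"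
  proof (rule suminf_le)
    fix i
    have "real (Suc (i + k)) powr - s = real (Suc (i + k)) powr - (s - r) * real (Suc (i + k)) powr - r"
      by (simp add: powr_add[symmetric])
    also have "\<dots> \<le> real (Suc (i + k)) powr - (s - r) * real (k + 1) powr - r"
      using assms(1) by (intro mult_left_mono powr_mono2') auto
    finally show "real (Suc (i + k)) powr - s \<le> real (Suc (i + k)) powr - (s - r) * real (k + 1) powr - r" .
    show "summable (\<lambda>i. real (Suc (i + k)) powr - s)"
      using zeta_summable[OF s] by (subst summable_iff_shift)
    show "summable (\<lambda>i. real (Suc (i + k)) powr - (s - r) * real (k + 1) powr - r)"
      using zeta_summable[OF assms(2)] by (intro summable_mult2) (subst summable_iff_shift)
  qed
  also have "\<dots> = (\<Sum>i. real (Suc (i + k)) powr - (s - r)) * real (k + 1) powr - r"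
    using zeta_summable[OF assms(2)] by (intro suminf_mult2[symmetric]) (subst summable_iff_shift)
  also have "(\<Sum>i. real (Suc (i + k)) powr - (s - r)) = zeta_sum (s - r) - (\<Sum>j=1..k. real j powr - (s - r))"
    unfolding zeta_sum_def
    using suminf_split_initial_segment[OF zeta_summable[OF assms(2)], of k] by (simp add: sum.atLeast1_atMost_eq)
  also have "\<dots> * real (k + 1) powr - r \<le> zeta_sum (s - r) * real (k + 1) powr - r"
    by (intro mult_right_mono) (auto intro: sum_nonneg)
  finally show "zeta_sum s - (\<Sum>j=1..k. real j powr - s) \<le> zeta_sum (s - r) * real (k + 1) powr - r" .
qed

text \<open>The same splitting in the opposite direction: a possibly divergent sum is made
  convergent at the price of a power of \<open>n\<close>.\<close>

lemma powr_sum_bound: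
  assumes "0 \<le> r" "1 < s + r"
  shows "(\<Sum>j=1..n. real j powr - s) \<le> zeta_sum (s + r) * real n powr r"
proof -
  have "(\<Sum>j=1..n. real j powr - s) \<le> (\<Sum>j=1..n. real j powr - (s + r) * real n powr r)"
  proof (rule sum_mono)
    fix j assume j: "j \<in> {1..n}"
    have "real j powr - s = real j powr - (s + r) * real j powr r" by (simp add: powr_add[symmetric])
    also have "\<dots> \<le> real j powr - (s + r) * real n powr r"
      using assms j by (intro mult_left_mono powr_mono2) auto
    finally show "real j powr - s \<le> real j powr - (s + r) * real n powr r" .
  qed
  also have "\<dots> = (\<Sum>j=1..n. real j powr - (s + r)) * real n powr r" by (simp add: sum_distrib_right)
  also have "\<dots> \<le> zeta_sum (s + r) * real n powr r"
    using assms by (intro mult_right_mono zeta_partial) auto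
  finally show ?thesis .
qed

lemma sum_inv_sqrt: "(\<Sum>k=1..l. real k powr - (1/2)) \<le> 2 * real l powr (1/2)"
proof (induction l)
  case (Suc l)
  have s: "x powr (1/2) = sqrt x" "x powr - (1/2) = 1 / sqrt x" if "0 \<le> x" for x
    using that by (simp_all add: powr_half_sqrt powr_minus_divide)
  have "2 * sqrt (real l) + 1 / sqrt (real (Suc l)) \<le> 2 * sqrt (real (Suc l))"
  proof -
    have "(2 * sqrt (real l) * sqrt (real (Suc l))) \<le> real l + real (Suc l)"
      using zero_le_power2[of "sqrt (real l) - sqrt (real (Suc l))"] by (simp add: power2_eq_square algebra_simps)
    then have le: "2 * sqrt (real l) * sqrt (real (Suc l)) + 1 \<le> 2 * sqrt (real (Suc l)) * sqrt (real (Suc l))"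
      by (simp add: mult.assoc)
    have *: "2 * a + 1 / t \<le> 2 * t" if "2 * a * t + 1 \<le> 2 * t * t" "0 < t" for a t :: real
    proof -
      have "2 * a + 1 / t = (2 * a * t + 1) / t" using that(2) by (simp add: field_simps)
      also have "\<dots> \<le> 2 * t * t / t" using that by (intro divide_right_mono) auto
      finally show ?thesis using that(2) by simp
    qed
    show ?thesis by (rule *[OF le]) simp
  qed
  then show ?case using Suc by (simp add: s)
qed simp

lemma mean_jump_eq:
  assumes "1 < \<gamma>" shows "mean_jump \<gamma> = zeta_sum \<gamma>"
proof -
  have "mean_jump \<gamma> = (\<Sum>\<^sub>\<infinity>y\<in>range (\<lambda>k. int (Suc k)). of_int y * p_rate \<gamma> y)"
    unfolding mean_jump_def
  proof (rule infsum_cong_neutral)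
    fix y assume y: "y \<in> UNIV - range (\<lambda>k. int (Suc k))"
    show "of_int y * p_rate \<gamma> y = 0"
    proof (rule ccontr)
      assume "of_int y * p_rate \<gamma> y \<noteq> 0"
      then have "y = int (Suc (nat (y - 1)))" by (auto simp: p_rate_def split: if_splits)
      with y show False by blast
    qed
  qed auto
  also have "\<dots> = (\<Sum>\<^sub>\<infinity>k\<in>UNIV. real (Suc k) powr - \<gamma>)"
  proof -
    have "(\<Sum>\<^sub>\<infinity>y\<in>range (\<lambda>k. int (Suc k)). of_int y * p_rate \<gamma> y) = (\<Sum>\<^sub>\<infinity>k\<in>UNIV. of_int (int (Suc k)) * p_rate \<gamma> (int (Suc k)))"
      by (subst infsum_reindex) (auto simp: inj_on_def o_def)
    also have "\<dots> = (\<Sum>\<^sub>\<infinity>k\<in>UNIV. real (Suc k) powr - \<gamma>)"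
    proof (rule infsum_cong)
      fix k :: nat
      have "real (Suc k) * real (Suc k) powr (- 1 - \<gamma>) = real (Suc k) powr 1 * real (Suc k) powr (- 1 - \<gamma>)" by simp
      also have "\<dots> = real (Suc k) powr - \<gamma>" by (simp only: powr_add[symmetric]) simp
      finally show "of_int (int (Suc k)) * p_rate \<gamma> (int (Suc k)) = real (Suc k) powr - \<gamma>"
        by (simp add: p_rate_def)
    qed
    finally show ?thesis .
  qed
  also have "\<dots> = zeta_sum \<gamma>"
    unfolding zeta_sum_def using zeta_summable[OF assms]
    by (intro infsumI norm_summable_imp_has_sum summable_sums) auto
  finally show ?thesis .
qed

text \<open>The increment of \<open>H\<close> contributes the distance divided by \<open>n\<close>;
  together with the normalisation this produces the critical exponent 3/2.\<close>

lemma pair_coeff_bound: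
  assumes xy: "x \<in> Sites n" "y \<in> Sites n" "x < y"
    and lip: "\<And>a b. 0 \<le> a \<Longrightarrow> a \<le> b \<Longrightarrow> b \<le> 1 \<Longrightarrow> \<bar>H b - H a\<bar> \<le> K1 * (b - a)"
  shows "\<bar>pair_coeff \<gamma> \<theta> n H x y\<bar> \<le> K1 * real n powr (\<theta> - 3/2) * of_int (y - x) powr - \<gamma>"
proof -
  let ?z = "of_int (y - x) :: real"
  have n: "0 < real n" and z: "0 < ?z" using xy by (auto simp: Sites_def)
  have "\<bar>H (of_int y / real n) - H (of_int x / real n)\<bar> \<le> K1 * (of_int y / real n - of_int x / real n)"
    using xy n by (intro lip) (auto simp: Sites_def field_simps)
  also have "\<dots> = K1 * ?z / real n" by (simp add: diff_divide_distrib[symmetric])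
  finally have b: "\<bar>H (of_int y / real n) - H (of_int x / real n)\<bar> \<le> K1 * ?z / real n" .
  have "\<bar>pair_coeff \<gamma> \<theta> n H x y\<bar> = (real n powr \<theta> / sqrt (real n)) * ?z powr (-1 - \<gamma>) * \<bar>H (of_int y / real n) - H (of_int x / real n)\<bar>"
    using xy(3) n by (simp add: pair_coeff_def p_rate_def abs_mult)
  also have "\<dots> \<le> (real n powr \<theta> / sqrt (real n)) * ?z powr (-1 - \<gamma>) * (K1 * ?z / real n)"
    using b n by (intro mult_left_mono) auto
  also have "\<dots> = K1 * (real n powr \<theta> / sqrt (real n) / real n) * (?z powr (-1 - \<gamma>) * ?z)" by simp
  also have "real n powr \<theta> / sqrt (real n) / real n = real n powr (\<theta> - 3/2)"
  proof -
    have "real n powr (\<theta> - 3/2) = real n powr \<theta> / real n powr (1/2 + 1)" by (simp add: powr_diff)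
    also have "real n powr (1/2 + 1) = sqrt (real n) * real n" using n by (simp only: powr_add powr_half_sqrt powr_one)
    finally show ?thesis by simp
  qed
  also have "?z powr (-1 - \<gamma>) * ?z = ?z powr - \<gamma>"
  proof -
    have "?z powr (-1 - \<gamma>) * ?z powr 1 = ?z powr - \<gamma>" by (simp only: powr_add[symmetric]) simp
    then show ?thesis using z by simp
  qed
  finally show ?thesis .
qed

text \<open>At the critical exponent the prefactor is exactly \<open>n\<close> and cancels the 1/n
  of the increment, so the coefficient has a limit at fixed distance.\<close>

lemma pair_coeff_taylor:
  assumes xy: "x \<in> Sites n" "y \<in> Sites n" "x < y" "x \<le> u" "u \<le> y"
    and taylor: "\<And>a b w. 0 \<le> a \<Longrightarrow> a \<le> w \<Longrightarrow> w \<le> b \<Longrightarrow> b \<le> 1 \<Longrightarrow> \<bar>H b - H a - (b - a) * D01 H w\<bar> \<le> K2 * (b - a)\<^sup>2"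
  shows "\<bar>pair_coeff \<gamma> (3/2) n H x y + of_int (y - x) powr - \<gamma> * D01 H (of_int u / real n)\<bar>
    \<le> K2 * of_int (y - x) powr (1 - \<gamma>) / real n"
proof -
  let ?z = "of_int (y - x) :: real" and ?v = "D01 H (of_int u / real n)"
  let ?D = "H (of_int y / real n) - H (of_int x / real n)"
  have n: "0 < real n" and z: "0 < ?z" using xy by (auto simp: Sites_def)
  have ba: "of_int y / real n - of_int x / real n = ?z / real n" by (simp add: diff_divide_distrib[symmetric])
  have b: "\<bar>?D - ?z / real n * ?v\<bar> \<le> K2 * (?z / real n)\<^sup>2"
    using taylor[of "of_int x / real n" "of_int u / real n" "of_int y / real n"] xy n
    by (simp add: ba Sites_def field_simps)
  have q: "real n powr (3/2) / sqrt (real n) = real n"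
  proof -
    have "real n powr (3/2) = real n powr (1 + 1/2)" by simp
    also have "\<dots> = real n * sqrt (real n)" using n by (simp only: powr_add powr_half_sqrt powr_one)
    finally show ?thesis using n by simp
  qed
  have zp: "?z powr (-1 - \<gamma>) * ?z = ?z powr - \<gamma>" "?z powr (-1 - \<gamma>) * ?z\<^sup>2 = ?z powr (1 - \<gamma>)"
  proof -
    have "?z powr (-1 - \<gamma>) * ?z powr 1 = ?z powr - \<gamma>" by (simp only: powr_add[symmetric]) simp
    then show "?z powr (-1 - \<gamma>) * ?z = ?z powr - \<gamma>" using z by simp
    have "?z powr (-1 - \<gamma>) * ?z powr 2 = ?z powr (1 - \<gamma>)" by (simp only: powr_add[symmetric]) simp
    then show "?z powr (-1 - \<gamma>) * ?z\<^sup>2 = ?z powr (1 - \<gamma>)" using z by simp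
  qed
  have "pair_coeff \<gamma> (3/2) n H x y + ?z powr - \<gamma> * ?v = - (real n * ?z powr (-1 - \<gamma>)) * (?D - ?z / real n * ?v)"
  proof -
    have gen: "- a * p * D + p * z * v = - (a * p) * (D - z / a * v)" if "0 < a" for a p D z v :: real
      using that by (simp add: field_simps)
    have "p_rate \<gamma> (y - x) = ?z powr (-1 - \<gamma>)" using xy(3) by (simp add: p_rate_def)
    then show ?thesis unfolding pair_coeff_def q zp(1)[symmetric] by (simp only: gen[OF n])
  qed
  then have "\<bar>pair_coeff \<gamma> (3/2) n H x y + ?z powr - \<gamma> * ?v\<bar> = (real n * ?z powr (-1 - \<gamma>)) * \<bar>?D - ?z / real n * ?v\<bar>"
    using n by (simp add: abs_mult)
  also have "\<dots> \<le> (real n * ?z powr (-1 - \<gamma>)) * (K2 * (?z / real n)\<^sup>2)"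
    using b n by (intro mult_left_mono) auto
  also have "\<dots> = K2 * (?z powr (-1 - \<gamma>) * ?z\<^sup>2) / real n"
    using n by (simp add: power2_eq_square)
  finally show ?thesis by (simp only: zp)
qed

section \<open>Bounds for far and near coefficients\<close>

lemma card_Sites_le: "real (card (Sites n)) \<le> real n"
  by (simp add: Sites_def)

lemma far_sum_bound:
  assumes l: "1 \<le> l" and \<gamma>: "0 < \<gamma>" and K: "0 \<le> K"
    and c: "\<And>x y. x \<in> Sites n \<Longrightarrow> y \<in> Sites n \<Longrightarrow> x < y \<Longrightarrow> \<bar>c x y\<bar> \<le> K * of_int (y - x) powr - \<gamma>"
  shows "(\<Sum>p\<in>far_pairs n l. (c (fst p) (snd p))\<^sup>2) \<le> (real n * (K * real l powr - \<gamma>))\<^sup>2"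
proof -
  have sub: "far_pairs n l \<subseteq> Sites n \<times> Sites n" by (auto simp: far_pairs_def)
  have "(\<Sum>p\<in>far_pairs n l. (c (fst p) (snd p))\<^sup>2) \<le> (\<Sum>p\<in>far_pairs n l. (K * real l powr - \<gamma>)\<^sup>2)"
  proof (rule sum_mono)
    fix p assume p: "p \<in> far_pairs n l"
    then have h: "fst p \<in> Sites n" "snd p \<in> Sites n" "fst p < snd p" "int l \<le> snd p - fst p"
      using l by (auto simp: far_pairs_def)
    have "real l \<le> of_int (snd p - fst p)" using h(4) by linarith
    then have "of_int (snd p - fst p) powr - \<gamma> \<le> real l powr - \<gamma>"
      using l \<gamma> by (intro powr_mono2') auto
    then have "\<bar>c (fst p) (snd p)\<bar> \<le> K * real l powr - \<gamma>"
      using c[OF h(1-3)] K by (meson mult_left_mono order.trans)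
    then show "(c (fst p) (snd p))\<^sup>2 \<le> (K * real l powr - \<gamma>)\<^sup>2"
      by (metis abs_ge_zero power2_abs power_mono)
  qed
  also have "\<dots> = real (card (far_pairs n l)) * (K * real l powr - \<gamma>)\<^sup>2" by simp
  also have "\<dots> \<le> (real n)\<^sup>2 * (K * real l powr - \<gamma>)\<^sup>2"
  proof (rule mult_right_mono)
    have "card (far_pairs n l) \<le> card (Sites n \<times> Sites n)" by (rule card_mono[OF _ sub]) simp
    also have "\<dots> \<le> n ^ 2" by (simp add: card_cartesian_product Sites_def power2_eq_square mult_mono)
    finally show "real (card (far_pairs n l)) \<le> (real n)\<^sup>2" by (metis of_nat_le_iff of_nat_power)
  qed simp
  finally show ?thesis by (simp add: power_mult_distrib)
qed

lemma near_coeff_bound: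
  assumes l: "1 \<le> l" "2 * l \<le> n" and x: "x \<in> Sites n" and j: "j \<in> {1..l - 1}" and K: "0 \<le> K"
    and c: "\<And>x y. x \<in> Sites n \<Longrightarrow> y \<in> Sites n \<Longrightarrow> x < y \<Longrightarrow> \<bar>c x y\<bar> \<le> K * of_int (y - x) powr - \<gamma>"
  shows "\<bar>near_coeff n l c x j\<bar> \<le> K * real j powr - \<gamma>"
proof -
  consider "x \<le> int n - int l - 1" | "int n - int l - 1 < x" "int n - int l \<le> x - int j" | "near_coeff n l c x j = 0"
    by (fastforce simp: near_coeff_def)
  then show ?thesis
  proof cases
    case 1
    then have "\<bar>c x (x + int j)\<bar> \<le> K * of_int ((x + int j) - x) powr - \<gamma>"
      using x j l by (intro c) (auto simp: Sites_def)
    then show ?thesis using 1 by (simp add: near_coeff_def)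
  next
    case 2
    then have "\<bar>c (x - int j) x\<bar> \<le> K * of_int (x - (x - int j)) powr - \<gamma>"
      using x j l by (intro c) (auto simp: Sites_def)
    then show ?thesis using 2 by (simp add: near_coeff_def)
  qed (simp add: K)
qed

text \<open>The number of pairs charged to \<open>x\<close>. It falls short of \<open>l - 1\<close>
  only in left-looking rows, which may not reach beyond the last \<open>l\<close> sites.\<close>

definition row_len :: "nat \<Rightarrow> nat \<Rightarrow> int \<Rightarrow> nat" where
  "row_len n l x = (if x \<le> int n - int l - 1 then l - 1 else nat (x - (int n - int l)))"

lemma near_coeff_taylor:
  assumes l: "1 \<le> l" "2 * l \<le> n" and x: "x \<in> Sites n" and j: "j \<in> {1..l - 1}" and K2: "0 \<le> K2"
    and taylor: "\<And>a b w. 0 \<le> a \<Longrightarrow> a \<le> w \<Longrightarrow> w \<le> b \<Longrightarrow> b \<le> 1 \<Longrightarrow> \<bar>H b - H a - (b - a) * D01 H w\<bar> \<le> K2 * (b - a)\<^sup>2"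
  shows "\<bar>near_coeff n l (pair_coeff \<gamma> (3/2) n H) x j
      + (if j \<le> row_len n l x then real j powr - \<gamma> else 0) * D01 H (of_int x / real n)\<bar> \<le> K2 / real n * real j powr (1 - \<gamma>)"
proof -
  consider "x \<le> int n - int l - 1" | "int n - int l - 1 < x" "int n - int l \<le> x - int j"
    | "int n - int l - 1 < x" "x - int j < int n - int l" by linarith
  then show ?thesis
  proof cases
    case 1
    have "\<bar>pair_coeff \<gamma> (3/2) n H x (x + int j) + of_int ((x + int j) - x) powr - \<gamma> * D01 H (of_int x / real n)\<bar>
      \<le> K2 * of_int ((x + int j) - x) powr (1 - \<gamma>) / real n"
      using x j l 1 by (intro pair_coeff_taylor taylor) (auto simp: Sites_def)
    then show ?thesis using 1 j by (simp add: near_coeff_def row_len_def)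
  next
    case 2
    have "\<bar>pair_coeff \<gamma> (3/2) n H (x - int j) x + of_int (x - (x - int j)) powr - \<gamma> * D01 H (of_int x / real n)\<bar>
      \<le> K2 * of_int (x - (x - int j)) powr (1 - \<gamma>) / real n"
      using x j l 2 by (intro pair_coeff_taylor taylor) (auto simp: Sites_def)
    moreover have "j \<le> row_len n l x" using 2 by (simp add: row_len_def)
    ultimately show ?thesis using 2 by (simp add: near_coeff_def)
  next
    case 3
    then have "\<not> j \<le> row_len n l x" by (simp add: row_len_def)
    then show ?thesis using 3 K2 by (simp add: near_coeff_def)
  qed
qed

section \<open>Block lengths and the Riemann sum of the squared derivative\<close>

lemma block_len_ratio:
  assumes "0 < \<epsilon>"
  shows "(\<lambda>n. real (block_len \<epsilon> n) / real n) \<longlonglongrightarrow> \<epsilon>"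
    and "filterlim (\<lambda>n. real (block_len \<epsilon> n)) at_top sequentially"
    and "(\<lambda>n. real n / real (block_len \<epsilon> n)) \<longlonglongrightarrow> 1 / \<epsilon>"
proof -
  have b: "\<epsilon> * real n - 1 \<le> real (block_len \<epsilon> n)" "real (block_len \<epsilon> n) \<le> \<epsilon> * real n" for n
  proof -
    have "0 \<le> \<epsilon> * real n" using assms by simp
    then have "real (block_len \<epsilon> n) = of_int \<lfloor>\<epsilon> * real n\<rfloor>" unfolding block_len_def by (simp add: of_nat_nat)
    then show "\<epsilon> * real n - 1 \<le> real (block_len \<epsilon> n)" "real (block_len \<epsilon> n) \<le> \<epsilon> * real n" by linarith+
  qed
  have "(\<lambda>n. \<epsilon> - inverse (real n)) \<longlonglongrightarrow> \<epsilon> - 0" by (intro tendsto_intros lim_inverse_n)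
  then have lim: "(\<lambda>n. \<epsilon> - inverse (real n)) \<longlonglongrightarrow> \<epsilon>" by simp
  show r: "(\<lambda>n. real (block_len \<epsilon> n) / real n) \<longlonglongrightarrow> \<epsilon>"
  proof (rule tendsto_sandwich[OF _ _ lim tendsto_const])
    show "\<forall>\<^sub>F n in sequentially. \<epsilon> - inverse (real n) \<le> real (block_len \<epsilon> n) / real n"
    proof (rule eventually_sequentiallyI[of 1])
      fix n :: nat assume "1 \<le> n"
      then have "\<epsilon> - inverse (real n) = (\<epsilon> * real n - 1) / real n" by (simp add: field_simps)
      also have "\<dots> \<le> real (block_len \<epsilon> n) / real n" by (intro divide_right_mono b) simp
      finally show "\<epsilon> - inverse (real n) \<le> real (block_len \<epsilon> n) / real n" .
    qed
    show "\<forall>\<^sub>F n in sequentially. real (block_len \<epsilon> n) / real n \<le> \<epsilon>"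
    proof (rule eventually_sequentiallyI[of 1])
      fix n :: nat assume "1 \<le> n"
      then show "real (block_len \<epsilon> n) / real n \<le> \<epsilon>" using b(2)[of n] by (simp add: field_simps)
    qed
  qed
  have "filterlim (\<lambda>n. \<epsilon> * real n) at_top sequentially"
    by (rule filterlim_tendsto_pos_mult_at_top[OF tendsto_const assms filterlim_real_sequentially])
  then have "filterlim (\<lambda>n. - 1 + \<epsilon> * real n) at_top sequentially"
    by (rule filterlim_tendsto_add_at_top[OF tendsto_const])
  then show "filterlim (\<lambda>n. real (block_len \<epsilon> n)) at_top sequentially"
    by (rule filterlim_at_top_mono) (use b in \<open>auto simp: algebra_simps\<close>)
  have "(\<lambda>n. inverse (real (block_len \<epsilon> n) / real n)) \<longlonglongrightarrow> inverse \<epsilon>"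
    using assms by (intro tendsto_inverse r) auto
  then show "(\<lambda>n. real n / real (block_len \<epsilon> n)) \<longlonglongrightarrow> 1 / \<epsilon>" by (simp add: divide_inverse mult.commute)
qed

lemma block_len_le: "\<epsilon> \<le> 1/2 \<Longrightarrow> 2 * block_len \<epsilon> n \<le> n"
proof -
  assume "\<epsilon> \<le> 1/2"
  then have "\<epsilon> * real n \<le> 1/2 * real n" by (intro mult_right_mono) auto
  then have "2 * \<lfloor>\<epsilon> * real n\<rfloor> \<le> int n" by linarith
  then show ?thesis unfolding block_len_def by linarith
qed

lemma block_len_eventually: "0 < \<epsilon> \<Longrightarrow> \<forall>\<^sub>F n in sequentially. 2 \<le> block_len \<epsilon> n"
  using filterlim_at_top[THEN iffD1, OF block_len_ratio(2), rule_format, of \<epsilon> 2] by (auto elim: eventually_mono)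

lemma riemann_test_function:
  assumes H: "H \<in> test_functions"
  shows "(\<lambda>n. \<Sum>k=1..n. 1 / real n * (D01 H (real k / real n))\<^sup>2) \<longlonglongrightarrow> L2_norm_sq (D01 H)"
proof -
  \<comment> \<open>Freezing the function beyond 1 makes it bounded and right-continuous on the
    whole half-line, as \<open>right_riemann_sums\<close> requires.\<close>
  define g where "g s = (D01 H (min s 1))\<^sup>2" for s :: real
  obtain K where K: "\<And>x. x \<in> {0..1} \<Longrightarrow> \<bar>(D01 ^^ 1) H x\<bar> \<le> K" using test_function_bounded[OF H] by metis
  have "continuous_on {0..1} (D01 H)" using test_function_continuous[OF H, of 1] by simp
  then have cont: "continuous_on {0..} g"
    unfolding g_def by (intro continuous_intros continuous_on_compose2[of "{0..1}" "D01 H" "{0..}" "\<lambda>s. min s 1"]) auto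
  have rc: "(g \<longlongrightarrow> g t) (at_right t)" if "0 \<le> t" for t
  proof -
    have "(g \<longlongrightarrow> g t) (at t within {0..})" using cont that by (simp add: continuous_on_def)
    then show ?thesis by (rule tendsto_within_subset) (use that in auto)
  qed
  have "\<bar>g t\<bar> \<le> K\<^sup>2" if "0 \<le> t" for t
    using K[of "min t 1"] that unfolding g_def by (simp add: abs_le_square_iff[symmetric] abs_le_iff) 
  from right_riemann_sums(1)[of g "K\<^sup>2" 1 1, OF rc this]
  have "(\<lambda>n. \<Sum>k=1..n. 1 / real n * g (real k * (1 / real n))) \<longlonglongrightarrow> integral {0..1} g" by simp
  moreover have "(\<Sum>k=1..n. 1 / real n * g (real k * (1 / real n))) = (\<Sum>k=1..n. 1 / real n * (D01 H (real k / real n))\<^sup>2)" for n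
    by (intro sum.cong) (auto simp: g_def min_def field_simps)
  moreover have "integral {0..1} g = L2_norm_sq (D01 H)"
    unfolding L2_norm_sq_def by (intro integral_cong) (auto simp: g_def min_def)
  ultimately show ?thesis by simp
qed

section \<open>The two regimes\<close>

lemma inverse_pred_le: "2 \<le> l \<Longrightarrow> 1 / real (l - 1) \<le> 2 / real l"
  by (simp add: of_nat_diff field_simps)

text \<open>With \<open>\<kappa> = 0\<close> the block field drops out. No masses cancel, so the
  uniform rows and the transport are both estimated by the absolute row mass, at most
  \<open>Q * S\<close>.\<close>

lemma A4_decomp:
  fixes \<theta> \<gamma> K1 :: real and H :: "real \<Rightarrow> real"
  assumes l: "2 \<le> l" "2 * l \<le> n" and \<gamma>: "0 < \<gamma>" and K1: "0 \<le> K1"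
    and lip: "\<And>a b. 0 \<le> a \<Longrightarrow> a \<le> b \<Longrightarrow> b \<le> 1 \<Longrightarrow> \<bar>H b - H a\<bar> \<le> K1 * (b - a)"
  defines "Q \<equiv> K1 * real n powr (\<theta> - 3/2)" and "S \<equiv> \<Sum>j=1..n. real j powr - \<gamma>"
  shows "decomp n (A4 \<gamma> \<theta> n H) (1/8 * (real n * (Q * real l powr - \<gamma>))\<^sup>2 + 2 * (real n / real l) * (Q * S)\<^sup>2)
    (16 * (real n)\<^sup>2 * (Q * S)\<^sup>2)"
proof -
  let ?c = "pair_coeff \<gamma> \<theta> n H"
  let ?d = "\<lambda>x j. near_coeff n l ?c x j + 0 * D01 H (of_int x / real n) / real l"
  have Q: "0 \<le> Q" using K1 by (simp add: Q_def)
  have c: "\<bar>?c x y\<bar> \<le> Q * of_int (y - x) powr - \<gamma>" if "x \<in> Sites n" "y \<in> Sites n" "x < y" for x y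
    unfolding Q_def by (rule pair_coeff_bound[OF that lip])
  have S0: "0 \<le> S" unfolding S_def by (intro sum_nonneg) auto
  have abs_row: "(\<Sum>j=1..l - 1. \<bar>?d x j\<bar>) \<le> Q * S" if x: "x \<in> Sites n" for x
  proof -
    have "(\<Sum>j=1..l - 1. \<bar>?d x j\<bar>) \<le> (\<Sum>j=1..l - 1. Q * real j powr - \<gamma>)"
      using near_coeff_bound[OF _ l(2) x _ Q c] l by (intro sum_mono) simp
    also have "\<dots> \<le> (\<Sum>j=1..n. Q * real j powr - \<gamma>)" using l Q by (intro sum_mono2) auto
    finally show ?thesis by (simp add: S_def sum_distrib_left)
  qed
  have row: "(\<Sum>j=1..l - 1. ?d x j)\<^sup>2 \<le> (Q * S)\<^sup>2" if x: "x \<in> Sites n" for x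
  proof -
    have "\<bar>\<Sum>j=1..l - 1. ?d x j\<bar> \<le> Q * S" using abs_row[OF x] by (intro order.trans[OF sum_abs])
    then show ?thesis using Q S0 by (intro abs_le_square_iff[THEN iffD1]) simp
  qed
  have abs_row2: "(\<Sum>j=1..l - 1. \<bar>?d x j\<bar>)\<^sup>2 \<le> (Q * S)\<^sup>2" if x: "x \<in> Sites n" for x
    using abs_row[OF x] by (intro power_mono sum_nonneg) auto
  have sites: "(\<Sum>x\<in>Sites n. f x) \<le> real n * (Q * S)\<^sup>2" if "\<And>x. x \<in> Sites n \<Longrightarrow> f x \<le> (Q * S)\<^sup>2" for f
  proof -
    have "(\<Sum>x\<in>Sites n. f x) \<le> real (card (Sites n)) * (Q * S)\<^sup>2" using that by (intro sum_bounded_above) auto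
    also have "\<dots> \<le> real n * (Q * S)\<^sup>2" by (intro mult_right_mono card_Sites_le) auto
    finally show ?thesis .
  qed
  show ?thesis
  proof (rule decomp_cong[OF decomp_pair_block[OF l, where c="?c" and \<kappa>=0 and H=H]])
    show "A4 \<gamma> \<theta> n H \<eta> = pair_field n ?c \<eta> + 0 * block_field n l H \<eta>" for \<eta>
      by (simp add: A4_eq_pair_field)
    have "(\<Sum>p\<in>far_pairs n l. (?c (fst p) (snd p))\<^sup>2) \<le> (real n * (Q * real l powr - \<gamma>))\<^sup>2"
      using l by (intro far_sum_bound \<gamma> Q c) auto
    moreover have "(\<Sum>x\<in>Sites n. (\<Sum>j=1..l - 1. ?d x j)\<^sup>2) / real (l - 1) \<le> 2 * (real n / real l) * (Q * S)\<^sup>2"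
    proof -
      have "(\<Sum>x\<in>Sites n. (\<Sum>j=1..l - 1. ?d x j)\<^sup>2) * (1 / real (l - 1)) \<le> (real n * (Q * S)\<^sup>2) * (2 / real l)"
        by (intro mult_mono sites row inverse_pred_le l) auto
      then show ?thesis by (simp add: mult_ac)
    qed
    ultimately show "1/8 * (\<Sum>p\<in>far_pairs n l. (?c (fst p) (snd p))\<^sup>2) + (\<Sum>x\<in>Sites n. (\<Sum>j=1..l - 1. ?d x j)\<^sup>2) / real (l - 1)
      \<le> 1/8 * (real n * (Q * real l powr - \<gamma>))\<^sup>2 + 2 * (real n / real l) * (Q * S)\<^sup>2"
      by (intro add_mono mult_left_mono) auto
    have "16 * real l * (\<Sum>x\<in>Sites n. (\<Sum>j=1..l - 1. \<bar>?d x j\<bar>)\<^sup>2) \<le> 16 * real n * (real n * (Q * S)\<^sup>2)"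
      using l by (intro mult_mono sites abs_row2) (auto intro!: sum_nonneg)
    then show "16 * real l * (\<Sum>x\<in>Sites n. (\<Sum>j=1..l - 1. \<bar>?d x j\<bar>)\<^sup>2)
      + 2 * real l * 0\<^sup>2 * (\<Sum>x\<in>Sites n. (D01 H (of_int x / real n))\<^sup>2) \<le> 16 * (real n)\<^sup>2 * (Q * S)\<^sup>2"
      by (simp add: power2_eq_square mult_ac)
  qed
qed

text \<open>With \<open>\<kappa> = m\<close> the mass of a full row is small: up to Taylor errors
  and a term of order 1/l, it is the derivative of \<open>H\<close> times a tail of the series for
  \<open>m\<close>. Short rows near the right end keep a larger mass, but there are few of them. The
  transport cost does not cancel; it keeps the squared derivative, whose sum \<open>V\<close>
  becomes the norm in the limit. Its constants are 130 = 16 * 8 + 2 and 32 = 16 * 2.\<close>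

lemma A4_remainder_decomp:
  fixes H :: "real \<Rightarrow> real"
  assumes l: "2 \<le> l" "2 * l \<le> n" and \<gamma>: "3/2 < \<gamma>" and K1: "0 \<le> K1" and K2: "0 \<le> K2"
    and deriv: "\<And>x. x \<in> {0..1} \<Longrightarrow> \<bar>D01 H x\<bar> \<le> K1"
    and lip: "\<And>a b. 0 \<le> a \<Longrightarrow> a \<le> b \<Longrightarrow> b \<le> 1 \<Longrightarrow> \<bar>H b - H a\<bar> \<le> K1 * (b - a)"
    and taylor: "\<And>a b w. 0 \<le> a \<Longrightarrow> a \<le> w \<Longrightarrow> w \<le> b \<Longrightarrow> b \<le> 1 \<Longrightarrow> \<bar>H b - H a - (b - a) * D01 H w\<bar> \<le> K2 * (b - a)\<^sup>2"
  defines "m \<equiv> zeta_sum \<gamma>" and "e \<equiv> K2 * zeta_sum (\<gamma> - 1/2) * real n powr - (1/2)" and "Z \<equiv> zeta_sum (\<gamma> - 1/4)"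
    and "V \<equiv> \<Sum>k=1..n. 1 / real n * (D01 H (real k / real n))\<^sup>2"
  shows "decomp n (\<lambda>\<eta>. A4 \<gamma> (3/2) n H \<eta> + m * block_field n l H \<eta>)
    (1/8 * (real n * (K1 * real l powr - \<gamma>))\<^sup>2
      + (6 * (K1 * Z)\<^sup>2 * (real n / real l * real l powr - (1/2) + 2 * real l powr - (1/2))
      + real n / real l * (6 * (K1 * m)\<^sup>2 * (1 / real l)\<^sup>2 + 6 * e\<^sup>2)))
    (real l * real n * (130 * m\<^sup>2 * V + 32 * e\<^sup>2))"
proof -
  let ?c = "pair_coeff \<gamma> (3/2) n H"
  let ?v = "\<lambda>x::int. D01 H (of_int x / real n)"
  let ?d = "\<lambda>x j. near_coeff n l ?c x j + m * ?v x / real l"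
  let ?a = "row_len n l"
  have n: "0 < real n" "l \<le> n" and l0: "0 < real l" using l by auto
  have m0: "0 \<le> m" and Z0: "0 \<le> Z" and e0: "0 \<le> e"
    using \<gamma> K2 by (auto simp: m_def Z_def e_def intro!: zeta_sum_nonneg mult_nonneg_nonneg)
  have v1: "\<bar>?v x\<bar> \<le> K1" if "x \<in> Sites n" for x
    using that n by (intro deriv) (auto simp: Sites_def)
  \<comment> \<open>Total Taylor error of a row. The sum of \<open>j powr (1 - \<gamma>)\<close> may
    diverge, but \<gamma> > 3/2 keeps it below order \<open>n powr (1/2)\<close>.\<close>
  have err: "(\<Sum>j=1..l - 1. K2 / real n * real j powr (1 - \<gamma>)) \<le> e"
  proof -
    have "(\<Sum>j=1..l - 1. K2 / real n * real j powr (1 - \<gamma>)) \<le> (\<Sum>j=1..n. K2 / real n * real j powr (1 - \<gamma>))"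
      using l K2 by (intro sum_mono2) auto
    also have "\<dots> = K2 / real n * (\<Sum>j=1..n. real j powr - (\<gamma> - 1))" by (simp add: sum_distrib_left)
    also have "\<dots> \<le> K2 / real n * (zeta_sum (\<gamma> - 1 + 1/2) * real n powr (1/2))"
      using K2 \<gamma> by (intro mult_left_mono powr_sum_bound) auto
    also have "\<dots> = K2 * zeta_sum (\<gamma> - 1/2) * (real n powr (1/2) / real n)" by simp
    also have "real n powr (1/2) / real n = real n powr - (1/2)"
    proof -
      have "real n powr - (1/2) = real n powr (1/2 - 1)" by simp
      also have "\<dots> = real n powr (1/2) / real n powr 1" by (rule powr_diff)
      finally show ?thesis using n by simp
    qed
    finally show ?thesis by (simp add: e_def)
  qed
  have a_le: "?a x \<le> l - 1" if "x \<in> Sites n" for x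
    using that l by (auto simp: row_len_def Sites_def)
  let ?\<sigma> = "\<lambda>x. \<Sum>j=1..?a x. real j powr - \<gamma>"
  have part: "(\<Sum>j=1..l - 1. if j \<le> ?a x then real j powr - \<gamma> else 0) = ?\<sigma> x" if "x \<in> Sites n" for x
    using a_le[OF that] by (intro sum.mono_neutral_cong_right) auto
  \<comment> \<open>The exponent 1/4 leaves \<gamma> - 1/4 > 1; squared it becomes 1/2, still
    summable over the short rows with total of order \<open>l powr (1/2)\<close>.\<close>
  have \<sigma>: "0 \<le> ?\<sigma> x" "?\<sigma> x \<le> m" "m - ?\<sigma> x \<le> Z * real (?a x + 1) powr - (1/4)" for x
    using zeta_tail[of "1/4" \<gamma> "?a x"] \<gamma> by (auto simp: m_def Z_def intro: sum_nonneg)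
  have near: "\<bar>near_coeff n l ?c x j + (if j \<le> ?a x then real j powr - \<gamma> else 0) * ?v x\<bar> \<le> K2 / real n * real j powr (1 - \<gamma>)"
    if "x \<in> Sites n" "j \<in> {1..l - 1}" for x j
    using l by (intro near_coeff_taylor that K2 taylor) auto
  \<comment> \<open>The near coefficients and the compensating uniform row each have absolute mass
    at most \<open>m\<close> times the derivative. That derivative is not replaced by its bound
    \<open>K1\<close>, since its square must survive to the limit.\<close>
  have abs_row: "(\<Sum>j=1..l - 1. \<bar>?d x j\<bar>)\<^sup>2 \<le> 8 * m\<^sup>2 * (?v x)\<^sup>2 + 2 * e\<^sup>2" if x: "x \<in> Sites n" for x
  proof -
    have "(\<Sum>j=1..l - 1. \<bar>?d x j\<bar>) \<le> (\<Sum>j=1..l - 1. K2 / real n * real j powr (1 - \<gamma>)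
        + (if j \<le> ?a x then real j powr - \<gamma> else 0) * \<bar>?v x\<bar> + m * \<bar>?v x\<bar> / real l)"
    proof (rule sum_mono)
      fix j assume j: "j \<in> {1..l - 1}"
      let ?b = "if j \<le> ?a x then real j powr - \<gamma> else 0"
      have b: "\<bar>?b * ?v x\<bar> = ?b * \<bar>?v x\<bar>" "\<bar>m * ?v x / real l\<bar> = m * \<bar>?v x\<bar> / real l"
        using m0 by (simp_all add: abs_mult)
      have tri: "\<bar>p + q\<bar> \<le> E + b + c" if "\<bar>p + w\<bar> \<le> E" "\<bar>w\<bar> = b" "\<bar>q\<bar> = c" for p q w E b c :: real
        using that by linarith
      show "\<bar>?d x j\<bar> \<le> K2 / real n * real j powr (1 - \<gamma>) + ?b * \<bar>?v x\<bar> + m * \<bar>?v x\<bar> / real l"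
        by (rule tri[OF near[OF x j] b])
    qed
    also have "\<dots> = (\<Sum>j=1..l - 1. K2 / real n * real j powr (1 - \<gamma>)) + ?\<sigma> x * \<bar>?v x\<bar> + real (l - 1) * (m * \<bar>?v x\<bar> / real l)"
      by (simp add: sum.distrib sum_distrib_right[symmetric] part[OF x, simplified])
    also have "\<dots> \<le> e + m * \<bar>?v x\<bar> + m * \<bar>?v x\<bar>"
    proof (intro add_mono err mult_right_mono \<sigma>)
      have "real (l - 1) / real l * (m * \<bar>?v x\<bar>) \<le> 1 * (m * \<bar>?v x\<bar>)"
        using l0 m0 by (intro mult_right_mono) auto
      then show "real (l - 1) * (m * \<bar>?v x\<bar> / real l) \<le> m * \<bar>?v x\<bar>" by simp
    qed simp
    finally have "(\<Sum>j=1..l - 1. \<bar>?d x j\<bar>) \<le> 2 * m * \<bar>?v x\<bar> + e" by simp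
    then have "(\<Sum>j=1..l - 1. \<bar>?d x j\<bar>)\<^sup>2 \<le> (2 * m * \<bar>?v x\<bar> + e)\<^sup>2"
      by (intro power_mono sum_nonneg) auto
    also have "\<dots> \<le> 2 * (2 * m * \<bar>?v x\<bar>)\<^sup>2 + 2 * e\<^sup>2" by (rule sq_add_le)
    finally show ?thesis by (simp add: power_mult_distrib)
  qed
  have row: "(\<Sum>j=1..l - 1. ?d x j)\<^sup>2 \<le> 3 * (K1 * Z)\<^sup>2 * real (?a x + 1) powr - (1/2) + (3 * (K1 * m)\<^sup>2 * (1 / real l)\<^sup>2 + 3 * e\<^sup>2)"
    if x: "x \<in> Sites n" for x
  proof -
    have "(\<Sum>j=1..l - 1. ?d x j) = (\<Sum>j=1..l - 1. near_coeff n l ?c x j + (if j \<le> ?a x then real j powr - \<gamma> else 0) * ?v x)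
        - ?\<sigma> x * ?v x + real (l - 1) * (m * ?v x / real l)"
      by (simp add: sum.distrib sum_distrib_right[symmetric] part[OF x, simplified])
    also have "\<dots> = (\<Sum>j=1..l - 1. near_coeff n l ?c x j + (if j \<le> ?a x then real j powr - \<gamma> else 0) * ?v x)
        + ?v x * (m - ?\<sigma> x) - ?v x * (m / real l)"
      using l0 l by (simp add: of_nat_diff field_simps)
    finally have eq: "(\<Sum>j=1..l - 1. ?d x j) = (\<Sum>j=1..l - 1. near_coeff n l ?c x j + (if j \<le> ?a x then real j powr - \<gamma> else 0) * ?v x)
        + ?v x * (m - ?\<sigma> x) - ?v x * (m / real l)" .
    have b1: "\<bar>\<Sum>j=1..l - 1. near_coeff n l ?c x j + (if j \<le> ?a x then real j powr - \<gamma> else 0) * ?v x\<bar> \<le> e"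
      by (rule order.trans[OF sum_abs order.trans[OF sum_mono err]]) (rule near[OF x])
    have b2: "\<bar>?v x * (m - ?\<sigma> x)\<bar> \<le> K1 * (Z * real (?a x + 1) powr - (1/4))"
      unfolding abs_mult using v1[OF x] \<sigma>[of x] by (intro mult_mono) auto
    have b3: "\<bar>?v x * (m / real l)\<bar> \<le> K1 * (m / real l)"
      unfolding abs_mult using v1[OF x] m0 K1 by (intro mult_mono) auto
    have "\<bar>\<Sum>j=1..l - 1. ?d x j\<bar> \<le> K1 * (Z * real (?a x + 1) powr - (1/4)) + K1 * (m / real l) + e"
      unfolding eq using b1 b2 b3 by linarith
    then have "(\<Sum>j=1..l - 1. ?d x j)\<^sup>2 \<le> (K1 * (Z * real (?a x + 1) powr - (1/4)) + K1 * (m / real l) + e)\<^sup>2"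
      using K1 Z0 m0 e0 by (intro abs_le_square_iff[THEN iffD1]) simp
    also have "\<dots> \<le> 3 * (K1 * (Z * real (?a x + 1) powr - (1/4)))\<^sup>2 + 3 * (K1 * (m / real l))\<^sup>2 + 3 * e\<^sup>2"
    proof -
      have "(a + b + c)\<^sup>2 \<le> 3 * a\<^sup>2 + 3 * b\<^sup>2 + 3 * c\<^sup>2" for a b c :: real
        using zero_le_power2[of "a - b"] zero_le_power2[of "b - c"] zero_le_power2[of "a - c"]
        by (simp add: power2_eq_square algebra_simps)
      then show ?thesis by blast
    qed
    also have "(real (?a x + 1) powr - (1/4))\<^sup>2 = real (?a x + 1) powr - (1/2)"
      by (simp add: power2_eq_square powr_add[symmetric])
    then have "(K1 * (Z * real (?a x + 1) powr - (1/4)))\<^sup>2 = (K1 * Z)\<^sup>2 * real (?a x + 1) powr - (1/2)"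
      by (simp only: power_mult_distrib mult.assoc)
    finally show ?thesis by (simp add: power_mult_distrib power_divide)
  qed
  \<comment> \<open>Left-looking rows have all lengths from 0 to \<open>l - 1\<close>, each once;
    their sum is of order \<open>l powr (1/2)\<close> and is negligible after division by
    \<open>l\<close>.\<close>
  have len_sum: "(\<Sum>x\<in>Sites n. real (?a x + 1) powr - (1/2)) \<le> real n * real l powr - (1/2) + 2 * real l powr (1/2)"
  proof -
    have "(\<Sum>x\<in>Sites n. real (?a x + 1) powr - (1/2))
      = (\<Sum>x\<in>right_rows n l. real (?a x + 1) powr - (1/2)) + (\<Sum>x\<in>left_rows n l. real (?a x + 1) powr - (1/2))"
      using l rows_Un[of l n] sum.union_disjoint[OF finite_rows rows_disjoint[of n l]] by simp
    also have "(\<Sum>x\<in>right_rows n l. real (?a x + 1) powr - (1/2)) = (\<Sum>x\<in>right_rows n l. real l powr - (1/2))"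
      using l by (intro sum.cong) (auto simp: right_rows_def row_len_def of_nat_diff)
    also have "\<dots> \<le> real n * real l powr - (1/2)"
      by (simp add: right_rows_def mult_right_mono)
    also have "(\<Sum>x\<in>left_rows n l. real (?a x + 1) powr - (1/2)) = (\<Sum>k=1..l. real k powr - (1/2))"
      by (rule sum.reindex_bij_witness[where i="\<lambda>k. int n - int l + int k - 1" and j="\<lambda>x. ?a x + 1"])
        (use l in \<open>auto simp: left_rows_def row_len_def\<close>)
    also have "\<dots> \<le> 2 * real l powr (1/2)" by (rule sum_inv_sqrt)
    finally show ?thesis by simp
  qed
  have V: "(\<Sum>x\<in>Sites n. (?v x)\<^sup>2) \<le> real n * V"
  proof -
    have "(\<Sum>x\<in>Sites n. (?v x)\<^sup>2) = (\<Sum>k\<in>{1..n - 1}. (D01 H (real k / real n))\<^sup>2)"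
      by (rule sum.reindex_bij_witness[where i=int and j=nat]) (auto simp: Sites_def)
    also have "\<dots> \<le> (\<Sum>k=1..n. (D01 H (real k / real n))\<^sup>2)" by (intro sum_mono2) auto
    also have "\<dots> = real n * V" using n by (simp add: V_def sum_divide_distrib[symmetric])
    finally show ?thesis .
  qed
  have V0: "0 \<le> V" unfolding V_def by (intro sum_nonneg) auto
  show ?thesis
  proof (rule decomp_cong[OF decomp_pair_block[OF l, where c="?c" and \<kappa>=m and H=H]])
    show "A4 \<gamma> (3/2) n H \<eta> + m * block_field n l H \<eta> = pair_field n ?c \<eta> + m * block_field n l H \<eta>" for \<eta>
      by (simp add: A4_eq_pair_field)
    have far: "(\<Sum>p\<in>far_pairs n l. (?c (fst p) (snd p))\<^sup>2) \<le> (real n * (K1 * real l powr - \<gamma>))\<^sup>2"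
    proof (rule far_sum_bound)
      show "\<bar>?c x y\<bar> \<le> K1 * of_int (y - x) powr - \<gamma>" if "x \<in> Sites n" "y \<in> Sites n" "x < y" for x y
        using pair_coeff_bound[OF that lip, of \<gamma> "3/2"] n by simp
    qed (use l \<gamma> K1 in auto)
    have "(\<Sum>x\<in>Sites n. (\<Sum>j=1..l - 1. ?d x j)\<^sup>2) \<le> (\<Sum>x\<in>Sites n. 3 * (K1 * Z)\<^sup>2 * real (?a x + 1) powr - (1/2) + (3 * (K1 * m)\<^sup>2 * (1 / real l)\<^sup>2 + 3 * e\<^sup>2))"
      by (intro sum_mono row)
    also have "\<dots> = 3 * (K1 * Z)\<^sup>2 * (\<Sum>x\<in>Sites n. real (?a x + 1) powr - (1/2)) + real (card (Sites n)) * (3 * (K1 * m)\<^sup>2 * (1 / real l)\<^sup>2 + 3 * e\<^sup>2)"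
      by (simp add: sum.distrib sum_distrib_left)
    also have "\<dots> \<le> 3 * (K1 * Z)\<^sup>2 * (real n * real l powr - (1/2) + 2 * real l powr (1/2)) + real n * (3 * (K1 * m)\<^sup>2 * (1 / real l)\<^sup>2 + 3 * e\<^sup>2)"
      by (intro add_mono mult_left_mono mult_right_mono len_sum card_Sites_le) auto
    finally have "(\<Sum>x\<in>Sites n. (\<Sum>j=1..l - 1. ?d x j)\<^sup>2) * (1 / real (l - 1))
      \<le> (3 * (K1 * Z)\<^sup>2 * (real n * real l powr - (1/2) + 2 * real l powr (1/2)) + real n * (3 * (K1 * m)\<^sup>2 * (1 / real l)\<^sup>2 + 3 * e\<^sup>2)) * (2 / real l)"
      by (intro mult_mono inverse_pred_le l add_nonneg_nonneg mult_nonneg_nonneg) auto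
    also have "\<dots> = 6 * (K1 * Z)\<^sup>2 * (real n / real l * real l powr - (1/2) + 2 * (real l powr (1/2) / real l))
      + real n / real l * (6 * (K1 * m)\<^sup>2 * (1 / real l)\<^sup>2 + 6 * e\<^sup>2)"
      using l0 by (simp add: field_simps)
    also have "real l powr (1/2) / real l = real l powr - (1/2)"
    proof -
      have "real l powr - (1/2) = real l powr (1/2 - 1)" by simp
      also have "\<dots> = real l powr (1/2) / real l powr 1" by (rule powr_diff)
      finally show ?thesis using l0 by simp
    qed
    finally show "1/8 * (\<Sum>p\<in>far_pairs n l. (?c (fst p) (snd p))\<^sup>2) + (\<Sum>x\<in>Sites n. (\<Sum>j=1..l - 1. ?d x j)\<^sup>2) / real (l - 1)
      \<le> 1/8 * (real n * (K1 * real l powr - \<gamma>))\<^sup>2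
      + (6 * (K1 * Z)\<^sup>2 * (real n / real l * real l powr - (1/2) + 2 * real l powr - (1/2))
      + real n / real l * (6 * (K1 * m)\<^sup>2 * (1 / real l)\<^sup>2 + 6 * e\<^sup>2))"
      using far by (intro add_mono mult_left_mono) (simp_all only: times_divide_eq_right mult_1_right)
    have "(\<Sum>x\<in>Sites n. (\<Sum>j=1..l - 1. \<bar>?d x j\<bar>)\<^sup>2) \<le> (\<Sum>x\<in>Sites n. 8 * m\<^sup>2 * (?v x)\<^sup>2 + 2 * e\<^sup>2)"
      by (intro sum_mono abs_row)
    also have "\<dots> = 8 * m\<^sup>2 * (\<Sum>x\<in>Sites n. (?v x)\<^sup>2) + real (card (Sites n)) * (2 * e\<^sup>2)"
      by (simp add: sum.distrib sum_distrib_left)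
    also have "\<dots> \<le> 8 * m\<^sup>2 * (real n * V) + real n * (2 * e\<^sup>2)"
      by (intro add_mono mult_left_mono mult_right_mono V card_Sites_le) auto
    finally have "16 * real l * (\<Sum>x\<in>Sites n. (\<Sum>j=1..l - 1. \<bar>?d x j\<bar>)\<^sup>2) + 2 * real l * m\<^sup>2 * (\<Sum>x\<in>Sites n. (?v x)\<^sup>2)
      \<le> 16 * real l * (8 * m\<^sup>2 * (real n * V) + real n * (2 * e\<^sup>2)) + 2 * real l * m\<^sup>2 * (real n * V)"
      by (intro add_mono mult_left_mono V) auto
    also have "\<dots> = real l * real n * (130 * m\<^sup>2 * V + 32 * e\<^sup>2)" by (simp add: algebra_simps)
    finally show "16 * real l * (\<Sum>x\<in>Sites n. (\<Sum>j=1..l - 1. \<bar>?d x j\<bar>)\<^sup>2) + 2 * real l * m\<^sup>2 * (\<Sum>x\<in>Sites n. (?v x)\<^sup>2)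
      \<le> real l * real n * (130 * m\<^sup>2 * V + 32 * e\<^sup>2)" .
  qed
qed

text \<open>Rows of half the system size: n/l stays bounded, so the variance and the transport term
  are both of order \<open>(Q * S)^2\<close>.\<close>

lemma A4_vanishes:
  assumes \<gamma>: "0 < \<gamma>" and \<theta>: "\<theta> < \<gamma>" "\<theta> < 3/2" and T: "0 < T" and H: "H \<in> test_functions"
    and proc: "\<And>n. markov_process (M n) (X n) (configs n) (nu_half n) (generator \<alpha> \<gamma> \<theta> n)"
  shows "(\<lambda>n. sup_sq_integral (M n) T (\<lambda>s \<omega>. A4 \<gamma> \<theta> n H (X n s \<omega>))) \<longlonglongrightarrow> 0"
proof -
  obtain K1 K2 where K: "0 \<le> K1" "\<And>x y. 0 \<le> x \<Longrightarrow> x \<le> y \<Longrightarrow> y \<le> 1 \<Longrightarrow> \<bar>H y - H x\<bar> \<le> K1 * (y - x)"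
    using test_function_estimates[OF H] by metis
  let ?l = "block_len (1/2)"
  \<comment> \<open>Makes \<gamma> + r at least 3/2, so \<open>S\<close> is at most of order
    \<open>n powr r\<close>; the exponent \<theta> - 3/2 + r is then negative by \<theta> < \<gamma>
    or by \<theta> < 3/2.\<close>
  define r where "r = max 0 (3/2 - \<gamma>)"
  define Q where "Q n = K1 * real n powr (\<theta> - 3/2)" for n
  define S where "S n = (\<Sum>j=1..n. real j powr - \<gamma>)" for n
  define U where "U n = 5 * T\<^sup>2 * (1/8 * (real n * (Q n * real (?l n) powr - \<gamma>))\<^sup>2 + 2 * (real n / real (?l n)) * (Q n * S n)\<^sup>2)
      + 25 * T * (16 * (Q n * S n)\<^sup>2)" for n
  have QS: "(\<lambda>n. Q n * S n) \<longlonglongrightarrow> 0"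
  proof (rule tendsto_sandwich[OF _ _ tendsto_const])
    show "\<forall>\<^sub>F n in sequentially. 0 \<le> Q n * S n"
      using K(1) by (intro always_eventually allI mult_nonneg_nonneg) (auto simp: Q_def S_def intro: sum_nonneg)
    show "\<forall>\<^sub>F n in sequentially. Q n * S n \<le> K1 * zeta_sum (\<gamma> + r) * real n powr (\<theta> - 3/2 + r)"
    proof (intro always_eventually allI)
      fix n
      have "Q n * S n \<le> Q n * (zeta_sum (\<gamma> + r) * real n powr r)"
        unfolding S_def using K(1) by (intro mult_left_mono powr_sum_bound) (auto simp: r_def Q_def)
      then show "Q n * S n \<le> K1 * zeta_sum (\<gamma> + r) * real n powr (\<theta> - 3/2 + r)"
        by (simp add: Q_def powr_add mult_ac)
    qed
    have "(\<lambda>n. real n powr (\<theta> - 3/2 + r)) \<longlonglongrightarrow> 0"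
      using \<theta> by (intro tendsto_neg_powr filterlim_real_sequentially) (auto simp: r_def)
    then show "(\<lambda>n. K1 * zeta_sum (\<gamma> + r) * real n powr (\<theta> - 3/2 + r)) \<longlonglongrightarrow> 0"
      by (rule tendsto_mult_right_zero)
  qed
  have ratio: "(\<lambda>n. real n / real (?l n)) \<longlonglongrightarrow> 2" using block_len_ratio(3)[of "1/2"] by simp
  have far: "(\<lambda>n. real n * (Q n * real (?l n) powr - \<gamma>)) \<longlonglongrightarrow> 0"
  proof -
    have "(\<lambda>n. K1 * ((real n / real (?l n)) powr \<gamma> * real n powr (\<theta> - 1/2 - \<gamma>))) \<longlonglongrightarrow> K1 * (2 powr \<gamma> * 0)"
      using \<theta> by (intro tendsto_intros tendsto_powr ratio tendsto_neg_powr filterlim_real_sequentially) auto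
    moreover have "\<forall>\<^sub>F n in sequentially. K1 * ((real n / real (?l n)) powr \<gamma> * real n powr (\<theta> - 1/2 - \<gamma>)) = real n * (Q n * real (?l n) powr - \<gamma>)"
      using block_len_eventually[of "1/2", simplified] eventually_ge_at_top[of 1]
    proof eventually_elim
      case (elim n)
      have "real n powr \<gamma> * real n powr (\<theta> - 1/2 - \<gamma>) = real n powr (1 + (\<theta> - 3/2))" by (simp add: powr_add[symmetric])
      also have "\<dots> = real n * real n powr (\<theta> - 3/2)" using elim by (simp only: powr_add) simp
      finally have "real n powr \<gamma> * real n powr (\<theta> - 1/2 - \<gamma>) = real n * real n powr (\<theta> - 3/2)" .
      moreover have "(real n / real (?l n)) powr \<gamma> = real n powr \<gamma> * real (?l n) powr - \<gamma>"
        by (simp add: powr_divide powr_minus_divide)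
      ultimately show ?case by (simp add: Q_def mult_ac)
    qed
    ultimately show ?thesis using tendsto_cong by force
  qed
  have "U \<longlonglongrightarrow> 5 * T\<^sup>2 * (1/8 * 0\<^sup>2 + 2 * 2 * 0\<^sup>2) + 25 * T * (16 * 0\<^sup>2)"
    unfolding U_def by (intro tendsto_intros far ratio QS)
  then have U: "(\<lambda>n. ennreal (U n)) \<longlonglongrightarrow> 0"
    using tendsto_ennrealI[of U 0] by simp
  have "\<forall>\<^sub>F n in sequentially. sup_sq_integral (M n) T (\<lambda>s \<omega>. A4 \<gamma> \<theta> n H (X n s \<omega>)) \<le> ennreal (U n)"
    using block_len_eventually[of "1/2", simplified] eventually_ge_at_top[of 1]
  proof eventually_elim
    case (elim n)
    have n: "0 < n" using elim by simp
    have "decomp n (A4 \<gamma> \<theta> n H) (1/8 * (real n * (Q n * real (?l n) powr - \<gamma>))\<^sup>2 + 2 * (real n / real (?l n)) * (Q n * S n)\<^sup>2)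
      (16 * (real n)\<^sup>2 * (Q n * S n)\<^sup>2)"
      unfolding Q_def S_def by (rule A4_decomp) (use elim \<gamma> K block_len_le[of "1/2" n] in auto)
    from decomp_sup_sq_integral[OF proc \<gamma> n T this] show ?case
      using n by (simp add: U_def)
  qed
  then show ?thesis
    by (intro tendsto_sandwich[OF _ _ tendsto_const U]) auto
qed

text \<open>At block length \<epsilon> n the variance part \<open>A\<close> tends to 0, and the
  transport cost divided by \<open>n^2\<close> tends to \<epsilon> times \<open>130 * m^2\<close>
  times the squared norm; 3250 = 25 * 130.\<close>

lemma A4_remainder_limsup:
  assumes \<gamma>: "3/2 < \<gamma>" and T: "0 < T" and H: "H \<in> test_functions" and \<epsilon>: "0 < \<epsilon>" "\<epsilon> \<le> 1/2"
    and proc: "\<And>n. markov_process (M n) (X n) (configs n) (nu_half n) (generator \<alpha> \<gamma> (3/2) n)"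
  shows "limsup (\<lambda>n. sup_sq_integral (M n) T (\<lambda>s \<omega>. A4_remainder \<gamma> (3/2) \<epsilon> n H (X n s \<omega>)))
    \<le> ennreal (3250 * (mean_jump \<gamma>)\<^sup>2 * T * \<epsilon> * L2_norm_sq (D01 H))"
proof -
  obtain K1 K2 where K: "0 \<le> K1" "0 \<le> K2" "\<And>x. x \<in> {0..1} \<Longrightarrow> \<bar>D01 H x\<bar> \<le> K1"
    "\<And>x y. 0 \<le> x \<Longrightarrow> x \<le> y \<Longrightarrow> y \<le> 1 \<Longrightarrow> \<bar>H y - H x\<bar> \<le> K1 * (y - x)"
    "\<And>x y u. 0 \<le> x \<Longrightarrow> x \<le> u \<Longrightarrow> u \<le> y \<Longrightarrow> y \<le> 1 \<Longrightarrow> \<bar>H y - H x - (y - x) * D01 H u\<bar> \<le> K2 * (y - x)\<^sup>2"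
    using test_function_estimates[OF H] by metis
  let ?l = "block_len \<epsilon>"
  define m where "m = zeta_sum \<gamma>"
  define Z where "Z = zeta_sum (\<gamma> - 1/4)"
  define e where "e n = K2 * zeta_sum (\<gamma> - 1/2) * real n powr - (1/2)" for n
  define V where "V n = (\<Sum>k=1..n. 1 / real n * (D01 H (real k / real n))\<^sup>2)" for n
  have m: "mean_jump \<gamma> = m" using \<gamma> by (simp add: m_def mean_jump_eq)
  define A where "A n = 1/8 * (real n * (K1 * real (?l n) powr - \<gamma>))\<^sup>2
      + (6 * (K1 * Z)\<^sup>2 * (real n / real (?l n) * real (?l n) powr - (1/2) + 2 * real (?l n) powr - (1/2))
      + real n / real (?l n) * (6 * (K1 * m)\<^sup>2 * (1 / real (?l n))\<^sup>2 + 6 * (e n)\<^sup>2))" for n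
  define U where "U n = 5 * T\<^sup>2 * A n + 25 * T * (real (?l n) / real n * (130 * m\<^sup>2 * V n + 32 * (e n)\<^sup>2))" for n
  have lim: "filterlim (\<lambda>n. real (?l n)) at_top sequentially" and r1: "(\<lambda>n. real (?l n) / real n) \<longlonglongrightarrow> \<epsilon>"
    and r2: "(\<lambda>n. real n / real (?l n)) \<longlonglongrightarrow> 1 / \<epsilon>"
    using block_len_ratio[OF \<epsilon>(1)] by auto
  have lh: "(\<lambda>n. real (?l n) powr - (1/2)) \<longlonglongrightarrow> 0" by (intro tendsto_neg_powr lim) simp
  have li: "(\<lambda>n. 1 / real (?l n)) \<longlonglongrightarrow> 0"
    using tendsto_inverse_0_at_top[OF lim] by (simp add: divide_inverse)
  have e: "e \<longlonglongrightarrow> 0"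
    unfolding e_def[abs_def] by (intro tendsto_mult_right_zero tendsto_neg_powr filterlim_real_sequentially) simp
  have far: "(\<lambda>n. real n * (K1 * real (?l n) powr - \<gamma>)) \<longlonglongrightarrow> 0"
  proof -
    have "(\<lambda>n. K1 * (real n / real (?l n) * real (?l n) powr (1 - \<gamma>))) \<longlonglongrightarrow> K1 * (1 / \<epsilon> * 0)"
      using \<gamma> by (intro tendsto_intros r2 tendsto_neg_powr lim) auto
    moreover have "\<forall>\<^sub>F n in sequentially. K1 * (real n / real (?l n) * real (?l n) powr (1 - \<gamma>)) = real n * (K1 * real (?l n) powr - \<gamma>)"
      using block_len_eventually[OF \<epsilon>(1)]
    proof eventually_elim
      case (elim n)
      have "real (?l n) powr (1 + - \<gamma>) = real (?l n) * real (?l n) powr - \<gamma>"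
        using elim by (simp only: powr_add) simp
      then show ?case using elim by simp
    qed
    ultimately show ?thesis using tendsto_cong by force
  qed
  have "A \<longlonglongrightarrow> 1/8 * 0\<^sup>2 + (6 * (K1 * Z)\<^sup>2 * (1 / \<epsilon> * 0 + 2 * 0) + 1 / \<epsilon> * (6 * (K1 * m)\<^sup>2 * 0\<^sup>2 + 6 * 0\<^sup>2))"
    unfolding A_def by (intro tendsto_intros far r2 lh li e)
  then have A: "A \<longlonglongrightarrow> 0" by simp
  have V: "V \<longlonglongrightarrow> L2_norm_sq (D01 H)" unfolding V_def by (rule riemann_test_function[OF H])
  have "U \<longlonglongrightarrow> 5 * T\<^sup>2 * 0 + 25 * T * (\<epsilon> * (130 * m\<^sup>2 * L2_norm_sq (D01 H) + 32 * 0\<^sup>2))"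
    unfolding U_def by (intro tendsto_intros A r1 V e)
  moreover have "5 * T\<^sup>2 * 0 + 25 * T * (\<epsilon> * (130 * m\<^sup>2 * L2_norm_sq (D01 H) + 32 * 0\<^sup>2))
      = 3250 * (mean_jump \<gamma>)\<^sup>2 * T * \<epsilon> * L2_norm_sq (D01 H)"
    by (simp add: m)
  ultimately have U: "(\<lambda>n. ennreal (U n)) \<longlonglongrightarrow> ennreal (3250 * (mean_jump \<gamma>)\<^sup>2 * T * \<epsilon> * L2_norm_sq (D01 H))"
    by (intro tendsto_ennrealI) (simp only:)
  have "\<forall>\<^sub>F n in sequentially. sup_sq_integral (M n) T (\<lambda>s \<omega>. A4_remainder \<gamma> (3/2) \<epsilon> n H (X n s \<omega>)) \<le> ennreal (U n)"
    using block_len_eventually[OF \<epsilon>(1)] eventually_ge_at_top[of 1]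
  proof eventually_elim
    case (elim n)
    have n: "0 < n" using elim by simp
    have "decomp n (\<lambda>\<eta>. A4 \<gamma> (3/2) n H \<eta> + m * block_field n (?l n) H \<eta>) (A n)
      (real (?l n) * real n * (130 * m\<^sup>2 * V n + 32 * (e n)\<^sup>2))"
      unfolding A_def m_def Z_def V_def e_def
      by (rule A4_remainder_decomp) (use elim \<gamma> K block_len_le[OF \<epsilon>(2)] in auto)
    then have "decomp n (A4_remainder \<gamma> (3/2) \<epsilon> n H) (A n) (real (?l n) * real n * (130 * m\<^sup>2 * V n + 32 * (e n)\<^sup>2))"
      by (rule decomp_cong) (simp_all add: A4_remainder_def m)
    from decomp_sup_sq_integral[OF proc _ n T this] have "sup_sq_integral (M n) T (\<lambda>s \<omega>. A4_remainder \<gamma> (3/2) \<epsilon> n H (X n s \<omega>))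
      \<le> ennreal (5 * T\<^sup>2 * A n + 25 * T * (real (?l n) * real n * (130 * m\<^sup>2 * V n + 32 * (e n)\<^sup>2) / (real n)\<^sup>2))"
      using \<gamma> by simp
    also have "real (?l n) * real n * (130 * m\<^sup>2 * V n + 32 * (e n)\<^sup>2) / (real n)\<^sup>2
      = real (?l n) / real n * (130 * m\<^sup>2 * V n + 32 * (e n)\<^sup>2)"
      using n by (simp add: power2_eq_square)
    finally show ?case by (simp only: U_def)
  qed
  then have "limsup (\<lambda>n. sup_sq_integral (M n) T (\<lambda>s \<omega>. A4_remainder \<gamma> (3/2) \<epsilon> n H (X n s \<omega>))) \<le> limsup (\<lambda>n. ennreal (U n))"
    by (rule Limsup_mono)
  also have "\<dots> = ennreal (3250 * (mean_jump \<gamma>)\<^sup>2 * T * \<epsilon> * L2_norm_sq (D01 H))"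
    by (intro lim_imp_Limsup U) auto
  finally show ?thesis .
qed

theorem proposition3p3:
  fixes \<alpha> \<gamma> \<theta> :: real
    and M :: "nat \<Rightarrow> 'a measure"
    and X :: "nat \<Rightarrow> real \<Rightarrow> 'a \<Rightarrow> config"
  assumes "\<alpha> > 0" and "\<gamma> > 0" and "\<theta> > 0"
    and "\<alpha> > 2" and "\<theta> < min \<gamma> 2"
    and "\<And>n. markov_process (M n) (X n) (configs n) (nu_half n) (generator \<alpha> \<gamma> \<theta> n)"
  shows "(\<theta> < 3/2 \<longrightarrow>
            (\<forall>T>0. \<forall>H\<in>test_functions.
               (\<lambda>n. sup_sq_integral (M n) T (\<lambda>s \<omega>. A4 \<gamma> \<theta> n H (X n s \<omega>))) \<longlonglongrightarrow> 0))
       \<and> (\<theta> = 3/2 \<longrightarrow>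
            (\<exists>C :: real. \<forall>T>0. \<forall>H\<in>test_functions. \<forall>\<epsilon>. 0 < \<epsilon> \<and> \<epsilon> \<le> 1/2 \<longrightarrow>
               limsup (\<lambda>n. sup_sq_integral (M n) T (\<lambda>s \<omega>. A4_remainder \<gamma> \<theta> \<epsilon> n H (X n s \<omega>)))
                 \<le> ennreal (C * T * \<epsilon> * L2_norm_sq (D01 H))))"
proof (intro conjI impI)
  assume \<theta>: "\<theta> < 3/2"
  show "\<forall>T>0. \<forall>H\<in>test_functions.
     (\<lambda>n. sup_sq_integral (M n) T (\<lambda>s \<omega>. A4 \<gamma> \<theta> n H (X n s \<omega>))) \<longlonglongrightarrow> 0"
    using assms \<theta> by (intro allI impI ballI A4_vanishes[where \<alpha>=\<alpha>]) auto
next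
  assume \<theta>: "\<theta> = 3/2"
  \<comment> \<open>Here \<theta> < \<gamma> makes the mean jump a convergent series, with exponent
    to spare for the tail estimates.\<close>
  have \<gamma>: "3/2 < \<gamma>" using assms(5) \<theta> by simp
  show "\<exists>C :: real. \<forall>T>0. \<forall>H\<in>test_functions. \<forall>\<epsilon>. 0 < \<epsilon> \<and> \<epsilon> \<le> 1/2 \<longrightarrow>
      limsup (\<lambda>n. sup_sq_integral (M n) T (\<lambda>s \<omega>. A4_remainder \<gamma> \<theta> \<epsilon> n H (X n s \<omega>)))
        \<le> ennreal (C * T * \<epsilon> * L2_norm_sq (D01 H))"
    unfolding \<theta> using assms(6) \<gamma>
    by (intro exI[of _ "3250 * (mean_jump \<gamma>)\<^sup>2"] allI impI ballI A4_remainder_limsup[where \<alpha>=\<alpha>]) (auto simp: \<theta>)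
qed

end
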